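(* Let $\tau$ be a finite relational vocabulary, let $(\mathcal{C}_+,\mathcal{C}_-,\mathcal{C}_0)$ be a Turing classification of finite $\tau$-models, and let $\mathrm{TM}$ be a Turing machine that witnesses this classification. Then there exists a sentence $\varphi_{\mathrm{TM}}$ of $\mathcal{L}(\tau)$ such that for all finite $\tau$-models $\mathfrak{A}$: $\mathfrak{A}\models^+\varphi_{\mathrm{TM}}$ iff $\mathfrak{A}\in\mathcal{C}_+$, and $\mathfrak{A}\models^-\varphi_{\mathrm{TM}}$ iff $\mathfrak{A}\in\mathcal{C}_-$.
   Context: Encodings. Let $\tau$ be a finite relational vocabulary with a fixed ordering $R_1,\dots,R_p$ of its symbols, and let $\mathfrak{A}$ be a finite $\tau$-structure with a linear order $<$ on its domain $A$. For a $k$-ary $R\in\tau$, $\mathit{enc}(R^{\mathfrak{A}})$ is the binary string of length $|A|^k$ whose $i$-th bit is $1$ iff the $i$-th tuple of $A^k$ in the lexicographic order induced by $<$ belongs to $R^{\mathfrak{A}}$. Then $\mathit{enc}(\mathfrak{A}) = 0^{|A|}\,1\,\mathit{enc}(R_1^{\mathfrak{A}})\cdots\mathit{enc}(R_p^{\mathfrak{A}})$ (depending on $<$ and on the ordering of $\tau$). Turing classification. Let $\mathcal{C}$ be the class of all finite $\tau$-models and let $\mathcal{C}_+,\mathcal{C}_-,\mathcal{C}_0$ be pairwise disjoint, isomorphism-closed subclasses with union $\mathcal{C}$. $(\mathcal{C}_+,\mathcal{C}_-,\mathcal{C}_0)$ is a Turing classification if there is a Turing machine $\mathrm{TM}$ (said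 to witness it) with input alphabet $\{0,1\}$ that rejects every input string not of the form $\mathit{enc}(\mathfrak{A})$ for a finite $\tau$-structure $\mathfrak{A}$, and an ordering $<^\tau$ of $\tau$ such that: for every $\mathfrak{A}\in\mathcal{C}$, any two encodings of $\mathfrak{A}$ using $<^\tau$ (possibly with different orders of $A$) are either both accepted, both rejected, or both diverged on by $\mathrm{TM}$; and for every encoding $\mathit{enc}(\mathfrak{A})$ using $<^\tau$, $\mathrm{TM}$ accepts it iff $\mathfrak{A}\in\mathcal{C}_+$, rejects it iff $\mathfrak{A}\in\mathcal{C}_-$, and diverges on it iff $\mathfrak{A}\in\mathcal{C}_0$. ("Accepts" = halts in an accepting state, "rejects" = halts in a rejecting state.) The logic $\mathcal{L}(\sigma)$ (for a relational vocabulary $\sigma$). There are first-order variables $x,y,\dots$ and, for each $k\ge1$, countably many $k$-ary relation variables $X$. Formulae of $\mathcal{L}^*(\sigma)$ are built by: atoms $R(x_1,\dots,x_k)$ ($R\in\sigma$ $k$-ary), $X(x_1,\dots,x_k)$ ($X$ a $k$-ary relation variable), $x=y$, and $k$ for each natural number $k$ (a "jump atom"); and if $\varphi,\psi$ are formulae then so are $\neg\varphi$, $(\varphi\wedge\psi)$, $\exists x\,\varphi$, $Ix\,\varphi$, $I_{Rx_1\dots x_k}\varphi$, $I_{Xx_1\dots x_k}\varphi$, $D_{Rx_1\dots x_k}\varphi$, $D_{Xx_1\dots x_k}\varphi$ (for $R\in\sigma$ or $X$ a relation variable, $k$-ary), and $k\varphi$ for $k\in\mathbb{N}$. Every occurrence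 of a subformula counts as a distinct subformula. A formula has a non-standard jump if it contains an atomic subformula (occurrence) $k$ and a subformula $k\psi$ such that this occurrence of $k$ is not a subformula of $k\psi$; $\mathcal{L}(\sigma)$ is the set of formulae of $\mathcal{L}^*(\sigma)$ without non-standard jumps. Free variables are defined as usual, where $\exists x$ and $Ix$ bind $x$, $I_{Rx_1\dots x_k}$ and $D_{Rx_1\dots x_k}$ bind $x_1,\dots,x_k$, $I_{Xx_1\dots x_k}$ and $D_{Xx_1\dots x_k}$ bind $X,x_1,\dots,x_k$, jump atoms $k$ have no free variables, $X(x_1,\dots,x_k)$ has free variables $X,x_1,\dots,x_k$, and $k\varphi$ has the free variables of $\varphi$. A sentence has no free variables. Semantics. For a $\sigma$-model $\mathfrak{A}$, an assignment $f$ (of elements to first-order variables and $k$-ary relations on the domain to $k$-ary relation variables) covering the free variables of $\varphi$, and $\#\in\{+,-\}$, the game $G(\mathfrak{A},f,\#,\varphi)$ between players $\exists$ and $\forall$ has positions $(\mathfrak{B},g,\#',\psi)$ and starts at $(\mathfrak{A},f,\#,\varphi)$. Call the "verifier" at a position $\exists$ if $\#'=+$ and $\forall$ if $\#'=-$, and the other player the "falsifier". Moves: from $\neg\psi$ go to $(\mathfrak{B},g,\#'',\psi)$ with $\#''$ the opposite sign; from $(\psi\wedge\psi')$ the falsifier picks one conjunct; from $\exists x\psi$ the verifier picks $b\in B$ and play goes to $(\mathfrak{B},g[x\mapsto b],\#',\psi)$; from $Ix\,\psi$ play goes to $(\mathfrak{C},g[x\mapsto b],\#',\psi)$ where $\mathfrak{C}$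 is $\mathfrak{B}$ with one fresh isolated element $b$ added to the domain (all relations unchanged); from $I_{Rx_1\dots x_k}\psi$ (resp. $D_{Rx_1\dots x_k}\psi$) the verifier picks $(b_1,\dots,b_k)\in B^k$ and play goes to $(\mathfrak{B}^*,g[x_1\mapsto b_1,\dots,x_k\mapsto b_k],\#',\psi)$ where $\mathfrak{B}^*$ is $\mathfrak{B}$ with $(b_1,\dots,b_k)$ added to (resp. removed from) $R$; from $I_{Xx_1\dots x_k}\psi$ (resp. $D_{Xx_1\dots x_k}\psi$) the verifier picks $(b_1,\dots,b_k)\in B^k$ and play goes to $(\mathfrak{B},g[x_1\mapsto b_1,\dots,x_k\mapsto b_k,X\mapsto C\cup\{(b_1,\dots,b_k)\}],\#',\psi)$ (resp. $C\setminus\{(b_1,\dots,b_k)\}$), where $C=g(X)$ if $X$ is in the domain of $g$ and $C=\emptyset$ otherwise; from $k\psi$ play goes to $(\mathfrak{B},g,\#',\psi)$; at a jump atom $k$, if the original formula $\varphi$ has some subformula of the form $k\chi$, the verifier chooses such a subformula $k\chi$ of $\varphi$ and play continues from $(\mathfrak{B},g,\#',k\chi)$, otherwise the play ends and the falsifier wins. At atoms $R(\bar x)$, $X(\bar x)$, $x=y$ the play ends: if $\#'=+$, $\exists$ wins iff the atom holds in $(\mathfrak{B},g)$ in the usual first-order sense (else $\forall$ wins); if $\#'=-$, $\forall$ wins iff the atom holds (else $\exists$ wins). Plays last at most $\omega$ rounds; an infinite play is won by neither player. A strategy is winning for a player if every play following it ends after finitely many rounds in a win for that player. $\mathfrak{A}\models^+\varphi$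 (for a sentence $\varphi$) iff $\exists$ has a winning strategy in $G(\mathfrak{A},\emptyset,+,\varphi)$, and $\mathfrak{A}\models^-\varphi$ iff $\exists$ has a winning strategy in $G(\mathfrak{A},\emptyset,-,\varphi)$, where $\emptyset$ is the empty assignment. *)

theory Defs
  imports "HOL-Library.Infinite_Typeclass" "HOL-Library.Sublist"
begin

section \<open>Finite relational structures and their encodings\<close>

text \<open>
  A relational vocabulary is a set \<open>\<tau>\<close> of symbols together with an arity function \<open>ar\<close>.
  Elements of structures come from an infinite type, so that fresh elements can always be added.
\<close>

record ('a, 'r) model =
  univ :: "'a set"
  interp :: "'r \<Rightarrow> 'a list set"

definition tuples :: "nat \<Rightarrow> 'a set \<Rightarrow> 'a list set" where
  "tuples k A = {xs. length xs = k \<and> set xs \<subseteq> A}"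

text \<open>Domains are nonempty; symbols outside the vocabulary get the dummy interpretation \<open>{}\<close>.\<close>

definition finite_model :: "'r set \<Rightarrow> ('r \<Rightarrow> nat) \<Rightarrow> ('a, 'r) model \<Rightarrow> bool" where
  "finite_model \<tau> ar \<AA> \<longleftrightarrow>
     finite (univ \<AA>) \<and> univ \<AA> \<noteq> {} \<and>
     (\<forall>R\<in>\<tau>. interp \<AA> R \<subseteq> tuples (ar R) (univ \<AA>)) \<and>
     (\<forall>R. R \<notin> \<tau> \<longrightarrow> interp \<AA> R = {})"

definition isomorphic ::
  "'r set \<Rightarrow> ('r \<Rightarrow> nat) \<Rightarrow> ('a, 'r) model \<Rightarrow> ('a, 'r) model \<Rightarrow> bool" where
  "isomorphic \<tau> ar \<AA> \<BB> \<longleftrightarrow>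
     (\<exists>h. bij_betw h (univ \<AA>) (univ \<BB>) \<and>
        (\<forall>R\<in>\<tau>. \<forall>t\<in>tuples (ar R) (univ \<AA>). t \<in> interp \<AA> R \<longleftrightarrow> map h t \<in> interp \<BB> R))"

definition iso_closed ::
  "'r set \<Rightarrow> ('r \<Rightarrow> nat) \<Rightarrow> ('a, 'r) model set \<Rightarrow> bool" where
  "iso_closed \<tau> ar \<C> \<longleftrightarrow>
     (\<forall>\<AA>\<in>\<C>. \<forall>\<BB>. finite_model \<tau> ar \<BB> \<and> isomorphic \<tau> ar \<AA> \<BB> \<longrightarrow> \<BB> \<in> \<C>)"

text \<open>
  An ordering of a finite set is given by the list of its elements in increasing order.
  With respect to it, \<^term>\<open>product_lists (replicate k as)\<close> lists the \<open>k\<close>-tuples over \<open>as\<close>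
  in lexicographic order.
\<close>

definition ordering_of :: "'b list \<Rightarrow> 'b set \<Rightarrow> bool" where
  "ordering_of as A \<longleftrightarrow> distinct as \<and> set as = A"

definition enc_rel :: "'a list \<Rightarrow> nat \<Rightarrow> 'a list set \<Rightarrow> bool list" where
  "enc_rel as k R = map (\<lambda>t. t \<in> R) (product_lists (replicate k as))"

definition enc ::
  "('r \<Rightarrow> nat) \<Rightarrow> 'r list \<Rightarrow> ('a, 'r) model \<Rightarrow> 'a list \<Rightarrow> bool list" where
  "enc ar Rs \<AA> as =
     replicate (length as) False @ [True] @
     concat (map (\<lambda>R. enc_rel as (ar R) (interp \<AA> R)) Rs)"

section \<open>Turing machines and Turing classifications\<close>

text \<open>
  Deterministic machines with one two-way infinite tape. As state sets and tape alphabets are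
  finite, naming states and auxiliary tape symbols by natural numbers is no restriction.
\<close>

datatype tsym = Blank | Bit bool | Aux nat

datatype dir = MoveL | MoveR | Stay

record tm =
  states :: "nat set"
  alphabet :: "tsym set"
  delta :: "nat \<Rightarrow> tsym \<Rightarrow> nat \<times> tsym \<times> dir"
  start :: nat
  acc :: "nat set"
  rej :: "nat set"

definition wf_tm :: "tm \<Rightarrow> bool" where
  "wf_tm M \<longleftrightarrow>
     finite (states M) \<and> finite (alphabet M) \<and>
     {Blank, Bit False, Bit True} \<subseteq> alphabet M \<and>
     start M \<in> states M \<and> acc M \<subseteq> states M \<and> rej M \<subseteq> states M \<and> acc M \<inter> rej M = {} \<and>
     (\<forall>q \<in> states M - (acc M \<union> rej M). \<forall>a \<in> alphabet M.
        delta M q a \<in> states M \<times> alphabet M \<times> UNIV)"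

text \<open>A configuration consists of state, tape contents and head position.\<close>

type_synonym config = "nat \<times> (int \<Rightarrow> tsym) \<times> int"

definition init_config :: "tm \<Rightarrow> bool list \<Rightarrow> config" where
  "init_config M w =
     (start M,
      (\<lambda>i. if 0 \<le> i \<and> i < int (length w) then Bit (w ! nat i) else Blank),
      0)"

fun shift :: "dir \<Rightarrow> int" where
  "shift MoveL = -1"
| "shift MoveR = 1"
| "shift Stay = 0"

text \<open>Halted configurations repeat forever.\<close>

fun tm_step :: "tm \<Rightarrow> config \<Rightarrow> config" where
  "tm_step M (q, t, h) =
     (if q \<in> acc M \<union> rej M then (q, t, h)
      else case delta M q (t h) of (q', a, d) \<Rightarrow> (q', t(h := a), h + shift d))"

definition tm_state :: "tm \<Rightarrow> bool list \<Rightarrow> nat \<Rightarrow> nat" where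
  "tm_state M w n = fst ((tm_step M ^^ n) (init_config M w))"

definition accepts :: "tm \<Rightarrow> bool list \<Rightarrow> bool" where
  "accepts M w \<longleftrightarrow> (\<exists>n. tm_state M w n \<in> acc M)"

definition rejects :: "tm \<Rightarrow> bool list \<Rightarrow> bool" where
  "rejects M w \<longleftrightarrow> (\<exists>n. tm_state M w n \<in> rej M)"

definition diverges :: "tm \<Rightarrow> bool list \<Rightarrow> bool" where
  "diverges M w \<longleftrightarrow> (\<forall>n. tm_state M w n \<notin> acc M \<union> rej M)"

definition witnesses ::
  "'r set \<Rightarrow> ('r \<Rightarrow> nat) \<Rightarrow>
   ('a::infinite, 'r) model set \<Rightarrow> ('a, 'r) model set \<Rightarrow> ('a, 'r) model set \<Rightarrow> tm \<Rightarrow> bool" where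
  "witnesses \<tau> ar Cp Cm C0 M \<longleftrightarrow>
     wf_tm M \<and>
     (\<exists>Rs. ordering_of Rs \<tau> \<and>
        (\<forall>w. \<not> (\<exists>(\<AA> :: ('a, 'r) model) as.
                  finite_model \<tau> ar \<AA> \<and> ordering_of as (univ \<AA>) \<and> w = enc ar Rs \<AA> as)
             \<longrightarrow> rejects M w) \<and>
        (\<forall>(\<AA> :: ('a, 'r) model) as as'.
           finite_model \<tau> ar \<AA> \<and> ordering_of as (univ \<AA>) \<and> ordering_of as' (univ \<AA>) \<longrightarrow>
             accepts M (enc ar Rs \<AA> as) \<and> accepts M (enc ar Rs \<AA> as') \<or>
             rejects M (enc ar Rs \<AA> as) \<and> rejects M (enc ar Rs \<AA> as') \<or>
             diverges M (enc ar Rs \<AA> as) \<and> diverges M (enc ar Rs \<AA> as')) \<and>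
        (\<forall>(\<AA> :: ('a, 'r) model) as.
           finite_model \<tau> ar \<AA> \<and> ordering_of as (univ \<AA>) \<longrightarrow>
             (accepts M (enc ar Rs \<AA> as) \<longleftrightarrow> \<AA> \<in> Cp) \<and>
             (rejects M (enc ar Rs \<AA> as) \<longleftrightarrow> \<AA> \<in> Cm) \<and>
             (diverges M (enc ar Rs \<AA> as) \<longleftrightarrow> \<AA> \<in> C0)))"

definition turing_classification ::
  "'r set \<Rightarrow> ('r \<Rightarrow> nat) \<Rightarrow>
   ('a::infinite, 'r) model set \<Rightarrow> ('a, 'r) model set \<Rightarrow> ('a, 'r) model set \<Rightarrow> bool" where
  "turing_classification \<tau> ar Cp Cm C0 \<longleftrightarrow>
     Cp \<inter> Cm = {} \<and> Cp \<inter> C0 = {} \<and> Cm \<inter> C0 = {} \<and>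
     Cp \<union> Cm \<union> C0 = Collect (finite_model \<tau> ar) \<and>
     iso_closed \<tau> ar Cp \<and> iso_closed \<tau> ar Cm \<and> iso_closed \<tau> ar C0 \<and>
     (\<exists>M. witnesses \<tau> ar Cp Cm C0 M)"

section \<open>Syntax of the logic\<close>

text \<open>First-order variables are natural numbers. A relation variable carries its arity.\<close>

datatype relvar = RV (rv_arity: nat) (rv_index: nat)

datatype 'r fm =
    Rel 'r "nat list"
  | RVar relvar "nat list"
  | Eq nat nat
  | Jump nat
  | Neg "'r fm"
  | Conj "'r fm" "'r fm"
  | Exi nat "'r fm"
  | InsEl nat "'r fm"
  | InsRel 'r "nat list" "'r fm"
  | InsVar relvar "nat list" "'r fm"
  | DelRel 'r "nat list" "'r fm"
  | DelVar relvar "nat list" "'r fm"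
  | Lab nat "'r fm"  \<comment> \<open>the formula \<open>k\<phi>\<close>\<close>

text \<open>
  The variables bound by an insertion or deletion operator are pairwise distinct, since they are
  assigned simultaneously.
\<close>

fun wf_fm :: "'r set \<Rightarrow> ('r \<Rightarrow> nat) \<Rightarrow> 'r fm \<Rightarrow> bool" where
  "wf_fm \<sigma> ar (Rel R xs) \<longleftrightarrow> R \<in> \<sigma> \<and> length xs = ar R"
| "wf_fm \<sigma> ar (RVar X xs) \<longleftrightarrow> 1 \<le> rv_arity X \<and> length xs = rv_arity X"
| "wf_fm \<sigma> ar (Eq x y) \<longleftrightarrow> True"
| "wf_fm \<sigma> ar (Jump k) \<longleftrightarrow> True"
| "wf_fm \<sigma> ar (Neg \<phi>) \<longleftrightarrow> wf_fm \<sigma> ar \<phi>"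
| "wf_fm \<sigma> ar (Conj \<phi> \<psi>) \<longleftrightarrow> wf_fm \<sigma> ar \<phi> \<and> wf_fm \<sigma> ar \<psi>"
| "wf_fm \<sigma> ar (Exi x \<phi>) \<longleftrightarrow> wf_fm \<sigma> ar \<phi>"
| "wf_fm \<sigma> ar (InsEl x \<phi>) \<longleftrightarrow> wf_fm \<sigma> ar \<phi>"
| "wf_fm \<sigma> ar (InsRel R xs \<phi>) \<longleftrightarrow>
     R \<in> \<sigma> \<and> length xs = ar R \<and> distinct xs \<and> wf_fm \<sigma> ar \<phi>"
| "wf_fm \<sigma> ar (InsVar X xs \<phi>) \<longleftrightarrow>
     1 \<le> rv_arity X \<and> length xs = rv_arity X \<and> distinct xs \<and> wf_fm \<sigma> ar \<phi>"
| "wf_fm \<sigma> ar (DelRel R xs \<phi>) \<longleftrightarrow>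
     R \<in> \<sigma> \<and> length xs = ar R \<and> distinct xs \<and> wf_fm \<sigma> ar \<phi>"
| "wf_fm \<sigma> ar (DelVar X xs \<phi>) \<longleftrightarrow>
     1 \<le> rv_arity X \<and> length xs = rv_arity X \<and> distinct xs \<and> wf_fm \<sigma> ar \<phi>"
| "wf_fm \<sigma> ar (Lab k \<phi>) \<longleftrightarrow> wf_fm \<sigma> ar \<phi>"

fun children :: "'r fm \<Rightarrow> 'r fm list" where
  "children (Rel R xs) = []"
| "children (RVar X xs) = []"
| "children (Eq x y) = []"
| "children (Jump k) = []"
| "children (Neg \<phi>) = [\<phi>]"
| "children (Conj \<phi> \<psi>) = [\<phi>, \<psi>]"
| "children (Exi x \<phi>) = [\<phi>]"
| "children (InsEl x \<phi>) = [\<phi>]"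
| "children (InsRel R xs \<phi>) = [\<phi>]"
| "children (InsVar X xs \<phi>) = [\<phi>]"
| "children (DelRel R xs \<phi>) = [\<phi>]"
| "children (DelVar X xs \<phi>) = [\<phi>]"
| "children (Lab k \<phi>) = [\<phi>]"

text \<open>
  A path \<open>p\<close> for which \<open>sub_at \<phi> p\<close> is defined is an occurrence of a subformula of \<open>\<phi>\<close>;
  the occurrence \<open>p\<close> lies within the occurrence \<open>q\<close> iff \<open>q\<close> is a prefix of \<open>p\<close>.
\<close>

fun sub_at :: "'r fm \<Rightarrow> nat list \<Rightarrow> 'r fm option" where
  "sub_at \<phi> [] = Some \<phi>"
| "sub_at \<phi> (i # p) = (if i < length (children \<phi>) then sub_at (children \<phi> ! i) p else None)"

definition nonstandard_jump :: "'r fm \<Rightarrow> bool" where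
  "nonstandard_jump \<phi> \<longleftrightarrow>
     (\<exists>k p q \<psi>. sub_at \<phi> p = Some (Jump k) \<and> sub_at \<phi> q = Some (Lab k \<psi>) \<and> \<not> prefix q p)"

definition logic_L :: "'r set \<Rightarrow> ('r \<Rightarrow> nat) \<Rightarrow> 'r fm set" where
  "logic_L \<sigma> ar = {\<phi>. wf_fm \<sigma> ar \<phi> \<and> \<not> nonstandard_jump \<phi>}"

fun free_fo :: "'r fm \<Rightarrow> nat set" where
  "free_fo (Rel R xs) = set xs"
| "free_fo (RVar X xs) = set xs"
| "free_fo (Eq x y) = {x, y}"
| "free_fo (Jump k) = {}"
| "free_fo (Neg \<phi>) = free_fo \<phi>"
| "free_fo (Conj \<phi> \<psi>) = free_fo \<phi> \<union> free_fo \<psi>"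
| "free_fo (Exi x \<phi>) = free_fo \<phi> - {x}"
| "free_fo (InsEl x \<phi>) = free_fo \<phi> - {x}"
| "free_fo (InsRel R xs \<phi>) = free_fo \<phi> - set xs"
| "free_fo (InsVar X xs \<phi>) = free_fo \<phi> - set xs"
| "free_fo (DelRel R xs \<phi>) = free_fo \<phi> - set xs"
| "free_fo (DelVar X xs \<phi>) = free_fo \<phi> - set xs"
| "free_fo (Lab k \<phi>) = free_fo \<phi>"

fun free_rel :: "'r fm \<Rightarrow> relvar set" where
  "free_rel (Rel R xs) = {}"
| "free_rel (RVar X xs) = {X}"
| "free_rel (Eq x y) = {}"
| "free_rel (Jump k) = {}"
| "free_rel (Neg \<phi>) = free_rel \<phi>"
| "free_rel (Conj \<phi> \<psi>) = free_rel \<phi> \<union> free_rel \<psi>"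
| "free_rel (Exi x \<phi>) = free_rel \<phi>"
| "free_rel (InsEl x \<phi>) = free_rel \<phi>"
| "free_rel (InsRel R xs \<phi>) = free_rel \<phi>"
| "free_rel (InsVar X xs \<phi>) = free_rel \<phi> - {X}"
| "free_rel (DelRel R xs \<phi>) = free_rel \<phi>"
| "free_rel (DelVar X xs \<phi>) = free_rel \<phi> - {X}"
| "free_rel (Lab k \<phi>) = free_rel \<phi>"

definition sentence :: "'r fm \<Rightarrow> bool" where
  "sentence \<phi> \<longleftrightarrow> free_fo \<phi> = {} \<and> free_rel \<phi> = {}"

section \<open>Game-theoretic semantics\<close>

datatype sign = Plus | Minus

datatype player = Eloise | Abelard

fun opp :: "sign \<Rightarrow> sign" where
  "opp Plus = Minus"
| "opp Minus = Plus"

fun verifier :: "sign \<Rightarrow> player" where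
  "verifier Plus = Eloise"
| "verifier Minus = Abelard"

definition falsifier :: "sign \<Rightarrow> player" where
  "falsifier s = verifier (opp s)"

record 'a assignment =
  fov :: "nat \<rightharpoonup> 'a"
  rlv :: "relvar \<rightharpoonup> 'a list set"

definition empty_assignment :: "'a assignment" where
  "empty_assignment = \<lparr>fov = Map.empty, rlv = Map.empty\<rparr>"

definition assign :: "'a assignment \<Rightarrow> nat list \<Rightarrow> 'a list \<Rightarrow> 'a assignment" where
  "assign g xs bs = g\<lparr>fov := (fov g)(xs [\<mapsto>] bs)\<rparr>"

definition rel_value :: "'a assignment \<Rightarrow> relvar \<Rightarrow> 'a list set" where
  "rel_value g X = (case rlv g X of Some C \<Rightarrow> C | None \<Rightarrow> {})"

definition set_rel :: "'a assignment \<Rightarrow> relvar \<Rightarrow> 'a list set \<Rightarrow> 'a assignment" where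
  "set_rel g X C = g\<lparr>rlv := (rlv g)(X \<mapsto> C)\<rparr>"

definition vals :: "'a assignment \<Rightarrow> nat list \<Rightarrow> 'a list" where
  "vals g xs = map (\<lambda>x. the (fov g x)) xs"

definition fresh :: "('a::infinite, 'r) model \<Rightarrow> 'a" where
  "fresh \<BB> = (SOME b. b \<notin> univ \<BB>)"

definition insert_element :: "'a \<Rightarrow> ('a, 'r) model \<Rightarrow> ('a, 'r) model" where
  "insert_element b \<BB> = \<BB>\<lparr>univ := insert b (univ \<BB>)\<rparr>"

definition insert_tuple :: "'r \<Rightarrow> 'a list \<Rightarrow> ('a, 'r) model \<Rightarrow> ('a, 'r) model" where
  "insert_tuple R bs \<BB> = \<BB>\<lparr>interp := (interp \<BB>)(R := interp \<BB> R \<union> {bs})\<rparr>"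

definition delete_tuple :: "'r \<Rightarrow> 'a list \<Rightarrow> ('a, 'r) model \<Rightarrow> ('a, 'r) model" where
  "delete_tuple R bs \<BB> = \<BB>\<lparr>interp := (interp \<BB>)(R := interp \<BB> R - {bs})\<rparr>"

type_synonym ('a, 'r) position = "('a, 'r) model \<times> 'a assignment \<times> sign \<times> 'r fm"

text \<open>
  In the following three functions, \<open>\<phi>\<close> is the formula for which the game is played. The set of
  moves from a position is empty exactly where the play ends. Forced moves belong to no player.
\<close>

fun moves :: "'r fm \<Rightarrow> ('a::infinite, 'r) position \<Rightarrow> ('a, 'r) position set" where
  "moves \<phi> (\<BB>, g, s, Rel R xs) = {}"
| "moves \<phi> (\<BB>, g, s, RVar X xs) = {}"
| "moves \<phi> (\<BB>, g, s, Eq x y) = {}"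
| "moves \<phi> (\<BB>, g, s, Jump k) =
     {(\<BB>, g, s, Lab k \<chi>) | p \<chi>. sub_at \<phi> p = Some (Lab k \<chi>)}"
| "moves \<phi> (\<BB>, g, s, Neg \<psi>) = {(\<BB>, g, opp s, \<psi>)}"
| "moves \<phi> (\<BB>, g, s, Conj \<psi> \<chi>) = {(\<BB>, g, s, \<psi>), (\<BB>, g, s, \<chi>)}"
| "moves \<phi> (\<BB>, g, s, Exi x \<psi>) = {(\<BB>, assign g [x] [b], s, \<psi>) | b. b \<in> univ \<BB>}"
| "moves \<phi> (\<BB>, g, s, InsEl x \<psi>) =
     {(insert_element (fresh \<BB>) \<BB>, assign g [x] [fresh \<BB>], s, \<psi>)}"
| "moves \<phi> (\<BB>, g, s, InsRel R xs \<psi>) =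
     {(insert_tuple R bs \<BB>, assign g xs bs, s, \<psi>) | bs. bs \<in> tuples (length xs) (univ \<BB>)}"
| "moves \<phi> (\<BB>, g, s, InsVar X xs \<psi>) =
     {(\<BB>, set_rel (assign g xs bs) X (rel_value g X \<union> {bs}), s, \<psi>) | bs.
        bs \<in> tuples (length xs) (univ \<BB>)}"
| "moves \<phi> (\<BB>, g, s, DelRel R xs \<psi>) =
     {(delete_tuple R bs \<BB>, assign g xs bs, s, \<psi>) | bs. bs \<in> tuples (length xs) (univ \<BB>)}"
| "moves \<phi> (\<BB>, g, s, DelVar X xs \<psi>) =
     {(\<BB>, set_rel (assign g xs bs) X (rel_value g X - {bs}), s, \<psi>) | bs.
        bs \<in> tuples (length xs) (univ \<BB>)}"
| "moves \<phi> (\<BB>, g, s, Lab k \<psi>) = {(\<BB>, g, s, \<psi>)}"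

fun mover :: "('a, 'r) position \<Rightarrow> player option" where
  "mover (\<BB>, g, s, Jump k) = Some (verifier s)"
| "mover (\<BB>, g, s, Conj \<psi> \<chi>) = Some (falsifier s)"
| "mover (\<BB>, g, s, Exi x \<psi>) = Some (verifier s)"
| "mover (\<BB>, g, s, InsRel R xs \<psi>) = Some (verifier s)"
| "mover (\<BB>, g, s, InsVar X xs \<psi>) = Some (verifier s)"
| "mover (\<BB>, g, s, DelRel R xs \<psi>) = Some (verifier s)"
| "mover (\<BB>, g, s, DelVar X xs \<psi>) = Some (verifier s)"
| "mover (\<BB>, g, s, _) = None"

text \<open>
  The last clause below covers jump atoms without a target, where the falsifier wins; it is
  irrelevant for positions from which the play continues.
\<close>

fun winner :: "('a, 'r) position \<Rightarrow> player" where
  "winner (\<BB>, g, s, Rel R xs) =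
     (if vals g xs \<in> interp \<BB> R then verifier s else falsifier s)"
| "winner (\<BB>, g, s, RVar X xs) =
     (if vals g xs \<in> rel_value g X then verifier s else falsifier s)"
| "winner (\<BB>, g, s, Eq x y) =
     (if the (fov g x) = the (fov g y) then verifier s else falsifier s)"
| "winner (\<BB>, g, s, _) = falsifier s"

text \<open>A strategy maps the nonempty history of a play to the next position.\<close>

type_synonym ('a, 'r) strategy = "('a, 'r) position list \<Rightarrow> ('a, 'r) position"

definition strategy_for ::
  "'r fm \<Rightarrow> player \<Rightarrow> ('a::infinite, 'r) strategy \<Rightarrow> bool" where
  "strategy_for \<phi> P \<sigma> \<longleftrightarrow>
     (\<forall>\<pi> p. mover p = Some P \<and> moves \<phi> p \<noteq> {} \<longrightarrow> \<sigma> (\<pi> @ [p]) \<in> moves \<phi> p)"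

definition partial_play ::
  "'r fm \<Rightarrow> player \<Rightarrow> ('a::infinite, 'r) strategy \<Rightarrow> ('a, 'r) position \<Rightarrow>
   ('a, 'r) position list \<Rightarrow> bool" where
  "partial_play \<phi> P \<sigma> p0 \<pi> \<longleftrightarrow>
     \<pi> \<noteq> [] \<and> hd \<pi> = p0 \<and>
     (\<forall>i. Suc i < length \<pi> \<longrightarrow>
        \<pi> ! Suc i \<in> moves \<phi> (\<pi> ! i) \<and>
        (mover (\<pi> ! i) = Some P \<longrightarrow> \<pi> ! Suc i = \<sigma> (take (Suc i) \<pi>)))"

definition winning_strategy ::
  "'r fm \<Rightarrow> player \<Rightarrow> ('a::infinite, 'r) position \<Rightarrow> ('a, 'r) strategy \<Rightarrow> bool" where
  "winning_strategy \<phi> P p0 \<sigma> \<longleftrightarrow>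
     strategy_for \<phi> P \<sigma> \<and>
     (\<forall>\<pi>. partial_play \<phi> P \<sigma> p0 \<pi> \<and> moves \<phi> (last \<pi>) = {} \<longrightarrow> winner (last \<pi>) = P) \<and>
     \<not> (\<exists>\<rho> :: nat \<Rightarrow> ('a, 'r) position. \<forall>n. partial_play \<phi> P \<sigma> p0 (map \<rho> [0..<Suc n]))"

definition sat :: "('a::infinite, 'r) model \<Rightarrow> sign \<Rightarrow> 'r fm \<Rightarrow> bool" where
  "sat \<AA> s \<phi> \<longleftrightarrow> (\<exists>\<sigma>. winning_strategy \<phi> Eloise (\<AA>, empty_assignment, s, \<phi>) \<sigma>)"

abbreviation sat_pos :: "('a::infinite, 'r) model \<Rightarrow> 'r fm \<Rightarrow> bool"  (infix "\<Turnstile>\<^sup>+" 50) where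
  "\<AA> \<Turnstile>\<^sup>+ \<phi> \<equiv> sat \<AA> Plus \<phi>"

abbreviation sat_neg :: "('a::infinite, 'r) model \<Rightarrow> 'r fm \<Rightarrow> bool"  (infix "\<Turnstile>\<^sup>-" 50) where
  "\<AA> \<Turnstile>\<^sup>- \<phi> \<equiv> sat \<AA> Minus \<phi>"

end

theory Submission
  imports Defs "HOL-Library.Countable"
begin

text \<open>
  The sentence is a program with loops. In each step the verifier announces the next data (an
  element, a tuple to insert or delete), and the falsifier may challenge the announcement, in which
  case a first-order guard is evaluated and the play ends. Since the guards determine the
  announcement up to irrelevant choices, neither player can deviate without losing, and the play
  follows the program. The program lists the domain in an arbitrary order, writes the encoding with
  respect to this order on a tape made of freshly inserted elements, and runs the machine on
  it: acceptance is a win for the verifier, rejection for the falsifier, divergence for nobody.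
  States and tape symbols are freshly inserted constants.
\<close>

section \<open>Winning regions\<close>

text \<open>The two signs use one sentence with the roles of the players exchanged, so the program
  has to behave alike whichever player is the verifier; blocks are therefore analysed for both roles
  at once, and only a final true or false atom separates acceptance from rejection. The obstacle is
  that infinite plays are won by nobody: a winning region is a least fixed point, and the two
  directions need different arguments. That Eloise wins only if the machine gives the matching
  answer follows from one predicate closed under the rules of the game, without a look at
  termination; that she does win needs a measure decreasing along the run, demanded only when the
  machine halts. The symbols of the vocabulary are only read; all working data live in four binary
  relation variables, so the input structure can be consulted throughout. The one choice of
  consequence that guards do not remove is the order in which the domain is listed. It is harmless
  because acceptance and rejection depend only on the structure.\<close>

inductive wins :: "'r fm \<Rightarrow> player \<Rightarrow> ('a::infinite, 'r) position \<Rightarrow> bool"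
  for \<phi> P where
  stop: "moves \<phi> p = {} \<Longrightarrow> winner p = P \<Longrightarrow> wins \<phi> P p"
| own: "mover p = Some P \<Longrightarrow> q \<in> moves \<phi> p \<Longrightarrow> wins \<phi> P q \<Longrightarrow> wins \<phi> P p"
| other: "mover p \<noteq> Some P \<Longrightarrow> moves \<phi> p \<noteq> {} \<Longrightarrow> (\<And>q. q \<in> moves \<phi> p \<Longrightarrow> wins \<phi> P q) \<Longrightarrow> wins \<phi> P p"

section \<open>Winning regions and winning strategies agree\<close>

lemma partial_play_ConsD:
  assumes "partial_play \<phi> P \<sigma> p \<pi>"
  obtains \<rho> where "\<pi> = p # \<rho>"
proof
  show "\<pi> = p # tl \<pi>"
    using assms hd_Cons_tl[of \<pi>] by (simp add: partial_play_def)
qed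

lemma partial_play_tl:
  assumes "partial_play \<phi> P \<sigma> p (p # \<pi>)" "\<pi> \<noteq> []"
    and "\<And>\<rho>. \<rho> \<noteq> [] \<Longrightarrow> hd \<rho> = hd \<pi> \<Longrightarrow> \<sigma> (p # \<rho>) = \<sigma>' \<rho>"
  shows "partial_play \<phi> P \<sigma>' (hd \<pi>) \<pi>"
proof -
  have "\<pi> ! Suc i \<in> moves \<phi> (\<pi> ! i) \<and> (mover (\<pi> ! i) = Some P \<longrightarrow> \<pi> ! Suc i = \<sigma>' (take (Suc i) \<pi>))"
    if "Suc i < length \<pi>" for i
  proof -
    have "take (Suc i) \<pi> \<noteq> []" "hd (take (Suc i) \<pi>) = hd \<pi>"
      using assms(2) by simp_all
    with assms(3) have "\<sigma> (take (Suc (Suc i)) (p # \<pi>)) = \<sigma>' (take (Suc i) \<pi>)"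
      by (simp del: take_Suc_Cons add: take_Suc_Cons[of "Suc i"])
    moreover have "Suc (Suc i) < length (p # \<pi>)" using that by simp
    ultimately show ?thesis
      using assms(1) unfolding partial_play_def by (metis nth_Cons_Suc)
  qed
  with assms(2) show ?thesis by (simp add: partial_play_def)
qed

lemma partial_play_step:
  assumes "partial_play \<phi> P \<sigma> p (p # \<pi>)" "\<pi> \<noteq> []"
  shows "hd \<pi> \<in> moves \<phi> p" "mover p = Some P \<Longrightarrow> hd \<pi> = \<sigma> [p]"
  using assms by (auto simp: partial_play_def hd_conv_nth dest: spec[of _ 0])

text \<open>Gluing: after the first move, the history without \<open>p\<close> is a history of a
  play from the chosen successor, and the strategy for that successor takes over. If
  \<open>P\<close> moves, any nonempty \<open>Q\<close> will do; otherwise every successor has to be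
  covered.\<close>

lemma winning_strategy_ex:
  fixes p :: "('a::infinite, 'r) position"
  assumes succ: "\<And>q. q \<in> Q \<Longrightarrow> \<exists>\<sigma>. winning_strategy \<phi> P q \<sigma>"
    and sub: "Q \<subseteq> moves \<phi> p" and ne: "Q \<noteq> {}"
    and other: "mover p \<noteq> Some P \<Longrightarrow> Q = moves \<phi> p"
  shows "\<exists>\<sigma>. winning_strategy \<phi> P p \<sigma>"
proof -
  obtain q0 where q0: "q0 \<in> Q" using ne by blast
  obtain f where f: "\<And>q. q \<in> Q \<Longrightarrow> winning_strategy \<phi> P q (f q)"
    using succ by metis
  \<comment> \<open>A strategy has to answer legally after every history, reachable or not; outside
    \<open>Q\<close> the strategy for \<open>q0\<close> serves as default.\<close>
  define f' where "f' q = (if q \<in> Q then f q else f q0)" for q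
  define \<sigma> where "\<sigma> \<pi> = (case \<pi> of [x] \<Rightarrow> if x = p then q0 else f q0 [x]
      | x # y # \<rho> \<Rightarrow> f' y (y # \<rho>))" for \<pi>
  have sf: "strategy_for \<phi> P (f' q)" for q
    using f q0 by (simp add: f'_def winning_strategy_def)
  have st: "strategy_for \<phi> P \<sigma>"
    unfolding strategy_for_def
  proof (intro allI impI)
    fix \<pi> and x :: "('a, 'r) position" assume x: "mover x = Some P \<and> moves \<phi> x \<noteq> {}"
    show "\<sigma> (\<pi> @ [x]) \<in> moves \<phi> x"
    proof (cases \<pi>)
      case Nil
      moreover have "f q0 [x] \<in> moves \<phi> x"
        using sf[of q0] x q0 unfolding strategy_for_def f'_def by (metis append_Nil)
      ultimately show ?thesis using q0 sub x by (auto simp: \<sigma>_def)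
    next
      case (Cons y \<rho>)
      then obtain z \<rho>' where z: "\<rho> @ [x] = z # \<rho>'" by (cases \<rho>) auto
      then have "\<sigma> (\<pi> @ [x]) = f' z (\<rho> @ [x])" using Cons by (simp add: \<sigma>_def)
      then show ?thesis using sf x unfolding strategy_for_def by metis
    qed
  qed
  have tl: "hd \<pi> \<in> Q \<and> partial_play \<phi> P (f (hd \<pi>)) (hd \<pi>) \<pi>"
    if "partial_play \<phi> P \<sigma> p (p # \<pi>)" "\<pi> \<noteq> []" for \<pi>
  proof -
    have Q: "hd \<pi> \<in> Q"
      using partial_play_step[OF that] other q0 by (cases "mover p = Some P") (auto simp: \<sigma>_def)
    have "\<sigma> (p # \<rho>) = f (hd \<pi>) \<rho>" if "\<rho> \<noteq> []" "hd \<rho> = hd \<pi>" for \<rho>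
      using that Q by (cases \<rho>) (auto simp: \<sigma>_def f'_def)
    with partial_play_tl[OF that] Q show ?thesis by blast
  qed
  have "winner (last \<pi>) = P" if \<pi>: "partial_play \<phi> P \<sigma> p \<pi>" "moves \<phi> (last \<pi>) = {}" for \<pi>
  proof -
    obtain \<rho> where \<rho>: "\<pi> = p # \<rho>"
      using \<pi>(1) by (rule partial_play_ConsD)
    have "\<rho> \<noteq> []" using \<pi>(2) \<rho> ne sub by auto
    with tl[of \<rho>] \<pi> \<rho> f[of "hd \<rho>"] show ?thesis by (simp add: winning_strategy_def)
  qed
  moreover have False if "\<forall>n. partial_play \<phi> P \<sigma> p (map \<rho> [0..<Suc n])" for \<rho>
  proof -
    define \<rho>' where "\<rho>' n = \<rho> (Suc n)" for n
    have e: "map \<rho> [0..<Suc (Suc n)] = \<rho> 0 # map \<rho>' [0..<Suc n]" for n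
      by (rule nth_equalityI) (auto simp: \<rho>'_def nth_Cons' simp del: upt_Suc)
    have p: "\<rho> 0 = p" using that[rule_format, of 0] by (simp add: partial_play_def)
    have h: "hd (map \<rho>' [0..<Suc n]) = \<rho>' 0" for n
      by (simp add: hd_map del: upt_Suc)
    have "\<rho>' 0 \<in> Q \<and> partial_play \<phi> P (f (\<rho>' 0)) (\<rho>' 0) (map \<rho>' [0..<Suc n])" for n
    proof -
      have "partial_play \<phi> P \<sigma> p (p # map \<rho>' [0..<Suc n])"
        using that[rule_format, of "Suc n"] unfolding e p .
      from tl[OF this] show ?thesis unfolding h by simp
    qed
    then have "\<exists>\<rho>. \<forall>n. partial_play \<phi> P (f (\<rho>' 0)) (\<rho>' 0) (map \<rho> [0..<Suc n])"
      and "\<rho>' 0 \<in> Q" by blast+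
    with f[of "\<rho>' 0"] show False unfolding winning_strategy_def by blast
  qed
  ultimately have "winning_strategy \<phi> P p \<sigma>"
    using st unfolding winning_strategy_def by blast
  then show ?thesis by (intro exI[of _ \<sigma>])
qed

lemma winning_strategy_if_wins:
  fixes p :: "('a::infinite, 'b) position"
  assumes "wins \<phi> P p"
  shows "\<exists>\<sigma>. winning_strategy \<phi> P p \<sigma>"
  using assms
proof (induction rule: wins.induct)
  case (stop p)
  \<comment> \<open>Any legal strategy will do, since no play leaves \<open>p\<close>.\<close>
  define \<sigma> :: "('a, 'b) strategy" where "\<sigma> \<pi> = (SOME q. q \<in> moves \<phi> (last \<pi>))" for \<pi>
  have single: "\<pi> = [p]" if "partial_play \<phi> P \<sigma> p \<pi>" for \<pi>
  proof -
    from that obtain \<rho> where \<rho>: "\<pi> = p # \<rho>"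
      by (rule partial_play_ConsD)
    then show ?thesis using partial_play_step(1)[of \<phi> P \<sigma> p \<rho>] that stop by auto
  qed
  have "strategy_for \<phi> P \<sigma>"
    by (auto simp: strategy_for_def \<sigma>_def intro: someI_ex)
  moreover have "\<not> (\<exists>\<rho>. \<forall>n. partial_play \<phi> P \<sigma> p (map \<rho> [0..<Suc n]))"
  proof
    assume "\<exists>\<rho>. \<forall>n. partial_play \<phi> P \<sigma> p (map \<rho> [0..<Suc n])"
    then obtain \<rho> where "partial_play \<phi> P \<sigma> p (map \<rho> [0..<Suc (Suc 0)])" by blast
    from single[OF this] show False by simp
  qed
  moreover have "winner (last \<pi>) = P" if "partial_play \<phi> P \<sigma> p \<pi>" for \<pi>
    unfolding single[OF that] using stop by simp
  ultimately have "winning_strategy \<phi> P p \<sigma>"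
    unfolding winning_strategy_def by blast
  then show ?case by (intro exI[of _ \<sigma>])
next
  case (own p q)
  show ?case by (rule winning_strategy_ex[of "{q}" \<phi> P p]) (use own in simp_all)
next
  case (other p)
  show ?case by (rule winning_strategy_ex[of "moves \<phi> p" \<phi> P p]) (use other in simp_all)
qed

lemma partial_play_snoc:
  assumes "partial_play \<phi> P \<sigma> p \<pi>" "q \<in> moves \<phi> (last \<pi>)" "mover (last \<pi>) = Some P \<Longrightarrow> q = \<sigma> \<pi>"
  shows "partial_play \<phi> P \<sigma> p (\<pi> @ [q])"
proof -
  have "(\<pi> @ [q]) ! Suc i \<in> moves \<phi> ((\<pi> @ [q]) ! i) \<and>
      (mover ((\<pi> @ [q]) ! i) = Some P \<longrightarrow> (\<pi> @ [q]) ! Suc i = \<sigma> (take (Suc i) (\<pi> @ [q])))"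
    if i: "Suc i < length (\<pi> @ [q])" for i
  proof (cases "Suc i < length \<pi>")
    case True
    then show ?thesis using assms(1) by (simp add: partial_play_def nth_append)
  next
    case False
    with i have "length \<pi> = Suc i" by simp
    moreover from this have "last \<pi> = \<pi> ! i"
      by (metis diff_Suc_1 last_conv_nth length_0_conv nat.distinct(1))
    ultimately show ?thesis using assms(2,3) by (simp add: nth_append)
  qed
  with assms(1) show ?thesis by (simp add: partial_play_def)
qed

text \<open>Contraposition: a position outside the winning region reached under
  \<open>\<sigma>\<close> has a successor outside it that is consistent with
  \<open>\<sigma>\<close>, since otherwise a rule of \<open>wins\<close> would apply or a play would
  be lost. Iteration yields an infinite play, which a winning strategy excludes.\<close>

lemma wins_if_winning_strategy:
  assumes "winning_strategy \<phi> P p \<sigma>"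
  shows "wins \<phi> P p"
proof (rule ccontr)
  assume p: "\<not> wins \<phi> P p"
  have sf: "strategy_for \<phi> P \<sigma>" using assms by (simp add: winning_strategy_def)
  have step: "\<exists>q. partial_play \<phi> P \<sigma> p (\<pi> @ [q]) \<and> \<not> wins \<phi> P q"
    if \<pi>: "partial_play \<phi> P \<sigma> p \<pi>" "\<not> wins \<phi> P (last \<pi>)" for \<pi>
  proof -
    have ne: "moves \<phi> (last \<pi>) \<noteq> {}"
      using assms \<pi> stop[of \<phi> "last \<pi>" P] unfolding winning_strategy_def by blast
    have n: "\<pi> = butlast \<pi> @ [last \<pi>]" using \<pi>(1) by (simp add: partial_play_def)
    show ?thesis
    proof (cases "mover (last \<pi>) = Some P")
      case True
      then have "\<sigma> \<pi> \<in> moves \<phi> (last \<pi>)"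
        using sf ne n unfolding strategy_for_def by metis
      then show ?thesis
        using partial_play_snoc[OF \<pi>(1)] own[OF True] \<pi>(2) by blast
    next
      case False
      then show ?thesis
        using partial_play_snoc[OF \<pi>(1)] other[OF False ne] \<pi>(2) by blast
    qed
  qed
  define H where "H = rec_nat [p] (\<lambda>_ \<pi>. \<pi> @ [SOME q. partial_play \<phi> P \<sigma> p (\<pi> @ [q]) \<and> \<not> wins \<phi> P q])"
  have H0: "H 0 = [p]" and HS: "H (Suc n) = H n @ [SOME q. partial_play \<phi> P \<sigma> p (H n @ [q]) \<and> \<not> wins \<phi> P q]" for n
    by (simp_all add: H_def)
  have H: "partial_play \<phi> P \<sigma> p (H n) \<and> \<not> wins \<phi> P (last (H n)) \<and> length (H n) = Suc n" for n
  proof (induction n)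
    case 0
    then show ?case using p by (simp add: H0 partial_play_def)
  next
    case (Suc n)
    then show ?case using someI_ex[OF step[of "H n"]] by (simp add: HS)
  qed
  have e: "map (\<lambda>n. last (H n)) [0..<Suc n] = H n" for n
    by (induction n) (simp_all add: H0, simp add: HS)
  have "\<forall>n. partial_play \<phi> P \<sigma> p (map (\<lambda>n. last (H n)) [0..<Suc n])"
    unfolding e using H by blast
  then show False using assms unfolding winning_strategy_def by blast
qed

lemma sat_iff_wins: "sat \<AA> s \<phi> \<longleftrightarrow> wins \<phi> Eloise (\<AA>, empty_assignment, s, \<phi>)"
  using winning_strategy_if_wins wins_if_winning_strategy unfolding sat_def by blast

section \<open>Formulas as evaluation relative to labels\<close>

type_synonym 'a loop_pred = "nat \<Rightarrow> bool \<Rightarrow> 'a set \<Rightarrow> (nat \<Rightarrow> 'a) \<Rightarrow> (relvar \<Rightarrow> 'a list set) \<Rightarrow> bool"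

text \<open>Total counterpart of \<open>assign\<close>; the list is reversed so that a later binding
  of a variable overrides an earlier one, in agreement with map updates.\<close>

definition upd :: "(nat \<Rightarrow> 'a) \<Rightarrow> nat list \<Rightarrow> 'a list \<Rightarrow> nat \<Rightarrow> 'a" where
  "upd v xs bs = (\<lambda>x. case map_of (rev (zip xs bs)) x of None \<Rightarrow> v x | Some b \<Rightarrow> b)"

lemma the_fov_assign: "(\<lambda>x. the (fov (assign g xs bs) x)) = upd (\<lambda>x. the (fov g x)) xs bs"
  by (auto simp: assign_def upd_def map_upds_def map_add_def fun_eq_iff split: option.split)

lemma upd_single [simp]: "upd v [x] [b] = v(x := b)"
  by (auto simp: upd_def)

lemma rel_value_assign [simp]: "rel_value (assign g xs bs) = rel_value g"
  by (auto simp: rel_value_def assign_def fun_eq_iff)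

lemma fov_set_rel [simp]: "fov (set_rel g X C) = fov g"
  by (simp add: set_rel_def)

lemma rel_value_set_rel [simp]: "rel_value (set_rel g X C) = (rel_value g)(X := C)"
  by (auto simp: rel_value_def set_rel_def fun_eq_iff)

section \<open>Labels, jumps and their occurrences\<close>

fun norel :: "'r fm \<Rightarrow> bool" where
  "norel (InsRel R xs \<phi>) = False"
| "norel (DelRel R xs \<phi>) = False"
| "norel (Neg \<phi>) = norel \<phi>"
| "norel (Conj \<phi> \<psi>) = (norel \<phi> \<and> norel \<psi>)"
| "norel (Exi x \<phi>) = norel \<phi>"
| "norel (InsEl x \<phi>) = norel \<phi>"
| "norel (InsVar X xs \<phi>) = norel \<phi>"
| "norel (DelVar X xs \<phi>) = norel \<phi>"
| "norel (Lab k \<phi>) = norel \<phi>"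
| "norel _ = True"

fun labset :: "'r fm \<Rightarrow> (nat \<times> 'r fm) set" where
  "labset (Lab k \<phi>) = insert (k, \<phi>) (labset \<phi>)"
| "labset (Neg \<phi>) = labset \<phi>"
| "labset (Conj \<phi> \<psi>) = labset \<phi> \<union> labset \<psi>"
| "labset (Exi x \<phi>) = labset \<phi>"
| "labset (InsEl x \<phi>) = labset \<phi>"
| "labset (InsRel R xs \<phi>) = labset \<phi>"
| "labset (InsVar X xs \<phi>) = labset \<phi>"
| "labset (DelRel R xs \<phi>) = labset \<phi>"
| "labset (DelVar X xs \<phi>) = labset \<phi>"
| "labset _ = {}"

fun jumps :: "'r fm \<Rightarrow> nat set" where
  "jumps (Jump k) = {k}"
| "jumps (Lab k \<phi>) = jumps \<phi>"
| "jumps (Neg \<phi>) = jumps \<phi>"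
| "jumps (Conj \<phi> \<psi>) = jumps \<phi> \<union> jumps \<psi>"
| "jumps (Exi x \<phi>) = jumps \<phi>"
| "jumps (InsEl x \<phi>) = jumps \<phi>"
| "jumps (InsRel R xs \<phi>) = jumps \<phi>"
| "jumps (InsVar X xs \<phi>) = jumps \<phi>"
| "jumps (DelRel R xs \<phi>) = jumps \<phi>"
| "jumps (DelVar X xs \<phi>) = jumps \<phi>"
| "jumps _ = {}"

abbreviation labels :: "'r fm \<Rightarrow> nat set" where
  "labels \<phi> \<equiv> fst ` labset \<phi>"

text \<open>Compositional sufficient condition for the absence of non-standard jumps: two
  occurrences can part only at a conjunction. The disjointness of label sets moreover makes every
  label unique, so that a jump leaves no choice of target.\<close>

fun structured :: "'r fm \<Rightarrow> bool" where
  "structured (Lab k \<phi>) = (structured \<phi> \<and> k \<notin> labels \<phi>)"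
| "structured (Conj \<phi> \<psi>) = (structured \<phi> \<and> structured \<psi> \<and> labels \<phi> \<inter> labels \<psi> = {} \<and>
     jumps \<phi> \<inter> labels \<psi> = {} \<and> jumps \<psi> \<inter> labels \<phi> = {})"
| "structured (Neg \<phi>) = structured \<phi>"
| "structured (Exi x \<phi>) = structured \<phi>"
| "structured (InsEl x \<phi>) = structured \<phi>"
| "structured (InsRel R xs \<phi>) = structured \<phi>"
| "structured (InsVar X xs \<phi>) = structured \<phi>"
| "structured (DelRel R xs \<phi>) = structured \<phi>"
| "structured (DelVar X xs \<phi>) = structured \<phi>"
| "structured _ = True"

lemma labset_children: "\<psi> \<in> set (children \<phi>) \<Longrightarrow> labset \<psi> \<subseteq> labset \<phi>"
  by (cases \<phi>) auto

lemma jumps_children: "\<psi> \<in> set (children \<phi>) \<Longrightarrow> jumps \<psi> \<subseteq> jumps \<phi>"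
  by (cases \<phi>) auto

lemma structured_children: "structured \<phi> \<Longrightarrow> \<psi> \<in> set (children \<phi>) \<Longrightarrow> structured \<psi>"
  by (cases \<phi>) auto

lemma labset_if_sub_at: "sub_at \<phi> p = Some (Lab k \<chi>) \<Longrightarrow> (k, \<chi>) \<in> labset \<phi>"
proof (induction p arbitrary: \<phi>)
  case (Cons i p)
  then have "(k, \<chi>) \<in> labset (children \<phi> ! i)" "children \<phi> ! i \<in> set (children \<phi>)"
    by (auto split: if_splits)
  then show ?case using labset_children by blast
qed simp

lemma jumps_if_sub_at: "sub_at \<phi> p = Some (Jump k) \<Longrightarrow> k \<in> jumps \<phi>"
proof (induction p arbitrary: \<phi>)
  case (Cons i p)
  then have "k \<in> jumps (children \<phi> ! i)" "children \<phi> ! i \<in> set (children \<phi>)"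
    by (auto split: if_splits)
  then show ?case using jumps_children by blast
qed simp

lemma sub_at_child: "i < length (children \<phi>) \<Longrightarrow> sub_at (children \<phi> ! i) p = x \<Longrightarrow> sub_at \<phi> (i # p) = x"
  by simp

lemma ex_sub_at_child:
  "\<exists>p. sub_at \<psi> p = Some \<chi> \<Longrightarrow> \<psi> \<in> set (children \<phi>) \<Longrightarrow> \<exists>p. sub_at \<phi> p = Some \<chi>"
  by (metis in_set_conv_nth sub_at_child)

lemma sub_at_if_labset: "(k, \<chi>) \<in> labset \<phi> \<Longrightarrow> \<exists>p. sub_at \<phi> p = Some (Lab k \<chi>)"
proof (induction \<phi>)
  case (Lab l \<phi>)
  show ?case
  proof (cases "(k, \<chi>) = (l, \<phi>)")
    case True
    then show ?thesis by (intro exI[of _ "[]"]) simp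
  next
    case False
    with Lab have "\<exists>p. sub_at \<phi> p = Some (Lab k \<chi>)" by auto
    then show ?thesis by (rule ex_sub_at_child) simp
  qed
next
  case (Conj \<phi> \<psi>)
  then have "(\<exists>p. sub_at \<phi> p = Some (Lab k \<chi>)) \<or> (\<exists>p. sub_at \<psi> p = Some (Lab k \<chi>))" by auto
  then show ?case
    by (elim disjE; elim ex_sub_at_child) simp_all
qed (simp_all, (erule ex_sub_at_child, simp)+)

lemma sub_at_iff_labset: "(\<exists>p. sub_at \<phi> p = Some (Lab k \<chi>)) \<longleftrightarrow> (k, \<chi>) \<in> labset \<phi>"
  using labset_if_sub_at sub_at_if_labset by blast

text \<open>Both paths are followed from the root. They can separate only at a conjunction, and then
  \<open>k\<close> is a jump of one conjunct and a label of the other, which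
  \<open>structured\<close> forbids.\<close>

lemma structured_sub_at:
  assumes "structured \<phi>" "sub_at \<phi> p = Some (Jump k)" "sub_at \<phi> q = Some (Lab k \<psi>)"
  shows "prefix q p"
  using assms
proof (induction q arbitrary: \<phi> p)
  case (Cons j q)
  then have j: "j < length (children \<phi>)" and jq: "sub_at (children \<phi> ! j) q = Some (Lab k \<psi>)"
    by (auto split: if_splits)
  obtain i p' where p: "p = i # p'"
    using Cons.prems j by (cases p) auto
  then have i: "i < length (children \<phi>)" and ip: "sub_at (children \<phi> ! i) p' = Some (Jump k)"
    using Cons.prems by (auto split: if_splits)
  show ?case
  proof (cases "i = j")
    case True
    with Cons.IH[OF structured_children[OF Cons.prems(1)], of "children \<phi> ! j" p'] ip jq j p
    show ?thesis by simp
  next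
    case False
    then obtain \<alpha> \<beta> where \<phi>: "\<phi> = Conj \<alpha> \<beta>" using i j by (cases \<phi>) auto
    have "k \<in> jumps (children \<phi> ! i)" "k \<in> labels (children \<phi> ! j)"
      using jumps_if_sub_at[OF ip] labset_if_sub_at[OF jq] by force+
    with \<phi> False i j have "k \<in> jumps \<alpha> \<inter> labels \<beta> \<or> k \<in> jumps \<beta> \<inter> labels \<alpha>"
      by (cases i; cases j) simp_all
    with Cons.prems(1) \<phi> show ?thesis by simp
  qed
qed simp

lemma not_nonstandard_jump_if_structured: "structured \<phi> \<Longrightarrow> \<not> nonstandard_jump \<phi>"
  unfolding nonstandard_jump_def using structured_sub_at by blast

lemma structured_labset_unique:
  "structured \<phi> \<Longrightarrow> (k, \<chi>) \<in> labset \<phi> \<Longrightarrow> (k, \<chi>') \<in> labset \<phi> \<Longrightarrow> \<chi> = \<chi>'"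
proof (induction \<phi>)
  case (Conj \<phi> \<psi>)
  have "k \<in> labels \<alpha>" if "(k, \<beta>) \<in> labset \<alpha>" for \<alpha> \<beta> :: "'a fm"
    using that by force
  note mem = this
  have "\<not> ((k, \<alpha>) \<in> labset \<phi> \<and> (k, \<beta>) \<in> labset \<psi>)" for \<alpha> \<beta>
  proof
    assume "(k, \<alpha>) \<in> labset \<phi> \<and> (k, \<beta>) \<in> labset \<psi>"
    with mem have "k \<in> labels \<phi> \<inter> labels \<psi>" by (meson IntI)
    with Conj.prems(1) show False by simp
  qed
  with Conj.prems(2,3) consider
      "(k, \<chi>) \<in> labset \<phi>" "(k, \<chi>') \<in> labset \<phi>"
    | "(k, \<chi>) \<in> labset \<psi>" "(k, \<chi>') \<in> labset \<psi>"
    by fastforce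
  then show ?case using Conj.IH Conj.prems(1) by cases simp_all
next
  case (Lab l \<phi>)
  have "k \<in> labels \<phi>" if "(k, \<beta>) \<in> labset \<phi>" for \<beta>
    using that by force
  with Lab show ?case by auto
qed auto

lemma norel_labset: "norel \<phi> \<Longrightarrow> (k, \<chi>) \<in> labset \<phi> \<Longrightarrow> norel \<chi>"
  by (induction \<phi>) auto

lemma labset_trans: "(k, \<chi>) \<in> labset \<phi> \<Longrightarrow> labset \<chi> \<subseteq> labset \<phi>"
  by (induction \<phi>) auto

text \<open>
  In \<open>ev I Q b \<psi> D v r\<close>, the flag \<open>b\<close> says whether the player under consideration is the verifier,
  and \<open>Q k b\<close> stands for the positions at the label \<open>k\<close> from which that player wins.
\<close>

fun ev :: "('r \<Rightarrow> 'a list set) \<Rightarrow> 'a loop_pred \<Rightarrow> bool \<Rightarrow> 'r fm \<Rightarrow>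
    'a set \<Rightarrow> (nat \<Rightarrow> 'a) \<Rightarrow> (relvar \<Rightarrow> 'a list set) \<Rightarrow> bool" where
  "ev I Q b (Rel R xs) D v r = ((map v xs \<in> I R) = b)"
| "ev I Q b (RVar X xs) D v r = ((map v xs \<in> r X) = b)"
| "ev I Q b (Eq x y) D v r = ((v x = v y) = b)"
| "ev I Q b (Jump k) D v r = Q k b D v r"
| "ev I Q b (Lab k \<psi>) D v r = Q k b D v r"
| "ev I Q b (Neg \<psi>) D v r = ev I Q (\<not> b) \<psi> D v r"
| "ev I Q b (Conj \<psi> \<chi>) D v r =
     (if b then ev I Q b \<psi> D v r \<and> ev I Q b \<chi> D v r else ev I Q b \<psi> D v r \<or> ev I Q b \<chi> D v r)"
| "ev I Q b (Exi x \<psi>) D v r =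
     (if b then \<exists>a\<in>D. ev I Q b \<psi> D (v(x := a)) r else \<forall>a\<in>D. ev I Q b \<psi> D (v(x := a)) r)"
| "ev I Q b (InsEl x \<psi>) D v r =
     (let a = (SOME a. a \<notin> D) in ev I Q b \<psi> (insert a D) (v(x := a)) r)"
| "ev I Q b (InsVar X xs \<psi>) D v r =
     (if b then \<exists>bs\<in>tuples (length xs) D. ev I Q b \<psi> D (upd v xs bs) (r(X := r X \<union> {bs}))
      else \<forall>bs\<in>tuples (length xs) D. ev I Q b \<psi> D (upd v xs bs) (r(X := r X \<union> {bs})))"
| "ev I Q b (DelVar X xs \<psi>) D v r =
     (if b then \<exists>bs\<in>tuples (length xs) D. ev I Q b \<psi> D (upd v xs bs) (r(X := r X - {bs}))
      else \<forall>bs\<in>tuples (length xs) D. ev I Q b \<psi> D (upd v xs bs) (r(X := r X - {bs})))"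
| "ev I Q b (InsRel R xs \<psi>) D v r = undefined"
| "ev I Q b (DelRel R xs \<psi>) D v r = undefined"

section \<open>Evaluation relative to labels against the game\<close>

definition player_sign :: "bool \<Rightarrow> sign" where
  "player_sign b = (if b then Plus else Minus)"

lemma player_sign_simps [simp]:
  "verifier (player_sign b) = Eloise \<longleftrightarrow> b" "falsifier (player_sign b) = Eloise \<longleftrightarrow> \<not> b"
  "opp (player_sign b) = player_sign (\<not> b)"
  by (simp_all add: player_sign_def falsifier_def)

abbreviation "fo_val g \<equiv> \<lambda>x. the (fov g x)"

lemma wins_if_all_moves:
  "mover p \<noteq> Some P \<Longrightarrow> (moves \<phi> p = {} \<Longrightarrow> winner p = P) \<Longrightarrow> \<forall>q\<in>moves \<phi> p. wins \<phi> P q \<Longrightarrow> wins \<phi> P p"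
  by (cases "moves \<phi> p = {}") (blast intro: wins.stop wins.other)+

lemma wins_if_some_move:
  "mover p = Some P \<Longrightarrow> \<exists>q\<in>moves \<phi> p. wins \<phi> P q \<Longrightarrow> wins \<phi> P p"
  by (blast intro: wins.own)

text \<open>Soundness: \<open>ev\<close> unfolds the game down to the next label or jump, where
  \<open>Q\<close> promises a win. The promise covers every body attached to the label, because the
  opponent may be the one who picks the target.\<close>

lemma wins_if_ev:
  fixes \<BB> :: "('a::infinite, 'b) model"
  assumes "norel \<psi>" "ev I Q b \<psi> (univ \<BB>) (fo_val g) (rel_value g)" "interp \<BB> = I"
    and labs: "labset \<psi> \<subseteq> labset \<phi>"
    and Q: "\<And>k b \<BB> g. Q k b (univ \<BB>) (fo_val g) (rel_value g) \<Longrightarrow> interp \<BB> = I \<Longrightarrow>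
        k \<in> labels \<phi> \<and> (\<forall>\<chi>. (k, \<chi>) \<in> labset \<phi> \<longrightarrow> wins \<phi> Eloise (\<BB>, g, player_sign b, \<chi>))"
  shows "wins \<phi> Eloise (\<BB>, g, player_sign b, \<psi>)"
  using assms(1-4)
proof (induction \<psi> arbitrary: b \<BB> g)
  case (Rel R xs)
  then show ?case by (intro wins_if_all_moves) (simp_all add: vals_def)
next
  case (RVar X xs)
  then show ?case by (intro wins_if_all_moves) (simp_all add: vals_def)
next
  case (Eq x y)
  then show ?case by (intro wins_if_all_moves) simp_all
next
  case (Jump k)
  have l: "k \<in> labels \<phi>" and w: "\<forall>\<chi>. (k, \<chi>) \<in> labset \<phi> \<longrightarrow> wins \<phi> Eloise (\<BB>, g, player_sign b, \<chi>)"
    using Q[of k b \<BB> g] Jump.prems(2,3) by simp_all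
  obtain \<chi>0 where \<chi>0: "(k, \<chi>0) \<in> labset \<phi>" using l by force
  have w': "wins \<phi> Eloise (\<BB>, g, player_sign b, Lab k \<chi>)" if "(k, \<chi>) \<in> labset \<phi>" for \<chi>
    by (rule wins_if_all_moves) (simp_all add: w[rule_format, OF that])
  have m: "moves \<phi> (\<BB>, g, player_sign b, Jump k) = (\<lambda>\<chi>. (\<BB>, g, player_sign b, Lab k \<chi>)) ` {\<chi>. (k, \<chi>) \<in> labset \<phi>}"
    unfolding sub_at_iff_labset[symmetric] by (auto simp: image_def)
  show ?case
  proof (cases b)
    case True
    have "\<exists>q\<in>moves \<phi> (\<BB>, g, player_sign b, Jump k). wins \<phi> Eloise q"
      unfolding m using w'[OF \<chi>0] \<chi>0 by blast
    then show ?thesis using True by (intro wins_if_some_move) simp_all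
  next
    case False
    have "\<forall>q\<in>moves \<phi> (\<BB>, g, player_sign b, Jump k). wins \<phi> Eloise q"
      unfolding m using w' by blast
    then show ?thesis using False by (intro wins_if_all_moves) simp_all
  qed
next
  case (Neg \<psi>)
  have "wins \<phi> Eloise (\<BB>, g, player_sign (\<not> b), \<psi>)"
    by (rule Neg.IH) (use Neg.prems in simp_all)
  then show ?case by (intro wins_if_all_moves) simp_all
next
  case (Conj \<psi> \<chi>)
  have "norel \<psi>" "norel \<chi>" "labset \<psi> \<subseteq> labset \<phi>" "labset \<chi> \<subseteq> labset \<phi>"
    using Conj.prems by simp_all
  note IH = Conj.IH(1)[OF this(1) _ Conj.prems(3) this(3)] Conj.IH(2)[OF this(2) _ Conj.prems(3) this(4)]
  show ?case
  proof (cases b)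
    case True
    then show ?thesis using Conj.prems(2) IH[where b = b]
      by (intro wins_if_all_moves) simp_all
  next
    case False
    then show ?thesis using Conj.prems(2) IH[where b = b]
      by (intro wins_if_some_move) (simp, fastforce)
  qed
next
  case (Exi x \<psi>)
  have IH: "wins \<phi> Eloise (\<BB>, assign g [x] [a], player_sign b, \<psi>)"
    if "ev I Q b \<psi> (univ \<BB>) ((fo_val g)(x := a)) (rel_value g)" for a
    by (rule Exi.IH) (use Exi.prems that in \<open>simp_all add: the_fov_assign\<close>)
  show ?case
  proof (cases b)
    case True
    then show ?thesis using Exi.prems(2) IH
      by (intro wins_if_some_move) (simp, fastforce)
  next
    case False
    then show ?thesis using Exi.prems(2) IH
      by (intro wins_if_all_moves) (simp, simp, fastforce)
  qed
next
  case (InsEl x \<psi>)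
  have "wins \<phi> Eloise (insert_element (fresh \<BB>) \<BB>, assign g [x] [fresh \<BB>], player_sign b, \<psi>)"
    by (rule InsEl.IH)
       (use InsEl.prems in \<open>simp_all add: the_fov_assign insert_element_def fresh_def Let_def\<close>)
  then show ?case by (intro wins_if_all_moves) simp_all
next
  case (InsVar X xs \<psi>)
  have IH: "wins \<phi> Eloise (\<BB>, set_rel (assign g xs bs) X (rel_value g X \<union> {bs}), player_sign b, \<psi>)"
    if "ev I Q b \<psi> (univ \<BB>) (upd (fo_val g) xs bs) ((rel_value g)(X := rel_value g X \<union> {bs}))" for bs
    by (rule InsVar.IH) (use InsVar.prems that in \<open>simp_all add: the_fov_assign fun_upd_def\<close>)
  show ?case
  proof (cases b)
    case True
    then show ?thesis using InsVar.prems(2) IH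
      by (intro wins_if_some_move) (simp, fastforce)
  next
    case False
    then show ?thesis using InsVar.prems(2) IH
      by (intro wins_if_all_moves) (simp, simp, fastforce)
  qed
next
  case (DelVar X xs \<psi>)
  have IH: "wins \<phi> Eloise (\<BB>, set_rel (assign g xs bs) X (rel_value g X - {bs}), player_sign b, \<psi>)"
    if "ev I Q b \<psi> (univ \<BB>) (upd (fo_val g) xs bs) ((rel_value g)(X := rel_value g X - {bs}))" for bs
    by (rule DelVar.IH) (use DelVar.prems that in \<open>simp_all add: the_fov_assign fun_upd_def\<close>)
  show ?case
  proof (cases b)
    case True
    then show ?thesis using DelVar.prems(2) IH
      by (intro wins_if_some_move) (simp, fastforce)
  next
    case False
    then show ?thesis using DelVar.prems(2) IH
      by (intro wins_if_all_moves) (simp, simp, fastforce)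
  qed
next
  case (Lab k \<psi>)
  with Q[of k b \<BB> g] have "wins \<phi> Eloise (\<BB>, g, player_sign b, \<psi>)" by simp
  then show ?case by (intro wins_if_all_moves) simp_all
qed simp_all

text \<open>Converse for every \<open>Q\<close> closed under evaluating label bodies: such a
  \<open>Q\<close> contains the least fixed point \<open>wins\<close> at the labels. This bounds
  winning regions from above without any termination argument.\<close>

lemma ev_if_wins:
  fixes \<BB> :: "('a::infinite, 'b) model"
  assumes "wins \<phi> Eloise (\<BB>, g, player_sign b, \<psi>)" "interp \<BB> = I"
    and "norel \<phi>" "norel \<psi>" "labset \<psi> \<subseteq> labset \<phi>"
    and Q: "\<And>k \<chi> b D v r. (k, \<chi>) \<in> labset \<phi> \<Longrightarrow> ev I Q b \<chi> D v r \<Longrightarrow> Q k b D v r"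
    and Q0: "\<And>k b D v r. k \<notin> labels \<phi> \<Longrightarrow> Q k b D v r"
  shows "ev I Q b \<psi> (univ \<BB>) (fo_val g) (rel_value g)"
proof -
  \<comment> \<open>Rule induction on \<open>wins\<close> runs over all positions, so the claim is
    restricted to those whose label bodies come from \<phi> and whose relations are still those of
    the input.\<close>
  define G :: "('a, 'b) position \<Rightarrow> bool" where "G p = (case p of (\<BB>, g, s, \<psi>) \<Rightarrow> \<forall>b. s = player_sign b \<longrightarrow> interp \<BB> = I \<longrightarrow>
    norel \<psi> \<longrightarrow> labset \<psi> \<subseteq> labset \<phi> \<longrightarrow> ev I Q b \<psi> (univ \<BB>) (fo_val g) (rel_value g))" for p
  have sgn [simp]: "player_sign b = player_sign b' \<longleftrightarrow> b = b'" for b b'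
    by (simp add: player_sign_def)
  have moves_Jump: "moves \<phi> (\<BB>, g, s, Jump k) = (\<lambda>\<chi>. (\<BB>, g, s, Lab k \<chi>)) ` {\<chi>. (k, \<chi>) \<in> labset \<phi>}" for \<BB> g s k
    unfolding sub_at_iff_labset[symmetric] by (auto simp: image_def)
  have G: "G (\<BB>, g, s, \<psi>)" if
    "\<And>b. s = player_sign b \<Longrightarrow> interp \<BB> = I \<Longrightarrow> norel \<psi> \<Longrightarrow> labset \<psi> \<subseteq> labset \<phi> \<Longrightarrow>
      ev I Q b \<psi> (univ \<BB>) (fo_val g) (rel_value g)" for \<BB> g s \<psi>
    using that by (simp add: G_def)
  have GD: "ev I Q b \<psi> (univ \<BB>) (fo_val g) (rel_value g)"
    if "G (\<BB>, g, player_sign b, \<psi>)" "interp \<BB> = I" "norel \<psi>" "labset \<psi> \<subseteq> labset \<phi>" for \<BB> g b \<psi>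
    using that by (simp add: G_def)
  have Q_at: "Q k b (univ \<BB>) (fo_val g) (rel_value g)"
    if "G (\<BB>, g, player_sign b, Lab k \<chi>)" "interp \<BB> = I" "(k, \<chi>) \<in> labset \<phi>" for \<BB> g b k \<chi>
    using GD[OF that(1,2)] norel_labset[OF assms(3) that(3)] labset_trans[OF that(3)] that(3) by simp
  have "G p" if "wins \<phi> Eloise p" for p
    using that
  proof (induction rule: wins.induct)
    case (stop p)
    obtain \<BB> g s \<psi> where p: "p = (\<BB>, g, s, \<psi>)" by (cases p)
    show ?case unfolding p
    proof (rule G)
      fix b assume *: "s = player_sign b" "interp \<BB> = I" "norel \<psi>"
      note st = stop[unfolded p *(1)]
      show "ev I Q b \<psi> (univ \<BB>) (fo_val g) (rel_value g)"
      proof (cases \<psi>)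
        case (Jump k)
        \<comment> \<open>A stuck jump has no target, so its label lies outside \<phi>, where
          \<open>Q\<close> holds by assumption.\<close>
        with st(1) have "{\<chi>. (k, \<chi>) \<in> labset \<phi>} = {}" by (simp only: moves_Jump image_is_empty)
        then have "k \<notin> labels \<phi>" by force
        with Jump Q0 show ?thesis by simp
      next
        case (Exi x \<chi>)
        with st show ?thesis by simp
      next
        case (InsVar X xs \<chi>)
        with st show ?thesis by simp
      next
        case (DelVar X xs \<chi>)
        with st show ?thesis by simp
      qed (use st * in \<open>simp_all add: vals_def split: if_splits\<close>)
    qed
  next
    case (own p q)
    obtain \<BB> g s \<psi> where p: "p = (\<BB>, g, s, \<psi>)" by (cases p)
    show ?case unfolding p
    proof (rule G)
      fix b assume *: "s = player_sign b" "interp \<BB> = I" "norel \<psi>" "labset \<psi> \<subseteq> labset \<phi>"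
      note st = own(1,2,4)[unfolded p *(1)]
      show "ev I Q b \<psi> (univ \<BB>) (fo_val g) (rel_value g)"
      proof (cases \<psi>)
        case (Jump k)
        with st(2) obtain \<chi> where "(k, \<chi>) \<in> labset \<phi>" "q = (\<BB>, g, player_sign b, Lab k \<chi>)"
          by (auto simp only: moves_Jump)
        with st(3) Jump Q_at[of \<BB> g b k \<chi>] *(2) show ?thesis by simp
      next
        case (Conj \<alpha> \<beta>)
        with st(2) have "q = (\<BB>, g, player_sign b, \<alpha>) \<or> q = (\<BB>, g, player_sign b, \<beta>)" by simp
        then show ?thesis using Conj st(1,3) * by (elim disjE) (simp_all add: GD)
      next
        case (Exi x \<chi>)
        with st(2) obtain a where a: "a \<in> univ \<BB>" "q = (\<BB>, assign g [x] [a], player_sign b, \<chi>)" by auto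
        with GD[of \<BB> "assign g [x] [a]" b \<chi>] Exi st(1,3) * show ?thesis
          by (auto simp: the_fov_assign)
      next
        case (InsVar X xs \<chi>)
        with st(2) obtain bs where a: "bs \<in> tuples (length xs) (univ \<BB>)"
          "q = (\<BB>, set_rel (assign g xs bs) X (rel_value g X \<union> {bs}), player_sign b, \<chi>)" by auto
        with GD[of \<BB> "set_rel (assign g xs bs) X (rel_value g X \<union> {bs})" b \<chi>] InsVar st(1,3) *
        show ?thesis by (auto simp: the_fov_assign)
      next
        case (DelVar X xs \<chi>)
        with st(2) obtain bs where a: "bs \<in> tuples (length xs) (univ \<BB>)"
          "q = (\<BB>, set_rel (assign g xs bs) X (rel_value g X - {bs}), player_sign b, \<chi>)" by auto
        with GD[of \<BB> "set_rel (assign g xs bs) X (rel_value g X - {bs})" b \<chi>] DelVar st(1,3) *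
        show ?thesis by (auto simp: the_fov_assign)
      qed (use st * in simp_all)
    qed
  next
    case (other p)
    obtain \<BB> g s \<psi> where p: "p = (\<BB>, g, s, \<psi>)" by (cases p)
    show ?case unfolding p
    proof (rule G)
      fix b assume *: "s = player_sign b" "interp \<BB> = I" "norel \<psi>" "labset \<psi> \<subseteq> labset \<phi>"
      note st = other(1,2,4)[unfolded p *(1)]
      show "ev I Q b \<psi> (univ \<BB>) (fo_val g) (rel_value g)"
      proof (cases \<psi>)
        case (Jump k)
        with st(2) obtain \<chi> where \<chi>: "(k, \<chi>) \<in> labset \<phi>"
          by (auto simp only: moves_Jump)
        then have "G (\<BB>, g, player_sign b, Lab k \<chi>)"
          using st(3) unfolding Jump moves_Jump by blast
        with Jump Q_at[of \<BB> g b k \<chi>] *(2) \<chi> show ?thesis by simp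
      next
        case (Neg \<chi>)
        then have "G (\<BB>, g, player_sign (\<not> b), \<chi>)" using st(3) by simp
        from GD[OF this] Neg * show ?thesis by simp
      next
        case (Conj \<alpha> \<beta>)
        then have "G (\<BB>, g, player_sign b, \<alpha>)" "G (\<BB>, g, player_sign b, \<beta>)" using st(3) by simp_all
        from GD[OF this(1)] GD[OF this(2)] Conj * show ?thesis by (cases b) simp_all
      next
        case (Exi x \<chi>)
        then have "\<forall>a\<in>univ \<BB>. G (\<BB>, assign g [x] [a], player_sign b, \<chi>)"
          using st(3) unfolding Exi moves.simps by blast
        then have "\<forall>a\<in>univ \<BB>. ev I Q b \<chi> (univ \<BB>) ((fo_val g)(x := a)) (rel_value g)"
          using GD[of \<BB> "assign g [x] [a]" b \<chi> for a] Exi * by (simp add: the_fov_assign)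
        with Exi st(1) *(1) show ?thesis by simp
      next
        case (InsEl x \<chi>)
        then have "G (insert_element (fresh \<BB>) \<BB>, assign g [x] [fresh \<BB>], player_sign b, \<chi>)"
          using st(3) by simp
        from GD[OF this] InsEl * show ?thesis
          by (simp add: the_fov_assign insert_element_def fresh_def Let_def)
      next
        case (InsVar X xs \<chi>)
        then have "\<forall>bs\<in>tuples (length xs) (univ \<BB>).
            G (\<BB>, set_rel (assign g xs bs) X (rel_value g X \<union> {bs}), player_sign b, \<chi>)"
          using st(3) unfolding InsVar moves.simps by blast
        then have "\<forall>bs\<in>tuples (length xs) (univ \<BB>). ev I Q b \<chi> (univ \<BB>) (upd (fo_val g) xs bs)
            ((rel_value g)(X := rel_value g X \<union> {bs}))"
          using GD[of \<BB> "set_rel (assign g xs bs) X (rel_value g X \<union> {bs})" b \<chi> for bs] InsVar *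
          by (simp add: the_fov_assign fun_upd_def)
        with InsVar st(1) *(1) show ?thesis by simp
      next
        case (DelVar X xs \<chi>)
        then have "\<forall>bs\<in>tuples (length xs) (univ \<BB>).
            G (\<BB>, set_rel (assign g xs bs) X (rel_value g X - {bs}), player_sign b, \<chi>)"
          using st(3) unfolding DelVar moves.simps by blast
        then have "\<forall>bs\<in>tuples (length xs) (univ \<BB>). ev I Q b \<chi> (univ \<BB>) (upd (fo_val g) xs bs)
            ((rel_value g)(X := rel_value g X - {bs}))"
          using GD[of \<BB> "set_rel (assign g xs bs) X (rel_value g X - {bs})" b \<chi> for bs] DelVar *
          by (simp add: the_fov_assign fun_upd_def)
        with DelVar st(1) *(1) show ?thesis by simp
      next
        case (Lab k \<chi>)
        then have "G (\<BB>, g, player_sign b, \<chi>)" using st(3) by simp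
        from GD[OF this] Lab * have "ev I Q b \<chi> (univ \<BB>) (fo_val g) (rel_value g)" by simp
        with Lab * Q[of k \<chi>] show ?thesis by simp
      qed (use st * in simp_all)
    qed
  qed
  from GD[OF this[OF assms(1)] assms(2,4,5)] show ?thesis .
qed

section \<open>Deterministic formulas\<close>

text \<open>One record of how a block ends serves both roles: \<open>Halt c\<close> is the truth
  value on which the play has settled, and it is a win for the player with role \<open>b\<close>
  precisely if \<open>c = b\<close>.\<close>

datatype 'a outcome = Halt bool | At nat "'a set" "nat \<Rightarrow> 'a" "relvar \<Rightarrow> 'a list set"

fun outcome_val :: "'a loop_pred \<Rightarrow> bool \<Rightarrow> 'a outcome \<Rightarrow> bool" where
  "outcome_val Q b (Halt c) = (c = b)"
| "outcome_val Q b (At k D v r) = Q k b D v r"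

definition choice :: "bool \<Rightarrow> 'b set \<Rightarrow> ('b \<Rightarrow> bool) \<Rightarrow> bool" where
  "choice b N P = (if b then \<exists>x\<in>N. P x else \<forall>x\<in>N. P x)"

text \<open>Successive choices of one player fuse into a single choice. Alternation never arises,
  because the challenges of the other player are all decided by guards.\<close>

lemma choice_UN: "choice b A (\<lambda>a. choice b (N a) P) = choice b (\<Union>a\<in>A. N a) P"
  by (auto simp: choice_def)

lemma choice_nonempty: "choice b N P \<Longrightarrow> N \<noteq> {} \<Longrightarrow> \<exists>x\<in>N. P x"
  by (auto simp: choice_def split: if_splits)

lemma choice_all: "N \<noteq> {} \<Longrightarrow> \<forall>x\<in>N. P x \<Longrightarrow> choice b N P"
  by (auto simp: choice_def)

text \<open>
  The verifier can steer the play from \<open>\<psi>\<close> exactly to the outcomes in some nonempty subset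
  of \<open>S\<close>; every other choice, and every unjustified challenge, is immediately punished.
\<close>

definition det :: "('r \<Rightarrow> 'a list set) \<Rightarrow> 'r fm \<Rightarrow> 'a set \<Rightarrow> (nat \<Rightarrow> 'a) \<Rightarrow>
    (relvar \<Rightarrow> 'a list set) \<Rightarrow> 'a outcome set \<Rightarrow> bool" where
  "det I \<psi> D v r S \<longleftrightarrow> (\<exists>N. N \<noteq> {} \<and> N \<subseteq> S \<and>
     (\<forall>Q b. ev I Q b \<psi> D v r = choice b N (outcome_val Q b)))"

lemma detI:
  assumes "N \<noteq> {}" "N \<subseteq> S" "\<And>Q b. ev I Q b \<psi> D v r = choice b N (outcome_val Q b)"
  shows "det I \<psi> D v r S"
  unfolding det_def using assms by (intro exI[of _ N]) simp

lemma detE: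
  assumes "det I \<psi> D v r S"
  obtains N where "N \<noteq> {}" "N \<subseteq> S" "\<And>Q b. ev I Q b \<psi> D v r = choice b N (outcome_val Q b)"
  using assms unfolding det_def by metis

lemma det_single:
  assumes "x \<in> S" "\<And>Q b. ev I Q b \<psi> D v r = outcome_val Q b x"
  shows "det I \<psi> D v r S"
  by (rule detI[of "{x}"]) (use assms in \<open>auto simp: choice_def\<close>)

lemma det_Jump: "At k D v r \<in> S \<Longrightarrow> det I (Jump k) D v r S"
  by (erule det_single) simp

lemma det_Lab: "At k D v r \<in> S \<Longrightarrow> det I (Lab k \<psi>) D v r S"
  by (erule det_single) simp

definition Verum :: "'r fm" where "Verum = Eq 0 0"

lemma det_Verum: "Halt True \<in> S \<Longrightarrow> det I Verum D v r S"
  by (erule det_single) (simp add: Verum_def)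

lemma det_Neg_Verum: "Halt False \<in> S \<Longrightarrow> det I (Neg Verum) D v r S"
  by (erule det_single) (auto simp: Verum_def)

lemma det_same:
  "det I \<psi> D v r S \<Longrightarrow> (\<And>Q b. ev I Q b \<psi>' D' v' r' = ev I Q b \<psi> D v r) \<Longrightarrow> det I \<psi>' D' v' r' S"
  by (simp add: det_def)

text \<open>Each alternative contributes its own set of outcomes, and by \<open>choice_UN\<close>
  the same player then chooses from their union.\<close>

lemma det_choice:
  assumes "A \<noteq> {}" "\<And>a. a \<in> A \<Longrightarrow> det I \<psi> (D' a) (v' a) (r' a) S"
    and "\<And>Q b. ev I Q b \<phi> D v r = choice b A (\<lambda>a. ev I Q b \<psi> (D' a) (v' a) (r' a))"
  shows "det I \<phi> D v r S"
proof -
  have "\<forall>a. \<exists>N. a \<in> A \<longrightarrow> N \<noteq> {} \<and> N \<subseteq> S \<and>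
     (\<forall>Q b. ev I Q b \<psi> (D' a) (v' a) (r' a) = choice b N (outcome_val Q b))"
    using assms(2) unfolding det_def by simp
  then obtain N where N: "\<And>a. a \<in> A \<Longrightarrow> N a \<noteq> {} \<and> N a \<subseteq> S \<and>
     (\<forall>Q b. ev I Q b \<psi> (D' a) (v' a) (r' a) = choice b (N a) (outcome_val Q b))"
    by metis
  have "ev I Q b \<phi> D v r = choice b (\<Union>a\<in>A. N a) (outcome_val Q b)" for Q b
    unfolding assms(3) choice_UN[symmetric] using N by (simp add: choice_def)
  moreover have "(\<Union>a\<in>A. N a) \<noteq> {}" "(\<Union>a\<in>A. N a) \<subseteq> S"
    using N assms(1) by auto
  ultimately show ?thesis by (intro detI)
qed

section \<open>First-order guards and guarded choices\<close>

fun fo :: "('r \<Rightarrow> 'a list set) \<Rightarrow> 'r fm \<Rightarrow> 'a set \<Rightarrow> (nat \<Rightarrow> 'a) \<Rightarrow> (relvar \<Rightarrow> 'a list set) \<Rightarrow> bool" where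
  "fo I (Rel R xs) D v r \<longleftrightarrow> map v xs \<in> I R"
| "fo I (RVar X xs) D v r \<longleftrightarrow> map v xs \<in> r X"
| "fo I (Eq x y) D v r \<longleftrightarrow> v x = v y"
| "fo I (Neg \<psi>) D v r \<longleftrightarrow> \<not> fo I \<psi> D v r"
| "fo I (Conj \<psi> \<chi>) D v r \<longleftrightarrow> fo I \<psi> D v r \<and> fo I \<chi> D v r"
| "fo I (Exi x \<psi>) D v r \<longleftrightarrow> (\<exists>a\<in>D. fo I \<psi> D (v(x := a)) r)"
| "fo I _ D v r \<longleftrightarrow> False"

fun fo_fm :: "'r fm \<Rightarrow> bool" where
  "fo_fm (Rel R xs) = True"
| "fo_fm (RVar X xs) = True"
| "fo_fm (Eq x y) = True"
| "fo_fm (Neg \<psi>) = fo_fm \<psi>"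
| "fo_fm (Conj \<psi> \<chi>) = (fo_fm \<psi> \<and> fo_fm \<chi>)"
| "fo_fm (Exi x \<psi>) = fo_fm \<psi>"
| "fo_fm _ = False"

lemma ev_fo: "fo_fm \<psi> \<Longrightarrow> ev I Q b \<psi> D v r = (fo I \<psi> D v r = b)"
  by (induction \<psi> arbitrary: b v) auto

lemma fo_fm_simps [simp]:
  assumes "fo_fm \<psi>"
  shows "labset \<psi> = {}" "jumps \<psi> = {}" "norel \<psi>" "structured \<psi>"
  using assms by (induction \<psi>) auto

definition Disj :: "'r fm \<Rightarrow> 'r fm \<Rightarrow> 'r fm" where
  "Disj \<phi> \<psi> = Neg (Conj (Neg \<phi>) (Neg \<psi>))"

definition IfFm :: "'r fm \<Rightarrow> 'r fm \<Rightarrow> 'r fm \<Rightarrow> 'r fm" where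
  "IfFm \<theta> \<phi> \<psi> = Disj (Conj \<theta> \<phi>) (Conj (Neg \<theta>) \<psi>)"

definition Choose :: "nat \<Rightarrow> 'r fm \<Rightarrow> 'r fm \<Rightarrow> 'r fm" where
  "Choose x \<theta> \<phi> = Exi x (Conj \<theta> \<phi>)"

text \<open>The verifier picks a disjunct and the falsifier may attack its guard. The disjunct with
  the false guard loses for the verifier, the attack on the true guard loses for the falsifier, so
  only the intended branch remains.\<close>

lemma det_IfFm:
  assumes "fo_fm \<theta>" "fo I \<theta> D v r \<Longrightarrow> det I \<phi> D v r S" "\<not> fo I \<theta> D v r \<Longrightarrow> det I \<psi> D v r S"
  shows "det I (IfFm \<theta> \<phi> \<psi>) D v r S"
proof (cases "fo I \<theta> D v r")
  case True
  show ?thesis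
    by (rule det_same[OF assms(2)[OF True]]) (auto simp: IfFm_def Disj_def ev_fo assms(1) True)
next
  case False
  show ?thesis
    by (rule det_same[OF assms(3)[OF False]]) (auto simp: IfFm_def Disj_def ev_fo assms(1) False)
qed

text \<open>Witnesses violating the guard are refuted at once, so the effective choices are those
  satisfying it; one must exist, as the verifier would otherwise be bound to lose.\<close>

lemma det_Choose:
  assumes "fo_fm \<theta>" "\<exists>a\<in>D. fo I \<theta> D (v(x := a)) r"
    and "\<And>a. a \<in> D \<Longrightarrow> fo I \<theta> D (v(x := a)) r \<Longrightarrow> det I \<phi> D (v(x := a)) r S"
  shows "det I (Choose x \<theta> \<phi>) D v r S"
proof (rule det_choice[where A = "{a \<in> D. fo I \<theta> D (v(x := a)) r}" and D' = "\<lambda>_. D"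
      and v' = "\<lambda>a. v(x := a)" and r' = "\<lambda>_. r" and \<psi> = \<phi>])
  show "ev I Q b (Choose x \<theta> \<phi>) D v r =
      choice b {a \<in> D. fo I \<theta> D (v(x := a)) r} (\<lambda>a. ev I Q b \<phi> D (v(x := a)) r)" for Q b
    by (auto simp: Choose_def choice_def ev_fo assms(1))
qed (use assms in auto)

lemma det_Exi:
  assumes "D \<noteq> {}" "\<And>a. a \<in> D \<Longrightarrow> det I \<phi> D (v(x := a)) r S"
  shows "det I (Exi x \<phi>) D v r S"
  by (rule det_choice[where A = D and D' = "\<lambda>_. D" and v' = "\<lambda>a. v(x := a)" and r' = "\<lambda>_. r" and \<psi> = \<phi>])
     (use assms in \<open>auto simp: choice_def\<close>)

definition Assign :: "nat \<Rightarrow> nat \<Rightarrow> 'r fm \<Rightarrow> 'r fm" where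
  "Assign x y \<phi> = Choose x (Eq x y) \<phi>"

text \<open>The guard is read after \<open>x\<close> has been overwritten, hence
  \<open>x \<noteq> y\<close>.\<close>

lemma det_Assign:
  assumes "x \<noteq> y" "v y \<in> D" "det I \<phi> D (v(x := v y)) r S"
  shows "det I (Assign x y \<phi>) D v r S"
  unfolding Assign_def by (rule det_Choose) (use assms in auto)

text \<open>The inserted element is fixed by Hilbert choice, but only its freshness is used; it
  exists because \<open>D\<close> is finite in an infinite type.\<close>

lemma det_InsEl:
  fixes D :: "'a::infinite set"
  assumes "finite D" "\<And>a. a \<notin> D \<Longrightarrow> det I \<phi> (insert a D) (v(x := a)) r S"
  shows "det I (InsEl x \<phi>) D v r S"
proof -
  have "(SOME a. a \<notin> D) \<notin> D"
    using ex_new_if_finite[OF infinite_UNIV assms(1)] by (rule someI_ex)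
  from assms(2)[OF this] show ?thesis by (rule det_same) (simp add: Let_def)
qed

section \<open>Program variables and guarded updates of relation variables\<close>

datatype var = Tmp1 | Tmp2 | Sym tsym | Sta nat | Tup nat | Zero | Cell | Elem | Last | LeftEnd | RightEnd
  | Head | Curr | Bit_val

instance tsym :: countable by countable_datatype
instance var :: countable by countable_datatype

definition nm :: "var \<Rightarrow> nat" where "nm = to_nat"

lemma nm_eq_iff [simp]: "nm x = nm y \<longleftrightarrow> x = y"
  by (simp add: nm_def)

text \<open>
  The tuple announced in an insertion or deletion is stored in \<open>Tmp1\<close> and \<open>Tmp2\<close>, and the guard
  forces it to be the tuple of the values of \<open>x\<close> and \<open>y\<close>.
\<close>

definition Put :: "nat \<Rightarrow> var \<Rightarrow> var \<Rightarrow> 'r fm \<Rightarrow> 'r fm" where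
  "Put i x y \<phi> = InsVar (RV 2 i) [nm Tmp1, nm Tmp2]
     (Conj (Conj (Eq (nm Tmp1) (nm x)) (Eq (nm Tmp2) (nm y))) \<phi>)"

definition Del :: "nat \<Rightarrow> var \<Rightarrow> var \<Rightarrow> 'r fm \<Rightarrow> 'r fm" where
  "Del i x y \<phi> = DelVar (RV 2 i) [nm Tmp1, nm Tmp2]
     (Conj (Conj (Eq (nm Tmp1) (nm x)) (Eq (nm Tmp2) (nm y))) \<phi>)"

definition clobber :: "(nat \<Rightarrow> 'a) \<Rightarrow> var \<Rightarrow> var \<Rightarrow> nat \<Rightarrow> 'a" where
  "clobber v x y = v(nm Tmp1 := v (nm x), nm Tmp2 := v (nm y))"

lemma tuples_2: "bs \<in> tuples 2 D \<longleftrightarrow> (\<exists>a\<in>D. \<exists>b\<in>D. bs = [a, b])"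
  by (auto simp: tuples_def numeral_2_eq_2 length_Suc_conv)

lemma upd_pair: "x \<noteq> y \<Longrightarrow> upd v [x, y] [a, b] = v(x := a, y := b)"
  by (auto simp: upd_def fun_eq_iff)

lemma choice_point: "x \<in> A \<Longrightarrow> choice b A (\<lambda>p. if p = x then R else \<not> b) = R"
  by (cases b; cases R) (auto simp: choice_def)

text \<open>The value \<open>\<not> b\<close> is a loss for whoever chooses, be it the player under
  consideration or the opponent; hence only the pair \<open>[c, d]\<close> counts.\<close>

lemma choice_tuples_2:
  assumes "c \<in> D" "d \<in> D" "P [c, d] = R"
    and "\<And>a a'. (a, a') \<noteq> (c, d) \<Longrightarrow> P [a, a'] = (\<not> b)"
  shows "choice b (tuples 2 D) P = R"
proof -
  have "tuples 2 D = (\<lambda>p. [fst p, snd p]) ` (D \<times> D)"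
    by (auto simp: tuples_2 set_eq_iff image_iff)
  then have "choice b (tuples 2 D) P = choice b (D \<times> D) (\<lambda>p. P [fst p, snd p])"
    by (simp add: choice_def)
  moreover have "(\<lambda>p. P [fst p, snd p]) = (\<lambda>p. if p = (c, d) then R else \<not> b)"
    using assms(3) assms(4)[of "fst p" "snd p" for p] by (intro ext) auto
  ultimately show ?thesis using choice_point[of "(c, d)" "D \<times> D"] assms(1,2) by simp
qed

text \<open>\<open>x\<close> and \<open>y\<close> must differ from the temporaries, since the guard
  compares their values after the temporaries have received the announced tuple.\<close>

lemma Tmp_guard:
  assumes "x \<notin> {Tmp1, Tmp2}" "y \<notin> {Tmp1, Tmp2}" "v (nm x) \<in> D" "v (nm y) \<in> D"
  shows "choice b (tuples 2 D) (\<lambda>bs. ev I Q b (Conj (Conj (Eq (nm Tmp1) (nm x)) (Eq (nm Tmp2) (nm y))) \<phi>)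
      D (upd v [nm Tmp1, nm Tmp2] bs) (F bs)) =
    ev I Q b \<phi> D (clobber v x y) (F [v (nm x), v (nm y)])"
  by (rule choice_tuples_2[OF assms(3,4)]) (use assms in \<open>auto simp: upd_pair clobber_def\<close>)

lemma det_Put:
  assumes "x \<notin> {Tmp1, Tmp2}" "y \<notin> {Tmp1, Tmp2}" "v (nm x) \<in> D" "v (nm y) \<in> D"
    and "det I \<phi> D (clobber v x y) (r(RV 2 i := insert [v (nm x), v (nm y)] (r (RV 2 i)))) S"
  shows "det I (Put i x y \<phi>) D v r S"
proof (rule det_same[OF assms(5)])
  show "ev I Q b (Put i x y \<phi>) D v r =
      ev I Q b \<phi> D (clobber v x y) (r(RV 2 i := insert [v (nm x), v (nm y)] (r (RV 2 i))))" for Q b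
    unfolding Tmp_guard[OF assms(1-4), where F = "\<lambda>bs. r(RV 2 i := insert bs (r (RV 2 i)))", symmetric]
    by (cases b) (simp_all add: Put_def choice_def numeral_2_eq_2)
qed

lemma det_Del:
  assumes "x \<notin> {Tmp1, Tmp2}" "y \<notin> {Tmp1, Tmp2}" "v (nm x) \<in> D" "v (nm y) \<in> D"
    and "det I \<phi> D (clobber v x y) (r(RV 2 i := r (RV 2 i) - {[v (nm x), v (nm y)]})) S"
  shows "det I (Del i x y \<phi>) D v r S"
proof (rule det_same[OF assms(5)])
  show "ev I Q b (Del i x y \<phi>) D v r =
      ev I Q b \<phi> D (clobber v x y) (r(RV 2 i := r (RV 2 i) - {[v (nm x), v (nm y)]}))" for Q b
    unfolding Tmp_guard[OF assms(1-4), where F = "\<lambda>bs. r(RV 2 i := r (RV 2 i) - {bs})", symmetric]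
    by (cases b) (simp_all add: Del_def choice_def numeral_2_eq_2)
qed

lemma sat_iff_outcome:
  fixes \<phi> :: "'r fm" and \<AA> :: "('a::infinite, 'r) model"
    and Inv :: "'i \<Rightarrow> nat \<Rightarrow> 'a set \<Rightarrow> (nat \<Rightarrow> 'a) \<Rightarrow> (relvar \<Rightarrow> 'a list set) \<Rightarrow> bool"
    and H :: "bool \<Rightarrow> bool" and \<mu> :: "('i \<times> 'i) set"
  assumes norel: "norel \<phi>" and struct: "structured \<phi>"
    and step: "\<And>i k D v r. Inv i k D v r \<Longrightarrow> \<exists>\<chi>. (k, \<chi>) \<in> labset \<phi> \<and>
      det (interp \<AA>) \<chi> D v r ({Halt c | c. H c} \<union>
        {At k' D' v' r' | j k' D' v' r'. Inv j k' D' v' r' \<and> (H True \<or> H False \<longrightarrow> (j, i) \<in> \<mu>)})"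
    and init: "\<And>v. det (interp \<AA>) \<phi> (univ \<AA>) v (\<lambda>_. {}) {At k D v r | i k D v r. Inv i k D v r}"
    and wf: "wf \<mu>" and excl: "\<not> (H True \<and> H False)"
  shows "sat \<AA> (player_sign b) \<phi> \<longleftrightarrow> H b"
proof -
  note uniq = structured_labset_unique[OF struct]
  have e: "rel_value empty_assignment = (\<lambda>_. {})"
    by (simp add: rel_value_def empty_assignment_def fun_eq_iff)
  have lab: "k \<in> labels \<phi>" if "Inv i k D v r" for i k D v r
    using step[OF that] by force
  show ?thesis
  proof
    assume "sat \<AA> (player_sign b) \<phi>"
    then have w: "wins \<phi> Eloise (\<AA>, empty_assignment, player_sign b, \<phi>)" by (simp add: sat_iff_wins)
    \<comment> \<open>Upper bound: at a state of the invariant a win forces the answer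
      \<open>H b\<close>. Elsewhere \<open>Q\<close> holds trivially, which also covers numbers that
      are not labels.\<close>
    define Q where "Q k b D v r \<longleftrightarrow> ((\<exists>i. Inv i k D v r) \<longrightarrow> H b)" for k b D v r
    have "ev (interp \<AA>) Q b \<phi> (univ \<AA>) (fo_val empty_assignment) (rel_value empty_assignment)"
    proof (rule ev_if_wins[OF w refl norel norel subset_refl])
      fix k \<chi> b D v r
      assume k: "(k, \<chi>) \<in> labset \<phi>" and e: "ev (interp \<AA>) Q b \<chi> D v r"
      show "Q k b D v r" unfolding Q_def
      proof (intro impI, elim exE)
        fix i assume "Inv i k D v r"
        from step[OF this] uniq[OF k] have "det (interp \<AA>) \<chi> D v r ({Halt c | c. H c} \<union>
          {At k' D' v' r' | j k' D' v' r'. Inv j k' D' v' r' \<and> (H True \<or> H False \<longrightarrow> (j, i) \<in> \<mu>)})"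
          by blast
        then obtain N where N: "N \<noteq> {}"
          "N \<subseteq> {Halt c | c. H c} \<union> {At k' D' v' r' | j k' D' v' r'. Inv j k' D' v' r' \<and> (H True \<or> H False \<longrightarrow> (j, i) \<in> \<mu>)}"
          "\<And>Q b. ev (interp \<AA>) Q b \<chi> D v r = choice b N (outcome_val Q b)"
          by (rule detE) blast
        from e N(1,3) choice_nonempty obtain x where x: "x \<in> N" "outcome_val Q b x" by metis
        from subsetD[OF N(2) x(1)] x(2) show "H b" by (auto simp: Q_def)
      qed
    next
      fix k b D v r assume "k \<notin> labels \<phi>"
      then show "Q k b D v r" using lab unfolding Q_def by blast
    qed
    moreover obtain N where N: "N \<noteq> {}" "N \<subseteq> {At k D v r | i k D v r. Inv i k D v r}"
      "\<And>Q b. ev (interp \<AA>) Q b \<phi> (univ \<AA>) (fo_val empty_assignment) (\<lambda>_. {}) = choice b N (outcome_val Q b)"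
      by (rule detE[OF init[of "fo_val empty_assignment"]]) blast
    ultimately have "choice b N (outcome_val Q b)" unfolding e by blast
    with N(1) obtain x where x: "x \<in> N" "outcome_val Q b x" using choice_nonempty by metis
    from subsetD[OF N(2) x(1)] x(2) show "H b" by (auto simp: Q_def)
  next
    assume H: "H b"
    define Q where "Q k c D v r \<longleftrightarrow> c = b \<and> (\<exists>i. Inv i k D v r)" for k c D v r
    have win: "wins \<phi> Eloise (\<BB>, g, player_sign b, \<chi>)"
      if "Inv i k (univ \<BB>) (fo_val g) (rel_value g)" "interp \<BB> = interp \<AA>" "(k, \<chi>) \<in> labset \<phi>" for i k \<BB> g \<chi>
      using wf that
    proof (induction i arbitrary: k \<BB> g \<chi> rule: wf_induct_rule)
      case (less i)
      \<comment> \<open>Only states of smaller measure, and only the role \<open>b\<close>: this is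
        what the induction hypothesis provides.\<close>
      define Q where "Q k c D v r \<longleftrightarrow> c = b \<and> (\<exists>j. (j, i) \<in> \<mu> \<and> Inv j k D v r)" for k c D v r
      from step[OF less.prems(1)] uniq[OF less.prems(3)]
      have "det (interp \<AA>) \<chi> (univ \<BB>) (fo_val g) (rel_value g) ({Halt c | c. H c} \<union>
          {At k' D' v' r' | j k' D' v' r'. Inv j k' D' v' r' \<and> (H True \<or> H False \<longrightarrow> (j, i) \<in> \<mu>)})"
        by blast
      then obtain N where N: "N \<noteq> {}"
        "N \<subseteq> {Halt c | c. H c} \<union> {At k' D' v' r' | j k' D' v' r'. Inv j k' D' v' r' \<and> (H True \<or> H False \<longrightarrow> (j, i) \<in> \<mu>)}"
        "\<And>Q b. ev (interp \<AA>) Q b \<chi> (univ \<BB>) (fo_val g) (rel_value g) = choice b N (outcome_val Q b)"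
        by (rule detE) blast
      have HH: "H True \<or> H False" using H by (cases b) simp_all
      \<comment> \<open>An end of the play allowed by \<open>H\<close> has the wanted value, because
        the two answers exclude each other.\<close>
      have c: "c = b" if "H c" for c using H excl that by (cases b; cases c) simp_all
      have "outcome_val Q b x" if "x \<in> N" for x
        using subsetD[OF N(2) that] HH c by (auto simp: Q_def)
      with N(1,3) have "ev (interp \<AA>) Q b \<chi> (univ \<BB>) (fo_val g) (rel_value g)"
        by (simp add: choice_all)
      then show ?case
      proof (rule wins_if_ev[OF norel_labset[OF norel less.prems(3)] _ less.prems(2) labset_trans[OF less.prems(3)]])
        fix k c and \<BB>' :: "('a, 'r) model" and g'
        assume "Q k c (univ \<BB>') (fo_val g') (rel_value g')" "interp \<BB>' = interp \<AA>"
        then show "k \<in> labels \<phi> \<and>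
          (\<forall>\<chi>. (k, \<chi>) \<in> labset \<phi> \<longrightarrow> wins \<phi> Eloise (\<BB>', g', player_sign c, \<chi>))"
          using less.IH lab unfolding Q_def by blast
      qed
    qed
    obtain N where N: "N \<noteq> {}" "N \<subseteq> {At k D v r | i k D v r. Inv i k D v r}"
      "\<And>Q b. ev (interp \<AA>) Q b \<phi> (univ \<AA>) (fo_val empty_assignment) (\<lambda>_. {}) = choice b N (outcome_val Q b)"
      by (rule detE[OF init[of "fo_val empty_assignment"]]) blast
    have "outcome_val Q b x" if "x \<in> N" for x
      using subsetD[OF N(2) that] by (auto simp: Q_def)
    with N(1,3) have "ev (interp \<AA>) Q b \<phi> (univ \<AA>) (fo_val empty_assignment) (rel_value empty_assignment)"
      by (simp add: choice_all e)
    then have "wins \<phi> Eloise (\<AA>, empty_assignment, player_sign b, \<phi>)"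
    proof (rule wins_if_ev[OF norel _ refl subset_refl])
      fix k c and \<BB>' :: "('a, 'r) model" and g'
      assume "Q k c (univ \<BB>') (fo_val g') (rel_value g')" "interp \<BB>' = interp \<AA>"
      then show "k \<in> labels \<phi> \<and>
        (\<forall>\<chi>. (k, \<chi>) \<in> labset \<phi> \<longrightarrow> wins \<phi> Eloise (\<BB>', g', player_sign c, \<chi>))"
        using win lab unfolding Q_def by blast
    qed
    then show "sat \<AA> (player_sign b) \<phi>" by (simp add: sat_iff_wins)
  qed
qed

section \<open>Ordered tuples\<close>

abbreviation ordR :: relvar where "ordR \<equiv> RV 2 5"
abbreviation adjR :: relvar where "adjR \<equiv> RV 2 4"
abbreviation symR :: relvar where "symR \<equiv> RV 2 2"
abbreviation markR :: relvar where "markR \<equiv> RV 2 3"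

abbreviation (input) val :: "(nat \<Rightarrow> 'a) \<Rightarrow> var \<Rightarrow> 'a" where "val v x \<equiv> v (nm x)"

definition agree :: "var set \<Rightarrow> (nat \<Rightarrow> 'a) \<Rightarrow> (nat \<Rightarrow> 'a) \<Rightarrow> bool" where
  "agree X v v' \<longleftrightarrow> (\<forall>x. x \<notin> X \<longrightarrow> val v' x = val v x)"

lemma agreeD: "agree X v v' \<Longrightarrow> x \<notin> X \<Longrightarrow> val v' x = val v x"
  by (simp add: agree_def)

lemma agree_trans: "agree X v v' \<Longrightarrow> agree Y v' v'' \<Longrightarrow> agree (X \<union> Y) v v''"
  by (simp add: agree_def)

lemma agree_mono: "agree X v v' \<Longrightarrow> X \<subseteq> Y \<Longrightarrow> agree Y v v'"
  by (auto simp: agree_def)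

lemma clobber_apply [simp]: "x \<noteq> Tmp1 \<Longrightarrow> x \<noteq> Tmp2 \<Longrightarrow> clobber v y z (nm x) = v (nm x)"
  by (simp add: clobber_def)

definition Atom :: "nat \<Rightarrow> var \<Rightarrow> var \<Rightarrow> 'r fm" where
  "Atom i x y = RVar (RV 2 i) [nm x, nm y]"

lemma fo_Atom [simp]: "fo I (Atom i x y) D v r \<longleftrightarrow> [val v x, val v y] \<in> r (RV 2 i)"
  by (simp add: Atom_def)

lemma fo_fm_Atom [simp]: "fo_fm (Atom i x y)"
  by (simp add: Atom_def)

text \<open>
  \<open>markR\<close> holds of the inserted elements and of the domain elements listed so far, so the unmarked
  elements are those still to be listed.
\<close>

definition New :: "var \<Rightarrow> 'r fm \<Rightarrow> 'r fm" where
  "New x \<phi> = InsEl (nm x) (Put 3 x x \<phi>)"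

definition Append :: "var \<Rightarrow> 'r fm \<Rightarrow> 'r fm" where
  "Append y \<phi> = New Cell (Put 4 RightEnd Cell (Put 2 Cell y (Assign (nm RightEnd) (nm Cell) \<phi>)))"

definition Prepend :: "var \<Rightarrow> 'r fm \<Rightarrow> 'r fm" where
  "Prepend y \<phi> = New Cell (Put 4 Cell LeftEnd (Put 2 Cell y (Assign (nm LeftEnd) (nm Cell) \<phi>)))"

text \<open>The constant \<open>Zero\<close> precedes the listed elements in the successor chain,
  which makes the least element definable as its successor.\<close>

definition Reset :: "var list \<Rightarrow> 'r fm \<Rightarrow> 'r fm" where
  "Reset us \<phi> = foldr (\<lambda>u. Choose (nm u) (Atom 5 Zero u)) us \<phi>"

text \<open>
  An odometer on the tuple \<open>us\<close>: continue with \<open>\<phi>\<close> at the lexicographic successor of the tuple,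
  or with \<open>\<psi>\<close> if there is none.
\<close>

fun Next :: "var list \<Rightarrow> 'r fm \<Rightarrow> 'r fm \<Rightarrow> 'r fm" where
  "Next [] \<phi> \<psi> = \<psi>"
| "Next (u # us) \<phi> \<psi> = Next us \<phi>
     (IfFm (Exi (nm Elem) (Atom 5 u Elem))
        (Choose (nm Elem) (Atom 5 u Elem) (Assign (nm u) (nm Elem) (Reset us \<phi>))) \<psi>)"

lemma det_New:
  fixes D :: "'a::infinite set"
  assumes "finite D" "x \<notin> {Tmp1, Tmp2}"
    and "\<And>a v'. a \<notin> D \<Longrightarrow> agree {x, Tmp1, Tmp2} v v' \<Longrightarrow> val v' x = a \<Longrightarrow>
      det I \<phi> (insert a D) v' (r(markR := insert [a, a] (r markR))) S"
  shows "det I (New x \<phi>) D v r S"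
  unfolding New_def
proof (rule det_InsEl[OF assms(1)])
  fix a assume a: "a \<notin> D"
  have "agree {x, Tmp1, Tmp2} v (clobber (v(nm x := a)) x x)"
    "val (clobber (v(nm x := a)) x x) x = a"
    using assms(2) by (auto simp: agree_def)
  from assms(3)[OF a this] show "det I (Put 3 x x \<phi>) (insert a D) (v(nm x := a)) r S"
    using assms(2) by (intro det_Put) (simp_all add: fun_upd_def)
qed

text \<open>Each new element avoids the domain already enlarged by the previous ones, whence
  injectivity.\<close>

lemma det_News:
  fixes D :: "'a::infinite set"
  assumes "finite D" "set xs \<inter> {Tmp1, Tmp2} = {}" "distinct xs"
    and "\<And>D' v'. finite D' \<Longrightarrow> D \<subseteq> D' \<Longrightarrow> agree (set xs \<union> {Tmp1, Tmp2}) v v' \<Longrightarrow>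
      inj_on (val v') (set xs) \<Longrightarrow> val v' ` set xs \<subseteq> D' - D \<Longrightarrow>
      det I \<phi> D' v' (r(markR := r markR \<union> {[a, a] | a. a \<in> D' - D})) S"
  shows "det I (foldr New xs \<phi>) D v r S"
  using assms
proof (induction xs arbitrary: D v r)
  case Nil
  from Nil.prems(4)[of D v] Nil.prems(1) show ?case by (simp add: agree_def)
next
  case (Cons x xs)
  show ?case unfolding foldr.simps o_apply
  proof (rule det_New[OF Cons.prems(1)])
    show "x \<notin> {Tmp1, Tmp2}" using Cons.prems(2) by auto
    fix a v'
    assume a: "a \<notin> D" "agree {x, Tmp1, Tmp2} v v'" "val v' x = a"
    show "det I (foldr New xs \<phi>) (insert a D) v' (r(markR := insert [a, a] (r markR))) S"
    proof (rule Cons.IH)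
      fix D' v''
      assume D': "finite D'" "insert a D \<subseteq> D'" "agree (set xs \<union> {Tmp1, Tmp2}) v' v''"
        "inj_on (val v'') (set xs)" "val v'' ` set xs \<subseteq> D' - insert a D"
      have x: "val v'' x = a" using agreeD[OF D'(3), of x] a(3) Cons.prems(2,3) by auto
      have "det I \<phi> D' v'' (r(markR := r markR \<union> {[a, a] | a. a \<in> D' - D})) S"
      proof (rule Cons.prems(4)[OF D'(1)])
        show "agree (set (x # xs) \<union> {Tmp1, Tmp2}) v v''"
          using agree_trans[OF a(2) D'(3)] by (rule agree_mono) auto
        show "inj_on (val v'') (set (x # xs))" using D'(4,5) x by (auto simp: inj_on_def)
        show "val v'' ` set (x # xs) \<subseteq> D' - D" using D'(2,5) x a(1) by auto
        show "D \<subseteq> D'" using D'(2) by auto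
      qed
      moreover have "r markR \<union> {[a, a] | a. a \<in> D' - D} =
          insert [a, a] (r markR) \<union> {[b, b] | b. b \<in> D' - insert a D}"
        using D'(2) a(1) by auto
      ultimately show "det I \<phi> D' v'' ((r(markR := insert [a, a] (r markR)))
          (markR := (r(markR := insert [a, a] (r markR))) markR \<union> {[b, b] | b. b \<in> D' - insert a D})) S"
        by simp
    qed (use Cons.prems in auto)
  qed
qed

section \<open>Successor chains and the odometer\<close>

definition succ_pairs :: "'a list \<Rightarrow> 'a list set" where
  "succ_pairs xs = {[a, b] | a b. \<exists>p q. xs = p @ a # b # q}"

lemma succ_pairs_snoc:
  assumes "xs \<noteq> []"
  shows "succ_pairs (xs @ [x]) = insert [last xs, x] (succ_pairs xs)"
proof -
  have *: "(\<exists>p q. xs @ [x] = p @ a # b # q) \<longleftrightarrow> (a = last xs \<and> b = x) \<or> (\<exists>p q. xs = p @ a # b # q)" for a b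
  proof
    assume "\<exists>p q. xs @ [x] = p @ a # b # q"
    then obtain p q where pq: "xs @ [x] = p @ a # b # q" by blast
    show "(a = last xs \<and> b = x) \<or> (\<exists>p q. xs = p @ a # b # q)"
    proof (cases q rule: rev_cases)
      case Nil
      then have "xs @ [x] = (p @ [a]) @ [b]" using pq by simp
      then show ?thesis by (auto simp only: append1_eq_conv last_snoc)
    next
      case (snoc q' y)
      then have "xs @ [x] = (p @ a # b # q') @ [y]" using pq by simp
      then show ?thesis by (auto simp only: append1_eq_conv)
    qed
  next
    assume "(a = last xs \<and> b = x) \<or> (\<exists>p q. xs = p @ a # b # q)"
    then show "\<exists>p q. xs @ [x] = p @ a # b # q"
    proof
      assume "a = last xs \<and> b = x"
      then have "xs @ [x] = butlast xs @ a # b # []" using assms by simp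
      then show ?thesis by blast
    next
      assume "\<exists>p q. xs = p @ a # b # q"
      then obtain p q where "xs = p @ a # b # q" by blast
      then have "xs @ [x] = p @ a # b # (q @ [x])" by simp
      then show ?thesis by blast
    qed
  qed
  show ?thesis unfolding succ_pairs_def * by blast
qed

lemma succ_pairs_single [simp]: "succ_pairs [x] = {}"
  by (auto simp: succ_pairs_def Cons_eq_append_conv)

lemma succ_pairs_iff:
  assumes "distinct xs" "xs = p @ a # q"
  shows "[a, b] \<in> succ_pairs xs \<longleftrightarrow> (\<exists>q'. q = b # q')"
proof
  assume "[a, b] \<in> succ_pairs xs"
  then obtain p' q' where "xs = p' @ a # b # q'" by (auto simp: succ_pairs_def)
  moreover have "a \<notin> set p" "a \<notin> set q" using assms by auto
  ultimately have "q = b # q'" using append_Cons_eq_iff[of a p q p' "b # q'"] assms(2) by simp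
  then show "\<exists>q'. q = b # q'" by blast
qed (use assms in \<open>auto simp: succ_pairs_def\<close>)

lemma det_Reset:
  assumes "r ordR = succ_pairs (z # as)" "distinct (z # as)" "as \<noteq> []" "set as \<subseteq> D"
    and "val v Zero = z" "Zero \<notin> set us"
    and "\<And>v'. agree (set us) v v' \<Longrightarrow> map (val v') us = replicate (length us) (hd as) \<Longrightarrow> det I \<phi> D v' r S"
  shows "det I (Reset us \<phi>) D v r S"
  using assms(5-)
proof (induction us arbitrary: v)
  case Nil
  then show ?case by (simp add: Reset_def agree_def)
next
  case (Cons u us)
  have s: "[z, a] \<in> r ordR \<longleftrightarrow> a = hd as" for a
    using succ_pairs_iff[OF assms(2), of "[]" z as a] assms(1,3) by (cases as) auto
  have "det I (Choose (nm u) (Atom 5 Zero u) (Reset us \<phi>)) D v r S"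
  proof (rule det_Choose)
    show "\<exists>a\<in>D. fo I (Atom 5 Zero u) D (v(nm u := a)) r"
      using assms(3,4) Cons.prems(1,2) s by (intro bexI[of _ "hd as"]) auto
    fix a assume a: "a \<in> D" "fo I (Atom 5 Zero u) D (v(nm u := a)) r"
    then have ah: "a = hd as" using Cons.prems(1,2) s by auto
    show "det I (Reset us \<phi>) D (v(nm u := a)) r S"
    proof (rule Cons.IH)
      fix v'
      assume v': "agree (set us) (v(nm u := a)) v'" "map (val v') us = replicate (length us) (hd as)"
      have "val v' u = hd as"
      proof (cases "u \<in> set us")
        case True
        then show ?thesis using v'(2) by (metis in_set_conv_nth length_map nth_map nth_replicate)
      next
        case False
        then show ?thesis using agreeD[OF v'(1)] ah by simp
      qed
      moreover have "agree (set (u # us)) v v'"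
        using v'(1) by (auto simp: agree_def)
      ultimately show "det I \<phi> D v' r S" using v'(2) by (intro Cons.prems(3)) auto
    qed (use Cons.prems in auto)
  qed simp
  then show ?case by (simp add: Reset_def)
qed

lemma product_lists_replicate_hd:
  "as \<noteq> [] \<Longrightarrow> \<exists>ps. product_lists (replicate k as) = replicate k (hd as) # ps"
proof (induction k)
  case (Suc k)
  then obtain ps where "product_lists (replicate k as) = replicate k (hd as) # ps" by blast
  then show ?case using Suc.prems by (cases as) auto
qed simp

text \<open>The last component runs fastest: the tail is advanced first, and only when it is
  exhausted does \<open>u\<close> step to its successor while the tail restarts. This mirrors
  \<open>product_lists\<close>, whose block for a fixed first component is a copy of the list for
  the tail.\<close>

lemma det_Next:
  assumes ord: "r ordR = succ_pairs (z # as)" "distinct (z # as)" "set as \<subseteq> D" "val v Zero = z"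
    and us: "distinct us" "set us \<subseteq> range Tup"
    and prod: "product_lists (replicate (length us) as) = pre @ map (val v) us # post"
    and nx: "\<And>v' post'. agree (insert Elem (set us)) v v' \<Longrightarrow> post = map (val v') us # post' \<Longrightarrow> det I \<phi> D v' r S"
    and dn: "post = [] \<Longrightarrow> det I \<psi> D v r S"
  shows "det I (Next us \<phi> \<psi>) D v r S"
  using us prod nx dn
proof (induction us arbitrary: pre post \<psi>)
  case Nil
  from Nil.prems(3) have "post = []" by (simp add: Cons_eq_append_conv)
  then show ?case using Nil.prems(5) by simp
next
  case (Cons u us)
  let ?P = "product_lists (replicate (length us) as)"
  let ?F = "\<lambda>a. map ((#) a) ?P"
  define a where "a = val v u"
  define t where "t = map (val v) us"
  have full: "concat (map ?F as) = pre @ (a # t) # post" using Cons.prems(3) by (simp add: a_def t_def)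
  have "distinct (product_lists (replicate (length (u # us)) as))"
    using ord(2) by (intro distinct_product_lists) auto
  then have dist: "distinct (concat (map ?F as))" by simp
  have "a # t \<in> set (concat (map ?F as))" unfolding full by simp
  then have at: "a \<in> set as" "t \<in> set ?P" by auto
  then obtain as1 as2 p1 p2 where split: "as = as1 @ a # as2" "?P = p1 @ t # p2"
    by (meson split_list)
  have "concat (map ?F as) =
      (concat (map ?F as1) @ map ((#) a) p1) @ (a # t) # (map ((#) a) p2 @ concat (map ?F as2))"
    by (subst split(1)) (simp add: split(2))
  then have eq: "pre @ (a # t) # post =
      (concat (map ?F as1) @ map ((#) a) p1) @ (a # t) # (map ((#) a) p2 @ concat (map ?F as2))"
    using full by (rule trans[OF sym, rotated])
  \<comment> \<open>The list of tuples has no repetitions, so the current tuple occurs at one place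
    only and the two decompositions coincide.\<close>
  have "a # t \<notin> set pre" "a # t \<notin> set post" using dist unfolding full by auto
  from iffD1[OF append_Cons_eq_iff[OF this] eq]
  have post: "post = map ((#) a) p2 @ concat (map ?F as2)" by (rule conjunct2)
  have as: "as \<noteq> []" using split(1) by simp
  have uE: "u \<noteq> Elem" "u \<notin> set us" "Elem \<notin> set us" "Zero \<notin> set us" "u \<noteq> Zero"
    using Cons.prems(1,2) by auto
  have succ: "[a, b] \<in> r ordR \<longleftrightarrow> (\<exists>q. as2 = b # q)" for b
    using succ_pairs_iff[OF ord(2), of "z # as1" a as2 b] ord(1) split(1) by simp
  show ?case unfolding Next.simps
  proof (rule Cons.IH)
    show "?P = p1 @ map (val v) us # p2" using split(2) by (simp add: t_def)
    fix v' post'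
    assume v': "agree (insert Elem (set us)) v v'" "p2 = map (val v') us # post'"
    have "val v' u = a" using agreeD[OF v'(1)] uE by (simp add: a_def)
    then show "det I \<phi> D v' r S"
      using v' agree_mono[OF v'(1)] by (intro Cons.prems(4)) (auto simp: post)
  next
    assume p2: "p2 = []"
    show "det I (IfFm (Exi (nm Elem) (Atom 5 u Elem))
        (Choose (nm Elem) (Atom 5 u Elem) (Assign (nm u) (nm Elem) (Reset us \<phi>))) \<psi>) D v r S"
    proof (rule det_IfFm)
      assume "fo I (Exi (nm Elem) (Atom 5 u Elem)) D v r"
      then obtain b where b: "b \<in> D" "[a, b] \<in> r ordR" using uE(1) by (auto simp: a_def)
      show "det I (Choose (nm Elem) (Atom 5 u Elem) (Assign (nm u) (nm Elem) (Reset us \<phi>))) D v r S"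
      proof (rule det_Choose)
        show "\<exists>b\<in>D. fo I (Atom 5 u Elem) D (v(nm Elem := b)) r"
          using b uE(1) by (auto simp: a_def)
        fix b assume b: "b \<in> D" "fo I (Atom 5 u Elem) D (v(nm Elem := b)) r"
        then obtain q where q: "as2 = b # q" using succ uE(1) by (auto simp: a_def)
        show "det I (Assign (nm u) (nm Elem) (Reset us \<phi>)) D (v(nm Elem := b)) r S"
        proof (rule det_Assign)
          show "det I (Reset us \<phi>) D ((v(nm Elem := b))(nm u := (v(nm Elem := b)) (nm Elem))) r S"
          proof (rule det_Reset[where r = r and z = z and as = as, OF ord(1,2) as ord(3)])
            fix v'
            assume v': "agree (set us) ((v(nm Elem := b))(nm u := (v(nm Elem := b)) (nm Elem))) v'"
              "map (val v') us = replicate (length us) (hd as)"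
            have "val v' u = b" using agreeD[OF v'(1) uE(2)] by simp
            moreover obtain ps where "?P = replicate (length us) (hd as) # ps"
              using product_lists_replicate_hd[OF as] by blast
            ultimately have "post = map (val v') (u # us) # map ((#) b) ps @ concat (map ?F q)"
              by (simp add: post p2 q v'(2))
            moreover have "agree (insert Elem (set (u # us))) v v'"
              using v'(1) by (auto simp: agree_def)
            ultimately show "det I \<phi> D v' r S" by (intro Cons.prems(4))
          qed (use uE ord(4) in auto)
        qed (use uE b in auto)
      qed simp
    next
      assume n: "\<not> fo I (Exi (nm Elem) (Atom 5 u Elem)) D v r"
      have "as2 = []"
      proof (rule ccontr)
        assume "as2 \<noteq> []"
        then obtain b q where q: "as2 = b # q" by (cases as2) auto
        then have "b \<in> D" using split(1) ord(3) by auto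
        with n succ[of b] q uE(1) show False by (auto simp: a_def)
      qed
      with p2 post show "det I \<psi> D v r S" by (intro Cons.prems(5)) simp
    qed simp
  qed (use Cons.prems in auto)
qed

section \<open>Tapes as linked lists\<close>

lemma agree_refl [simp, intro]: "agree X v v"
  by (simp add: agree_def)

lemma agree_upd [intro]: "agree X v v' \<Longrightarrow> x \<in> X \<Longrightarrow> agree X v (v'(nm x := a))"
  by (auto simp: agree_def)

lemma agree_clobber [intro]: "agree X v v' \<Longrightarrow> Tmp1 \<in> X \<Longrightarrow> Tmp2 \<in> X \<Longrightarrow> agree X v (clobber v' x y)"
  by (auto simp: agree_def clobber_def)

text \<open>
  The cells \<open>pos lo\<close>, ..., \<open>pos hi\<close> are linked by \<open>adjR\<close>, and \<open>symR\<close> relates each cell to the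
  constant for its symbol. All other positions are blank.
\<close>

definition tape_ok :: "tsym set \<Rightarrow> 'a set \<Rightarrow> (nat \<Rightarrow> 'a) \<Rightarrow> (relvar \<Rightarrow> 'a list set) \<Rightarrow>
    int \<Rightarrow> int \<Rightarrow> (int \<Rightarrow> tsym) \<Rightarrow> (int \<Rightarrow> 'a) \<Rightarrow> bool" where
  "tape_ok \<Gamma> D v r lo hi t pos \<longleftrightarrow>
     lo \<le> hi \<and> inj_on pos {lo..hi} \<and> pos ` {lo..hi} \<subseteq> D \<and>
     val v LeftEnd = pos lo \<and> val v RightEnd = pos hi \<and>
     r adjR = (\<lambda>i. [pos i, pos (i + 1)]) ` {lo..<hi} \<and>
     r symR = (\<lambda>i. [pos i, val v (Sym (t i))]) ` {lo..hi} \<and>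
     (\<forall>i. i < lo \<or> hi < i \<longrightarrow> t i = Blank) \<and> range t \<subseteq> \<Gamma>"

lemma tape_ok_cong:
  assumes "tape_ok \<Gamma> D v r lo hi t pos" "agree X v v'" "X \<inter> ({LeftEnd, RightEnd} \<union> range Sym) = {}"
    and "r' adjR = r adjR" "r' symR = r symR" "D \<subseteq> D'"
  shows "tape_ok \<Gamma> D' v' r' lo hi t pos"
proof -
  have "val v' x = val v x" if "x \<in> {LeftEnd, RightEnd} \<union> range Sym" for x
    using that assms(2,3) by (intro agreeD) auto
  then show ?thesis using assms(1,4-6) unfolding tape_ok_def by auto
qed

text \<open>Freshness of \<open>c\<close> keeps \<open>pos\<close> injective. Input bits and the
  blanks added at the right end during the run are both covered, the symbol \<open>a\<close> being
  arbitrary.\<close>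

lemma tape_ok_extend_right:
  assumes t: "tape_ok \<Gamma> D v r lo hi t pos" and c: "c \<notin> D" and a: "a \<in> \<Gamma>"
    and v': "\<And>s. val v' (Sym s) = val v (Sym s)" "val v' LeftEnd = val v LeftEnd" "val v' RightEnd = c"
    and r': "r' adjR = insert [val v RightEnd, c] (r adjR)" "r' symR = insert [c, val v (Sym a)] (r symR)"
  shows "tape_ok \<Gamma> (insert c D) v' r' lo (hi + 1) (t(hi + 1 := a)) (pos(hi + 1 := c))"
proof -
  let ?pos = "pos(hi + 1 := c)" and ?t = "t(hi + 1 := a)"
  have le: "lo \<le> hi" and inj: "inj_on pos {lo..hi}" and im: "pos ` {lo..hi} \<subseteq> D"
    and adj: "r adjR = (\<lambda>i. [pos i, pos (i + 1)]) ` {lo..<hi}"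
    and sym: "r symR = (\<lambda>i. [pos i, val v (Sym (t i))]) ` {lo..hi}"
    and ends: "val v LeftEnd = pos lo" "val v RightEnd = pos hi"
    and bl: "\<forall>i. i < lo \<or> hi < i \<longrightarrow> t i = Blank" "range t \<subseteq> \<Gamma>"
    using t by (simp_all add: tape_ok_def)
  have iv: "{lo..hi + 1} = insert (hi + 1) {lo..hi}" using le by auto
  have same: "?pos i = pos i" "?t i = t i" if "i \<le> hi" for i using that by simp_all
  have "inj_on ?pos {lo..hi + 1}"
    unfolding iv using inj im c same(1) by (auto simp: inj_on_def)
  moreover have "?pos ` {lo..hi + 1} \<subseteq> insert c D" unfolding iv using im by auto
  moreover have "r' adjR = (\<lambda>i. [?pos i, ?pos (i + 1)]) ` {lo..<hi + 1}"
  proof -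
    have iv': "{lo..<hi + 1} = insert hi {lo..<hi}" using le by auto
    have "(\<lambda>i. [?pos i, ?pos (i + 1)]) ` {lo..<hi} = (\<lambda>i. [pos i, pos (i + 1)]) ` {lo..<hi}"
      by (intro image_cong) auto
    then show ?thesis unfolding iv' r' adj ends by simp
  qed
  moreover have "r' symR = (\<lambda>i. [?pos i, val v' (Sym (?t i))]) ` {lo..hi + 1}"
  proof -
    have "(\<lambda>i. [?pos i, val v' (Sym (?t i))]) ` {lo..hi} = (\<lambda>i. [pos i, val v (Sym (t i))]) ` {lo..hi}"
      using v'(1) by (intro image_cong) auto
    then show ?thesis unfolding iv r' sym using v'(1) by simp
  qed
  ultimately show ?thesis using le ends v' bl a unfolding tape_ok_def by (auto simp: image_subset_iff)
qed

lemma tape_ok_extend_left: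
  assumes t: "tape_ok \<Gamma> D v r lo hi t pos" and c: "c \<notin> D" and a: "a \<in> \<Gamma>"
    and v': "\<And>s. val v' (Sym s) = val v (Sym s)" "val v' RightEnd = val v RightEnd" "val v' LeftEnd = c"
    and r': "r' adjR = insert [c, val v LeftEnd] (r adjR)" "r' symR = insert [c, val v (Sym a)] (r symR)"
  shows "tape_ok \<Gamma> (insert c D) v' r' (lo - 1) hi (t(lo - 1 := a)) (pos(lo - 1 := c))"
proof -
  let ?pos = "pos(lo - 1 := c)" and ?t = "t(lo - 1 := a)"
  have le: "lo \<le> hi" and inj: "inj_on pos {lo..hi}" and im: "pos ` {lo..hi} \<subseteq> D"
    and adj: "r adjR = (\<lambda>i. [pos i, pos (i + 1)]) ` {lo..<hi}"
    and sym: "r symR = (\<lambda>i. [pos i, val v (Sym (t i))]) ` {lo..hi}"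
    and ends: "val v LeftEnd = pos lo" "val v RightEnd = pos hi"
    and bl: "\<forall>i. i < lo \<or> hi < i \<longrightarrow> t i = Blank" "range t \<subseteq> \<Gamma>"
    using t by (simp_all add: tape_ok_def)
  have iv: "{lo - 1..hi} = insert (lo - 1) {lo..hi}" using le by auto
  have same: "?pos i = pos i" "?t i = t i" if "lo \<le> i" for i using that by simp_all
  have "inj_on ?pos {lo - 1..hi}"
    unfolding iv using inj im c same(1) by (auto simp: inj_on_def)
  moreover have "?pos ` {lo - 1..hi} \<subseteq> insert c D" unfolding iv using im by auto
  moreover have "r' adjR = (\<lambda>i. [?pos i, ?pos (i + 1)]) ` {lo - 1..<hi}"
  proof -
    have iv': "{lo - 1..<hi} = insert (lo - 1) {lo..<hi}" using le by auto
    have "(\<lambda>i. [?pos i, ?pos (i + 1)]) ` {lo..<hi} = (\<lambda>i. [pos i, pos (i + 1)]) ` {lo..<hi}"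
      by (intro image_cong) auto
    then show ?thesis unfolding iv' r' adj ends by simp
  qed
  moreover have "r' symR = (\<lambda>i. [?pos i, val v' (Sym (?t i))]) ` {lo - 1..hi}"
  proof -
    have "(\<lambda>i. [?pos i, val v' (Sym (?t i))]) ` {lo..hi} = (\<lambda>i. [pos i, val v (Sym (t i))]) ` {lo..hi}"
      using v'(1) by (intro image_cong) auto
    then show ?thesis unfolding iv r' sym using v'(1) by simp
  qed
  ultimately show ?thesis using le ends v' bl a unfolding tape_ok_def by (auto simp: image_subset_iff)
qed

text \<open>As \<open>pos\<close> is injective, deleting the old pair affects no other cell.
  Insertion comes after deletion, so writing the symbol already present is correct as well.\<close>

lemma tape_ok_write:
  assumes t: "tape_ok \<Gamma> D v r lo hi t pos" and h: "lo \<le> h" "h \<le> hi" and a: "a \<in> \<Gamma>"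
    and v': "agree X v v'" "X \<inter> ({LeftEnd, RightEnd} \<union> range Sym) = {}"
    and r': "r' adjR = r adjR"
      "r' symR = insert [pos h, val v (Sym a)] (r symR - {[pos h, val v (Sym (t h))]})"
  shows "tape_ok \<Gamma> D v' r' lo hi (t(h := a)) pos"
proof -
  have e: "val v' x = val v x" if "x \<in> {LeftEnd, RightEnd} \<union> range Sym" for x
    using that v' by (intro agreeD) auto
  have inj: "inj_on pos {lo..hi}"
    and sym: "r symR = (\<lambda>i. [pos i, val v (Sym (t i))]) ` {lo..hi}"
    using t by (simp_all add: tape_ok_def)
  have eq: "pos i = pos h \<longleftrightarrow> i = h" if "lo \<le> i" "i \<le> hi" for i
    using inj that h by (auto simp: inj_on_def)
  have iv: "{lo..hi} = insert h ({lo..hi} - {h})" using h by auto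
  have "r symR - {[pos h, val v (Sym (t h))]} = (\<lambda>i. [pos i, val v (Sym (t i))]) ` ({lo..hi} - {h})"
    unfolding sym using eq by auto
  also have "\<dots> = (\<lambda>i. [pos i, val v (Sym ((t(h := a)) i))]) ` ({lo..hi} - {h})"
    by (intro image_cong) auto
  finally have "r' symR = insert [pos h, val v (Sym ((t(h := a)) h))]
      ((\<lambda>i. [pos i, val v (Sym ((t(h := a)) i))]) ` ({lo..hi} - {h}))"
    unfolding r' by simp
  also have "\<dots> = (\<lambda>i. [pos i, val v (Sym ((t(h := a)) i))]) ` {lo..hi}"
    by (subst (2) iv) (simp only: image_insert)
  finally have "r' symR = (\<lambda>i. [pos i, val v (Sym ((t(h := a)) i))]) ` {lo..hi}" .
  then show ?thesis using t h a r'(1) e unfolding tape_ok_def by (auto simp: image_subset_iff)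
qed

lemma det_Append:
  fixes D :: "'a::infinite set"
  assumes t: "tape_ok \<Gamma> D v r lo hi t pos" and D: "finite D"
    and y: "y \<notin> {Cell, Tmp1, Tmp2, RightEnd}" "val v y = val v (Sym a)" "a \<in> \<Gamma>" "val v y \<in> D"
    and k: "\<And>c v' r'. c \<notin> D \<Longrightarrow> agree {Cell, Tmp1, Tmp2, RightEnd} v v' \<Longrightarrow> r' ordR = r ordR \<Longrightarrow>
      r' markR = insert [c, c] (r markR) \<Longrightarrow>
      tape_ok \<Gamma> (insert c D) v' r' lo (hi + 1) (t(hi + 1 := a)) (pos(hi + 1 := c)) \<Longrightarrow>
      det I \<phi> (insert c D) v' r' S"
  shows "det I (Append y \<phi>) D v r S"
  unfolding Append_def
proof (rule det_New[OF D])
  fix c v1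
  assume c: "c \<notin> D" and v1: "agree {Cell, Tmp1, Tmp2} v v1" "val v1 Cell = c"
  have re: "val v RightEnd \<in> D" using t by (auto simp: tape_ok_def)
  have e: "val v1 x = val v x" if "x \<notin> {Cell, Tmp1, Tmp2}" for x
    using v1(1) that by (rule agreeD)
  show "det I (Put 4 RightEnd Cell (Put 2 Cell y (Assign (nm RightEnd) (nm Cell) \<phi>)))
      (insert c D) v1 (r(markR := insert [c, c] (r markR))) S"
  proof (intro det_Put det_Assign)
    let ?v = "clobber (clobber v1 RightEnd Cell) Cell y"
    let ?v' = "?v(nm RightEnd := ?v (nm Cell))"
    let ?r1 = "(r(markR := insert [c, c] (r markR)))"
    let ?r2 = "?r1(adjR := insert [val v1 RightEnd, val v1 Cell] (?r1 adjR))"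
    let ?v2 = "clobber v1 RightEnd Cell"
    let ?r3 = "?r2(symR := insert [val ?v2 Cell, val ?v2 y] (?r2 symR))"
    have ag: "agree {Cell, Tmp1, Tmp2, RightEnd} v ?v'"
      using agree_mono[OF v1(1), of "{Cell, Tmp1, Tmp2, RightEnd}"] by (intro agree_upd agree_clobber) auto
    show "det I \<phi> (insert c D) ?v' ?r3 S"
    proof (rule k[OF c ag])
      show "tape_ok \<Gamma> (insert c D) ?v' ?r3 lo (hi + 1) (t(hi + 1 := a)) (pos(hi + 1 := c))"
        by (rule tape_ok_extend_right[OF t c y(3)]) (use v1(2) e y in auto)
    qed simp_all
  qed (use v1(2) e y re in auto)
qed simp

lemma det_Prepend:
  fixes D :: "'a::infinite set"
  assumes t: "tape_ok \<Gamma> D v r lo hi t pos" and D: "finite D"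
    and y: "y \<notin> {Cell, Tmp1, Tmp2, LeftEnd}" "val v y = val v (Sym a)" "a \<in> \<Gamma>" "val v y \<in> D"
    and k: "\<And>c v' r'. c \<notin> D \<Longrightarrow> agree {Cell, Tmp1, Tmp2, LeftEnd} v v' \<Longrightarrow> r' ordR = r ordR \<Longrightarrow>
      r' markR = insert [c, c] (r markR) \<Longrightarrow>
      tape_ok \<Gamma> (insert c D) v' r' (lo - 1) hi (t(lo - 1 := a)) (pos(lo - 1 := c)) \<Longrightarrow>
      det I \<phi> (insert c D) v' r' S"
  shows "det I (Prepend y \<phi>) D v r S"
  unfolding Prepend_def
proof (rule det_New[OF D])
  fix c v1
  assume c: "c \<notin> D" and v1: "agree {Cell, Tmp1, Tmp2} v v1" "val v1 Cell = c"
  have re: "val v LeftEnd \<in> D" using t by (auto simp: tape_ok_def)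
  have e: "val v1 x = val v x" if "x \<notin> {Cell, Tmp1, Tmp2}" for x
    using v1(1) that by (rule agreeD)
  show "det I (Put 4 Cell LeftEnd (Put 2 Cell y (Assign (nm LeftEnd) (nm Cell) \<phi>)))
      (insert c D) v1 (r(markR := insert [c, c] (r markR))) S"
  proof (intro det_Put det_Assign)
    let ?v = "clobber (clobber v1 Cell LeftEnd) Cell y"
    let ?v' = "?v(nm LeftEnd := ?v (nm Cell))"
    let ?r1 = "(r(markR := insert [c, c] (r markR)))"
    let ?r2 = "?r1(adjR := insert [val v1 Cell, val v1 LeftEnd] (?r1 adjR))"
    let ?v2 = "clobber v1 Cell LeftEnd"
    let ?r3 = "?r2(symR := insert [val ?v2 Cell, val ?v2 y] (?r2 symR))"
    have ag: "agree {Cell, Tmp1, Tmp2, LeftEnd} v ?v'"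
      using agree_mono[OF v1(1), of "{Cell, Tmp1, Tmp2, LeftEnd}"] by (intro agree_upd agree_clobber) auto
    show "det I \<phi> (insert c D) ?v' ?r3 S"
    proof (rule k[OF c ag])
      show "tape_ok \<Gamma> (insert c D) ?v' ?r3 (lo - 1) hi (t(lo - 1 := a)) (pos(lo - 1 := c))"
        by (rule tape_ok_extend_left[OF t c y(3)]) (use v1(2) e y in auto)
    qed simp_all
  qed (use v1(2) e y re in auto)
qed simp

section \<open>The sentence simulating a machine\<close>

lemma free_rel_fo_Atom [simp]: "free_rel (Atom i x y) = {RV 2 i}"
  by (simp add: Atom_def)

lemma wf_fm_Atom [simp]: "wf_fm \<tau> ar (Atom i x y)"
  by (simp add: Atom_def)

lemma structured_if_no_labels: "labset \<phi> = {} \<Longrightarrow> structured \<phi>"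
  by (induction \<phi>) auto

lemma Put_simps [simp]:
  "labset (Put i x y \<phi>) = labset \<phi>" "jumps (Put i x y \<phi>) = jumps \<phi>"
  "norel (Put i x y \<phi>) = norel \<phi>" "structured (Put i x y \<phi>) = structured \<phi>"
  "wf_fm \<tau> ar (Put i x y \<phi>) = wf_fm \<tau> ar \<phi>" "free_rel (Put i x y \<phi>) = free_rel \<phi> - {RV 2 i}"
  by (simp_all add: Put_def)

lemma Del_simps [simp]:
  "labset (Del i x y \<phi>) = labset \<phi>" "jumps (Del i x y \<phi>) = jumps \<phi>"
  "norel (Del i x y \<phi>) = norel \<phi>" "structured (Del i x y \<phi>) = structured \<phi>"
  "wf_fm \<tau> ar (Del i x y \<phi>) = wf_fm \<tau> ar \<phi>" "free_rel (Del i x y \<phi>) = free_rel \<phi> - {RV 2 i}"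
  by (simp_all add: Del_def)

lemma New_simps [simp]:
  "labset (New x \<phi>) = labset \<phi>" "jumps (New x \<phi>) = jumps \<phi>"
  "norel (New x \<phi>) = norel \<phi>" "structured (New x \<phi>) = structured \<phi>"
  "wf_fm \<tau> ar (New x \<phi>) = wf_fm \<tau> ar \<phi>" "free_rel (New x \<phi>) = free_rel \<phi> - {markR}"
  by (simp_all add: New_def)

lemma Choose_simps [simp]:
  "fo_fm \<theta> \<Longrightarrow> labset (Choose x \<theta> \<phi>) = labset \<phi>" "fo_fm \<theta> \<Longrightarrow> jumps (Choose x \<theta> \<phi>) = jumps \<phi>"
  "fo_fm \<theta> \<Longrightarrow> norel (Choose x \<theta> \<phi>) = norel \<phi>"
  "fo_fm \<theta> \<Longrightarrow> structured (Choose x \<theta> \<phi>) = structured \<phi>"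
  "wf_fm \<tau> ar (Choose x \<theta> \<phi>) = (wf_fm \<tau> ar \<theta> \<and> wf_fm \<tau> ar \<phi>)"
  "free_rel (Choose x \<theta> \<phi>) = free_rel \<theta> \<union> free_rel \<phi>"
  by (simp_all add: Choose_def)

lemma Assign_simps [simp]:
  "labset (Assign x y \<phi>) = labset \<phi>" "jumps (Assign x y \<phi>) = jumps \<phi>"
  "norel (Assign x y \<phi>) = norel \<phi>" "structured (Assign x y \<phi>) = structured \<phi>"
  "wf_fm \<tau> ar (Assign x y \<phi>) = wf_fm \<tau> ar \<phi>" "free_rel (Assign x y \<phi>) = free_rel \<phi>"
  by (simp_all add: Assign_def)

lemma IfFm_simps [simp]:
  "fo_fm \<theta> \<Longrightarrow> labset (IfFm \<theta> \<phi> \<psi>) = labset \<phi> \<union> labset \<psi>"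
  "fo_fm \<theta> \<Longrightarrow> jumps (IfFm \<theta> \<phi> \<psi>) = jumps \<phi> \<union> jumps \<psi>"
  "fo_fm \<theta> \<Longrightarrow> norel (IfFm \<theta> \<phi> \<psi>) = (norel \<phi> \<and> norel \<psi>)"
  "fo_fm \<theta> \<Longrightarrow> structured (IfFm \<theta> \<phi> \<psi>) = (structured \<phi> \<and> structured \<psi> \<and> labels \<phi> \<inter> labels \<psi> = {} \<and>
     jumps \<phi> \<inter> labels \<psi> = {} \<and> jumps \<psi> \<inter> labels \<phi> = {})"
  "wf_fm \<tau> ar (IfFm \<theta> \<phi> \<psi>) = (wf_fm \<tau> ar \<theta> \<and> wf_fm \<tau> ar \<phi> \<and> wf_fm \<tau> ar \<psi>)"
  "free_rel (IfFm \<theta> \<phi> \<psi>) = free_rel \<theta> \<union> free_rel \<phi> \<union> free_rel \<psi>"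
  by (auto simp: IfFm_def Disj_def)

lemma Append_simps [simp]:
  "labset (Append y \<phi>) = labset \<phi>" "jumps (Append y \<phi>) = jumps \<phi>"
  "norel (Append y \<phi>) = norel \<phi>" "structured (Append y \<phi>) = structured \<phi>"
  "wf_fm \<tau> ar (Append y \<phi>) = wf_fm \<tau> ar \<phi>" "free_rel (Append y \<phi>) = free_rel \<phi> - {markR, adjR, symR}"
  by (auto simp: Append_def)

lemma Prepend_simps [simp]:
  "labset (Prepend y \<phi>) = labset \<phi>" "jumps (Prepend y \<phi>) = jumps \<phi>"
  "norel (Prepend y \<phi>) = norel \<phi>" "structured (Prepend y \<phi>) = structured \<phi>"
  "wf_fm \<tau> ar (Prepend y \<phi>) = wf_fm \<tau> ar \<phi>" "free_rel (Prepend y \<phi>) = free_rel \<phi> - {markR, adjR, symR}"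
  by (auto simp: Prepend_def)

lemma foldr_New_simps [simp]:
  "labset (foldr New xs \<phi>) = labset \<phi>"
  "norel (foldr New xs \<phi>) = norel \<phi>" "structured (foldr New xs \<phi>) = structured \<phi>"
  "wf_fm \<tau> ar (foldr New xs \<phi>) = wf_fm \<tau> ar \<phi>" "free_rel (foldr New xs \<phi>) \<subseteq> free_rel \<phi>"
  by (induction xs) auto

lemma Reset_simps [simp]:
  "labset (Reset us \<phi>) = labset \<phi>" "jumps (Reset us \<phi>) = jumps \<phi>"
  "norel (Reset us \<phi>) = norel \<phi>" "structured (Reset us \<phi>) = structured \<phi>"
  "wf_fm \<tau> ar (Reset us \<phi>) = wf_fm \<tau> ar \<phi>" "free_rel (Reset us \<phi>) \<subseteq> insert ordR (free_rel \<phi>)"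
  by (induction us) (auto simp: Reset_def)

text \<open>\<open>Next\<close> copies its continuation once per component, so a label inside it
  would be duplicated. A jump back to the head of the loop is safe, provided its label does not
  occur in the exit branch.\<close>

lemma Next_simps [simp]:
  "labset (Next us (Jump k) \<psi>) = labset \<psi>" "jumps (Next us (Jump k) \<psi>) \<subseteq> insert k (jumps \<psi>)"
  "norel (Next us (Jump k) \<psi>) = norel \<psi>"
  "k \<notin> labels \<psi> \<Longrightarrow> structured \<psi> \<Longrightarrow> structured (Next us (Jump k) \<psi>)"
  "wf_fm \<tau> ar (Next us (Jump k) \<psi>) = wf_fm \<tau> ar \<psi>"
proof (induction us arbitrary: \<psi>)
  case (Cons u us)
  {
    case 2
    show ?case using Cons.IH(2) by force
  }
qed (auto simp del: fst_conv)

lemma free_rel_Next: "free_rel (Next us (Jump k) \<psi>) \<subseteq> insert ordR (free_rel \<psi>)"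
proof (induction us arbitrary: \<psi>)
  case (Cons u us)
  show ?case unfolding Next.simps
    by (rule order_trans[OF Cons.IH]) (use Reset_simps(6)[of us "Jump k"] in auto)
qed auto

definition Move :: "dir \<Rightarrow> 'r fm \<Rightarrow> 'r fm" where
  "Move d \<phi> = (case d of
      Stay \<Rightarrow> \<phi>
    | MoveR \<Rightarrow> Choose (nm Elem) (Atom 4 Head Elem) (Assign (nm Head) (nm Elem) \<phi>)
    | MoveL \<Rightarrow> Choose (nm Elem) (Atom 4 Elem Head) (Assign (nm Head) (nm Elem) \<phi>))"

lemma Move_simps [simp]:
  "labset (Move d \<phi>) = labset \<phi>" "jumps (Move d \<phi>) = jumps \<phi>" "norel (Move d \<phi>) = norel \<phi>"
  "wf_fm \<tau> ar (Move d \<phi>) = wf_fm \<tau> ar \<phi>" "free_rel (Move d \<phi>) \<subseteq> insert adjR (free_rel \<phi>)"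
  by (auto simp: Move_def split: dir.split)

abbreviation relvars :: "relvar list" where
  "relvars \<equiv> [ordR, adjR, symR, markR]"

lemma Verum_simps [simp]:
  "labset Verum = {}" "jumps Verum = {}" "norel Verum" "structured Verum" "wf_fm \<tau> ar Verum" "free_rel Verum = {}"
  by (simp_all add: Verum_def)

section \<open>The program for a given machine\<close>

locale tm_program =
  fixes ar :: "'r \<Rightarrow> nat" and Rs :: "'r list" and M :: tm
    and qs :: "nat list" and ss :: "tsym list"
  assumes wf_M: "wf_tm M"
    and qs: "distinct qs" "set qs = states M"
    and ss: "distinct ss" "set ss = alphabet M"
begin

definition tups :: "'r \<Rightarrow> var list" where
  "tups R = map Tup [0..<ar R]"

text \<open>A blank cell is added at both ends before every step. The head then always has both
  neighbours, which spares a case distinction for moves off the represented part of the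
  tape.\<close>

definition Act :: "nat \<Rightarrow> nat \<Rightarrow> tsym \<Rightarrow> 'r fm" where
  "Act k q a =
     (if q \<in> acc M then Verum else if q \<in> rej M then Neg Verum
      else case delta M q a of (q', a', d) \<Rightarrow>
        Prepend (Sym Blank) (Append (Sym Blank) (Del 2 Head (Sym a) (Put 2 Head (Sym a')
          (Move d (Assign (nm Curr) (nm (Sta q')) (Jump k)))))))"

fun Dispatch :: "nat \<Rightarrow> (nat \<times> tsym) list \<Rightarrow> 'r fm" where
  "Dispatch k [] = Verum"
| "Dispatch k ((q, a) # ps) =
     IfFm (Conj (Eq (nm Curr) (nm (Sta q))) (Atom 2 Head (Sym a))) (Act k q a) (Dispatch k ps)"

definition Step :: "nat \<Rightarrow> 'r fm" where
  "Step k = Dispatch k (List.product qs ss)"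

definition bit_test :: "'r \<Rightarrow> 'r fm" where
  "bit_test R = Disj
     (Conj (Rel R (map nm (tups R))) (Eq (nm Bit_val) (nm (Sym (Bit True)))))
     (Conj (Neg (Rel R (map nm (tups R)))) (Eq (nm Bit_val) (nm (Sym (Bit False)))))"

text \<open>The relations use consecutive labels starting from \<open>k\<close>, and the machine
  loop uses the label after the last of them. Each loop sits in the exit branch of the one before,
  and every jump lies in the body of its own label.\<close>

fun Encode :: "nat \<Rightarrow> 'r list \<Rightarrow> 'r fm" where
  "Encode k [] = Choose (nm Head) (Atom 4 LeftEnd Head) (Assign (nm Curr) (nm (Sta (start M))) (Lab k (Step k)))"
| "Encode k (R # Rs') = Reset (tups R) (Lab k (Choose (nm Bit_val) (bit_test R)
     (Append Bit_val (Next (tups R) (Jump k) (Encode (Suc k) Rs')))))"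

definition enc_body :: "nat \<Rightarrow> 'r \<Rightarrow> 'r list \<Rightarrow> 'r fm" where
  "enc_body k R Rs' = Choose (nm Bit_val) (bit_test R)
     (Append Bit_val (Next (tups R) (Jump k) (Encode (Suc k) Rs')))"

text \<open>Each listed element contributes one \<open>0\<close> to the tape, so the unary prefix of
  the encoding is complete when no unmarked element is left.\<close>

definition list_body :: "'r fm" where
  "list_body = IfFm (Exi (nm Elem) (Neg (Atom 3 Elem Elem)))
     (Choose (nm Elem) (Neg (Atom 3 Elem Elem)) (Put 5 Last Elem (Put 3 Elem Elem
        (Assign (nm Last) (nm Elem) (Append (Sym (Bit False)) (Jump 0))))))
     (Append (Sym (Bit True)) (Encode 1 Rs))"

definition constants :: "var list" where
  "constants = Zero # map Sym ss @ map Sta qs"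

text \<open>The first cell is a blank at position -1: the tape is a nonempty linked list before any
  bit is written, and position 0 will be the right neighbour of \<open>LeftEnd\<close>.\<close>

definition Setup :: "'r fm" where
  "Setup = foldr New constants (New Cell (Put 2 Cell (Sym Blank) (Assign (nm LeftEnd) (nm Cell)
     (Assign (nm RightEnd) (nm Cell) (Assign (nm Last) (nm Zero) (Lab 0 list_body))))))"

text \<open>Deleting from a relation variable without value leaves it empty, so the only effect on
  relations is that \<open>X\<close> becomes bound.\<close>

definition Clear :: "relvar \<Rightarrow> 'r fm \<Rightarrow> 'r fm" where
  "Clear X \<phi> = DelVar X [nm Tmp1, nm Tmp2] \<phi>"

text \<open>The outer quantifiers bind whatever the program leaves free, with arbitrary values.
  Closedness thus requires no account of which variables are set before use; \<open>Verum\<close>,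
  for instance, mentions variable 0.\<close>

definition Sentence :: "'r fm" where
  "Sentence = foldr Exi (sorted_list_of_set (free_fo Setup)) (foldr Clear relvars Setup)"

lemma Act_simps [simp]:
  "labset (Act k q a) = {}" "norel (Act k q a)" "wf_fm \<tau> ar (Act k q a)"
  by (simp_all add: Act_def split: prod.split)

lemma free_rel_Act: "free_rel (Act k q a) \<subseteq> set relvars"
  by (auto simp: Act_def split: prod.split dest!: subsetD[OF Move_simps(5)])

lemma Dispatch_simps [simp]:
  "labset (Dispatch k ps) = {}" "norel (Dispatch k ps)" "wf_fm \<tau> ar (Dispatch k ps)"
  by (induction k ps rule: Dispatch.induct) simp_all

lemma free_rel_Dispatch: "free_rel (Dispatch k ps) \<subseteq> set relvars"
proof (induction k ps rule: Dispatch.induct)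
  case (2 k q a ps)
  then show ?case using free_rel_Act[of k q a] by simp
qed simp

lemma fo_fm_bit_test [simp]: "fo_fm (bit_test R)"
  by (simp add: bit_test_def Disj_def)

lemma norel_Encode: "norel (Encode k Rs')"
  by (induction k Rs' rule: Encode.induct) (simp_all add: Step_def)

lemma labels_Encode: "labels (Encode k Rs') \<subseteq> {k..}"
  by (induction k Rs' rule: Encode.induct) (auto simp: Step_def)

lemma structured_Encode: "structured (Encode k Rs')"
proof (induction k Rs' rule: Encode.induct)
  case (1 k)
  then show ?case by (simp add: Step_def structured_if_no_labels)
next
  case (2 k R Rs')
  have "k \<notin> labels (Encode (Suc k) Rs')" using labels_Encode[of "Suc k" Rs'] by force
  with 2 show ?case by simp
qed

lemma wf_fm_Encode: "set Rs' \<subseteq> \<tau> \<Longrightarrow> wf_fm \<tau> ar (Encode k Rs')"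
  by (induction k Rs' rule: Encode.induct) (simp_all add: Step_def bit_test_def Disj_def tups_def)

lemma free_rel_Encode: "free_rel (Encode k Rs') \<subseteq> set relvars"
proof (induction k Rs' rule: Encode.induct)
  case (1 k)
  then show ?case using free_rel_Dispatch by (simp add: Step_def)
next
  case (2 k R Rs')
  have "free_rel (bit_test R) = {}" by (simp add: bit_test_def Disj_def)
  with 2 show ?case using free_rel_Next[of "tups R" k "Encode (Suc k) Rs'"]
    by (auto dest!: subsetD[OF Reset_simps(6)])
qed

lemma Step_in_labset: "(k + length Rs', Step (k + length Rs')) \<in> labset (Encode k Rs')"
proof (induction k Rs' rule: Encode.induct)
  case (2 k R Rs')
  then show ?case by simp
qed simp

lemma enc_body_in_labset:
  "(k + length dn, enc_body (k + length dn) R rest) \<in> labset (Encode k (dn @ R # rest))"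
proof (induction dn arbitrary: k)
  case (Cons R' dn)
  from Cons[of "Suc k"] show ?case by simp
qed (simp add: enc_body_def)

lemma foldr_Exi_simps [simp]:
  "labset (foldr Exi xs \<phi>) = labset \<phi>" "norel (foldr Exi xs \<phi>) = norel \<phi>"
  "structured (foldr Exi xs \<phi>) = structured \<phi>" "wf_fm \<tau> ar (foldr Exi xs \<phi>) = wf_fm \<tau> ar \<phi>"
  "free_fo (foldr Exi xs \<phi>) = free_fo \<phi> - set xs" "free_rel (foldr Exi xs \<phi>) = free_rel \<phi>"
  by (induction xs) auto

lemma Clear_simps [simp]:
  "labset (Clear X \<phi>) = labset \<phi>" "norel (Clear X \<phi>) = norel \<phi>"
  "structured (Clear X \<phi>) = structured \<phi>"
  "wf_fm \<tau> ar (Clear (RV 2 i) \<phi>) = wf_fm \<tau> ar \<phi>"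
  "free_fo (Clear X \<phi>) = free_fo \<phi> - {nm Tmp1, nm Tmp2}" "free_rel (Clear X \<phi>) = free_rel \<phi> - {X}"
  by (simp_all add: Clear_def)

lemma finite_free_fo: "finite (free_fo \<phi>)"
  by (induction \<phi>) auto

lemma sentence_Sentence: "sentence Sentence"
proof -
  have "free_rel list_body \<subseteq> set relvars"
    using free_rel_Encode[of 1 Rs] by (auto simp: list_body_def)
  then have "free_rel Setup \<subseteq> set relvars"
    by (auto simp: Setup_def dest!: subsetD[OF foldr_New_simps(5)])
  then show ?thesis
    by (auto simp: sentence_def Sentence_def set_sorted_list_of_set[OF finite_free_fo])
qed

lemma labset_Sentence: "labset Sentence = insert (0, list_body) (labset (Encode 1 Rs))"
  by (simp add: Sentence_def Setup_def list_body_def)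

lemma norel_Sentence: "norel Sentence"
  by (simp add: Sentence_def Setup_def list_body_def norel_Encode)

lemma structured_Sentence: "structured Sentence"
proof -
  have "0 \<notin> labels (Encode 1 Rs)" using labels_Encode[of 1 Rs] by force
  then show ?thesis
    by (simp add: Sentence_def Setup_def list_body_def structured_Encode)
qed

lemma Sentence_in_logic: "set Rs \<subseteq> \<tau> \<Longrightarrow> Sentence \<in> logic_L \<tau> ar"
  using not_nonstandard_jump_if_structured[OF structured_Sentence]
  by (simp add: logic_L_def Sentence_def Setup_def list_body_def wf_fm_Encode)

end

section \<open>Correctness of the simulation\<close>

definition tape_of :: "bool list \<Rightarrow> int \<Rightarrow> tsym" where
  "tape_of w i = (if 0 \<le> i \<and> i < int (length w) then Bit (w ! nat i) else Blank)"

lemma init_config_tape_of: "init_config M w = (start M, tape_of w, 0)"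
  by (auto simp: init_config_def tape_of_def fun_eq_iff)

lemma tape_of_snoc: "(tape_of w)(int (length w) := Bit x) = tape_of (w @ [x])"
  by (auto simp: tape_of_def fun_eq_iff nth_append nat_less_iff)

lemma tape_ok_adj_iff:
  assumes t: "tape_ok \<Gamma> D v r lo hi t pos" and i: "lo \<le> i" "i < hi"
  shows "[pos i, a] \<in> r adjR \<longleftrightarrow> a = pos (i + 1)" "[a, pos (i + 1)] \<in> r adjR \<longleftrightarrow> a = pos i"
proof -
  have inj: "inj_on pos {lo..hi}" and adj: "r adjR = (\<lambda>i. [pos i, pos (i + 1)]) ` {lo..<hi}"
    using t by (simp_all add: tape_ok_def)
  have eq: "pos j = pos k \<longleftrightarrow> j = k" if "lo \<le> j" "j \<le> hi" "lo \<le> k" "k \<le> hi" for j k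
    using inj that by (auto simp: inj_on_def)
  show "[pos i, a] \<in> r adjR \<longleftrightarrow> a = pos (i + 1)"
  proof
    assume "[pos i, a] \<in> r adjR"
    then obtain j where j: "lo \<le> j" "j < hi" "pos i = pos j" "a = pos (j + 1)" unfolding adj by auto
    with eq[of i j] i show "a = pos (i + 1)" by simp
  qed (use i in \<open>auto simp: adj\<close>)
  show "[a, pos (i + 1)] \<in> r adjR \<longleftrightarrow> a = pos i"
  proof
    assume "[a, pos (i + 1)] \<in> r adjR"
    then obtain j where j: "lo \<le> j" "j < hi" "pos (i + 1) = pos (j + 1)" "a = pos j" unfolding adj by auto
    with eq[of "i + 1" "j + 1"] i show "a = pos i" by simp
  qed (use i in \<open>auto simp: adj\<close>)
qed

lemma tape_ok_sym_iff:
  assumes t: "tape_ok \<Gamma> D v r lo hi t pos" and i: "lo \<le> i" "i \<le> hi"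
  shows "[pos i, a] \<in> r symR \<longleftrightarrow> a = val v (Sym (t i))"
proof
  assume "[pos i, a] \<in> r symR"
  then obtain j where "j \<in> {lo..hi}" "pos i = pos j" "a = val v (Sym (t j))"
    using t by (auto simp: tape_ok_def)
  moreover have "inj_on pos {lo..hi}" using t by (simp add: tape_ok_def)
  ultimately show "a = val v (Sym (t i))" using i by (auto dest: inj_onD)
qed (use t i in \<open>auto simp: tape_ok_def\<close>)

lemma tape_ok_pos: "tape_ok \<Gamma> D v r lo hi t pos \<Longrightarrow> lo \<le> i \<Longrightarrow> i \<le> hi \<Longrightarrow> pos i \<in> D"
  by (auto simp: tape_ok_def)

text \<open>The strict bounds on \<open>h\<close> ensure that the neighbour asked for exists;
  \<open>Act\<close> provides them by extending the tape beforehand.\<close>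

lemma det_Move:
  assumes t: "tape_ok \<Gamma> D v r lo hi t pos" and h: "lo < h" "h < hi" "val v Head = pos h"
    and k: "\<And>v'. agree {Elem, Head} v v' \<Longrightarrow> val v' Head = pos (h + shift d) \<Longrightarrow> det I \<phi> D v' r S"
  shows "det I (Move d \<phi>) D v r S"
proof (cases d)
  case MoveL
  have *: "[a, val v Head] \<in> r adjR \<longleftrightarrow> a = pos (h - 1)" for a
    using tape_ok_adj_iff(2)[OF t, of "h - 1" a] h by simp
  have "det I (Choose (nm Elem) (Atom 4 Elem Head) (Assign (nm Head) (nm Elem) \<phi>)) D v r S"
  proof (intro det_Choose det_Assign)
    show "\<exists>a\<in>D. fo I (Atom 4 Elem Head) D (v(nm Elem := a)) r"
      using * tape_ok_pos[OF t, of "h - 1"] h by (intro bexI[of _ "pos (h - 1)"]) auto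
    fix a assume "a \<in> D" "fo I (Atom 4 Elem Head) D (v(nm Elem := a)) r"
    then have "a = pos (h - 1)" using * by simp
    then show "det I \<phi> D ((v(nm Elem := a))(nm Head := (v(nm Elem := a)) (nm Elem))) r S"
      using MoveL by (intro k) auto
  qed auto
  then show ?thesis using MoveL by (simp add: Move_def)
next
  case MoveR
  have *: "[val v Head, a] \<in> r adjR \<longleftrightarrow> a = pos (h + 1)" for a
    using tape_ok_adj_iff(1)[OF t, of h a] h by simp
  have "det I (Choose (nm Elem) (Atom 4 Head Elem) (Assign (nm Head) (nm Elem) \<phi>)) D v r S"
  proof (intro det_Choose det_Assign)
    show "\<exists>a\<in>D. fo I (Atom 4 Head Elem) D (v(nm Elem := a)) r"
      using * tape_ok_pos[OF t, of "h + 1"] h by (intro bexI[of _ "pos (h + 1)"]) auto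
    fix a assume "a \<in> D" "fo I (Atom 4 Head Elem) D (v(nm Elem := a)) r"
    then have "a = pos (h + 1)" using * by simp
    then show "det I \<phi> D ((v(nm Elem := a))(nm Head := (v(nm Elem := a)) (nm Elem))) r S"
      using MoveR by (intro k) auto
  qed auto
  then show ?thesis using MoveR by (simp add: Move_def)
next
  case Stay
  then show ?thesis using k[of v] h(3) by (simp add: Move_def)
qed

lemma tm_step_halted: "q \<in> acc M \<union> rej M \<Longrightarrow> (tm_step M ^^ n) (q, c) = (q, c)"
  by (induction n) (cases c, auto)+

lemma tm_state_mono:
  assumes "tm_state M w n \<in> acc M \<union> rej M" "n \<le> m"
  shows "tm_state M w m = tm_state M w n"
proof -
  obtain q c where qc: "(tm_step M ^^ n) (init_config M w) = (q, c)" by (cases "(tm_step M ^^ n) (init_config M w)")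
  have "(tm_step M ^^ m) (init_config M w) = (tm_step M ^^ (m - n)) ((tm_step M ^^ n) (init_config M w))"
    using assms(2) by (metis comp_apply funpow_add le_add_diff_inverse2)
  then show ?thesis using assms(1) qc by (simp add: tm_state_def tm_step_halted)
qed

section \<open>Loop invariants and their preservation\<close>

locale tm_simulation = tm_program ar Rs M qs ss
  for ar :: "'r \<Rightarrow> nat" and Rs M qs ss +
  fixes \<AA> :: "('a::infinite, 'r) model"
  assumes fin: "finite (univ \<AA>)" and ne: "univ \<AA> \<noteq> {}"
begin

abbreviation "I \<equiv> interp \<AA>"

lemma constants_disjoint: "x \<in> set constants \<Longrightarrow> x \<notin> {Tmp1, Tmp2, Cell, Elem, Last, LeftEnd, RightEnd, Head, Curr, Bit_val} \<union> range Tup"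
  by (auto simp: constants_def)

text \<open>The share of the constants in every invariant: they denote pairwise distinct elements,
  so equality tests identify states and symbols.\<close>

definition base :: "'a set \<Rightarrow> (nat \<Rightarrow> 'a) \<Rightarrow> bool" where
  "base D v \<longleftrightarrow> finite D \<and> univ \<AA> \<subseteq> D \<and> inj_on (val v) (set constants) \<and> val v ` set constants \<subseteq> D"

lemma base_mono:
  assumes "base D v" "agree X v v'" "X \<subseteq> {Tmp1, Tmp2, Cell, Elem, Last, LeftEnd, RightEnd, Head, Curr, Bit_val} \<union> range Tup"
    and "finite D'" "D \<subseteq> D'"
  shows "base D' v'"
proof -
  have "val v' x = val v x" if "x \<in> set constants" for x
    using assms(2,3) constants_disjoint[OF that] by (intro agreeD) auto
  then show ?thesis using assms(1,4,5) unfolding base_def inj_on_def by (auto simp: image_subset_iff)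
qed

lemma base_simps:
  assumes "base D v"
  shows "finite D" "univ \<AA> \<subseteq> D" "val v Zero \<in> D" "a \<in> alphabet M \<Longrightarrow> val v (Sym a) \<in> D"
    "q \<in> states M \<Longrightarrow> val v (Sta q) \<in> D"
    "a \<in> alphabet M \<Longrightarrow> b \<in> alphabet M \<Longrightarrow> val v (Sym a) = val v (Sym b) \<longleftrightarrow> a = b"
    "q \<in> states M \<Longrightarrow> q' \<in> states M \<Longrightarrow> val v (Sta q) = val v (Sta q') \<longleftrightarrow> q = q'"
proof -
  have inj: "inj_on (val v) (set constants)" and im: "val v ` set constants \<subseteq> D"
    using assms by (simp_all add: base_def)
  have c: "Zero \<in> set constants" "\<And>a. a \<in> alphabet M \<Longrightarrow> Sym a \<in> set constants"
    "\<And>q. q \<in> states M \<Longrightarrow> Sta q \<in> set constants"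
    using ss(2) qs(2) by (simp_all add: constants_def)
  show "finite D" "univ \<AA> \<subseteq> D" using assms by (simp_all add: base_def)
  show "val v Zero \<in> D" "a \<in> alphabet M \<Longrightarrow> val v (Sym a) \<in> D" "q \<in> states M \<Longrightarrow> val v (Sta q) \<in> D"
    using im c by (simp_all add: image_subset_iff)
  show "a \<in> alphabet M \<Longrightarrow> b \<in> alphabet M \<Longrightarrow> val v (Sym a) = val v (Sym b) \<longleftrightarrow> a = b"
    using inj_on_eq_iff[OF inj c(2) c(2), of a b] by simp
  show "q \<in> states M \<Longrightarrow> q' \<in> states M \<Longrightarrow> val v (Sta q) = val v (Sta q') \<longleftrightarrow> q = q'"
    using inj_on_eq_iff[OF inj c(3) c(3), of q q'] by simp
qed

lemma alphabet_simps [simp]: "Blank \<in> alphabet M" "Bit x \<in> alphabet M"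
  using wf_M by (cases x; simp add: wf_tm_def)+

definition input_word :: "'a list \<Rightarrow> 'r list \<Rightarrow> bool list \<Rightarrow> bool list" where
  "input_word as dn bs = replicate (length as) False @ [True] @
     concat (map (\<lambda>R. enc_rel as (ar R) (I R)) dn) @ bs"

text \<open>Shape of the tape while the input is written: from the blank at -1 to the last bit, so
  the empty word is the single cell at -1.\<close>

definition tape_word :: "'a set \<Rightarrow> (nat \<Rightarrow> 'a) \<Rightarrow> (relvar \<Rightarrow> 'a list set) \<Rightarrow> bool list \<Rightarrow> bool" where
  "tape_word D v r w \<longleftrightarrow>
     (\<exists>pos. tape_ok (alphabet M) D v r (-1) (int (length w) - 1) (tape_of w) pos)"

lemma det_Append_bit:
  assumes t: "tape_word D v r w" and b: "base D v"
    and y: "y \<notin> {Cell, Tmp1, Tmp2, RightEnd}" "val v y = val v (Sym (Bit x))"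
    and k: "\<And>c v' r'. c \<notin> D \<Longrightarrow> agree {Cell, Tmp1, Tmp2, RightEnd} v v' \<Longrightarrow> base (insert c D) v' \<Longrightarrow>
      r' ordR = r ordR \<Longrightarrow> r' markR = insert [c, c] (r markR) \<Longrightarrow>
      tape_word (insert c D) v' r' (w @ [x]) \<Longrightarrow> det I \<phi> (insert c D) v' r' S"
  shows "det I (Append y \<phi>) D v r S"
proof -
  from t obtain pos where pos: "tape_ok (alphabet M) D v r (-1) (int (length w) - 1) (tape_of w) pos"
    by (auto simp: tape_word_def)
  show ?thesis
  proof (rule det_Append[OF pos _ y])
    show "finite D" "val v y \<in> D" using base_simps[OF b] y(2) by simp_all
    fix c v' r'
    assume c: "c \<notin> D" and ag: "agree {Cell, Tmp1, Tmp2, RightEnd} v v'"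
      and r': "r' ordR = r ordR" "r' markR = insert [c, c] (r markR)"
      and t': "tape_ok (alphabet M) (insert c D) v' r' (-1) (int (length w) - 1 + 1)
        ((tape_of w)(int (length w) - 1 + 1 := Bit x)) (pos(int (length w) - 1 + 1 := c))"
    show "det I \<phi> (insert c D) v' r' S"
    proof (rule k[OF c ag _ r'])
      show "base (insert c D) v'" using b base_simps(1)[OF b] by (intro base_mono[OF b ag]) auto
      show "tape_word (insert c D) v' r' (w @ [x])"
        using t' by (auto simp: tape_word_def tape_of_snoc)
    qed
  qed simp
qed

definition inv_list :: "'a list \<Rightarrow> 'a set \<Rightarrow> (nat \<Rightarrow> 'a) \<Rightarrow> (relvar \<Rightarrow> 'a list set) \<Rightarrow> bool" where
  "inv_list as D v r \<longleftrightarrow> base D v \<and> distinct as \<and> set as \<subseteq> univ \<AA> \<and> val v Zero \<notin> univ \<AA> \<and>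
     r ordR = succ_pairs (val v Zero # as) \<and> val v Last = last (val v Zero # as) \<and>
     (\<forall>x\<in>D. [x, x] \<in> r markR \<longleftrightarrow> x \<notin> univ \<AA> - set as) \<and>
     tape_word D v r (replicate (length as) False)"

definition ready :: "'a list \<Rightarrow> bool list \<Rightarrow> 'a set \<Rightarrow> (nat \<Rightarrow> 'a) \<Rightarrow> (relvar \<Rightarrow> 'a list set) \<Rightarrow> bool" where
  "ready as w D v r \<longleftrightarrow> base D v \<and> ordering_of as (univ \<AA>) \<and> val v Zero \<notin> univ \<AA> \<and>
     r ordR = succ_pairs (val v Zero # as) \<and> tape_word D v r w"

text \<open>State at the head of the loop for \<open>R\<close>: the bits for \<open>pre\<close> are
  on the tape, while the current tuple, held in the variables \<open>tups R\<close>, and the tuples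
  in \<open>post\<close> are still to be processed.\<close>

definition inv_enc :: "'a list \<Rightarrow> 'r list \<Rightarrow> 'r \<Rightarrow> 'r list \<Rightarrow> 'a list list \<Rightarrow> 'a list list \<Rightarrow>
    'a set \<Rightarrow> (nat \<Rightarrow> 'a) \<Rightarrow> (relvar \<Rightarrow> 'a list set) \<Rightarrow> bool" where
  "inv_enc as dn R rest pre post D v r \<longleftrightarrow>
     ready as (input_word as dn (map (\<lambda>t. t \<in> I R) pre)) D v r \<and> Rs = dn @ R # rest \<and>
     product_lists (replicate (ar R) as) = pre @ map (val v) (tups R) # post"

definition inv_main :: "'a list \<Rightarrow> nat \<Rightarrow> 'a set \<Rightarrow> (nat \<Rightarrow> 'a) \<Rightarrow> (relvar \<Rightarrow> 'a list set) \<Rightarrow> bool" where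
  "inv_main as n D v r \<longleftrightarrow> base D v \<and> ordering_of as (univ \<AA>) \<and>
     (\<exists>q t h lo hi pos. (tm_step M ^^ n) (init_config M (enc ar Rs \<AA> as)) = (q, t, h) \<and>
        q \<in> states M \<and> tape_ok (alphabet M) D v r lo hi t pos \<and> lo \<le> h \<and> h \<le> hi \<and>
        val v Head = pos h \<and> val v Curr = val v (Sta q))"

text \<open>An unmarked element is one not yet listed, so either the list grows by such an element,
  or it exhausts the domain and the separator is written.\<close>

lemma det_list_body:
  assumes inv: "inv_list as D v r"
    and k: "\<And>x D' v' r'. x \<in> univ \<AA> - set as \<Longrightarrow> inv_list (as @ [x]) D' v' r' \<Longrightarrow> At 0 D' v' r' \<in> S"
    and exit: "\<And>D' v' r'. ready as (input_word as [] []) D' v' r' \<Longrightarrow> det I (Encode 1 Rs) D' v' r' S"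
  shows "det I list_body D v r S"
proof -
  have b: "base D v" and as: "distinct as" "set as \<subseteq> univ \<AA>" and z: "val v Zero \<notin> univ \<AA>"
    and ord: "r ordR = succ_pairs (val v Zero # as)" and la: "val v Last = last (val v Zero # as)"
    and mk: "\<And>x. x \<in> D \<Longrightarrow> [x, x] \<in> r markR \<longleftrightarrow> x \<notin> univ \<AA> - set as"
    and t: "tape_word D v r (replicate (length as) False)"
    using inv by (simp_all add: inv_list_def)
  note bs = base_simps[OF b]
  have "val v Last \<in> set (val v Zero # as)" unfolding la by (rule last_in_set) simp
  then have LD: "val v Last \<in> D" using as(2) bs(2,3) by auto
  show ?thesis unfolding list_body_def
  proof (rule det_IfFm)
    assume "fo I (Exi (nm Elem) (Neg (Atom 3 Elem Elem))) D v r"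
    then obtain x where x: "x \<in> D" "[x, x] \<notin> r markR" by auto
    show "det I (Choose (nm Elem) (Neg (Atom 3 Elem Elem)) (Put 5 Last Elem (Put 3 Elem Elem
        (Assign (nm Last) (nm Elem) (Append (Sym (Bit False)) (Jump 0)))))) D v r S"
    proof (intro det_Choose det_Put det_Assign)
      show "\<exists>a\<in>D. fo I (Neg (Atom 3 Elem Elem)) D (v(nm Elem := a)) r" using x by auto
      fix a assume a: "a \<in> D" "fo I (Neg (Atom 3 Elem Elem)) D (v(nm Elem := a)) r"
      then have aA: "a \<in> univ \<AA> - set as" using mk by auto
      let ?v0 = "v(nm Elem := a)"
      let ?v1 = "clobber ?v0 Last Elem"
      let ?v2 = "clobber ?v1 Elem Elem"
      let ?v3 = "?v2(nm Last := ?v2 (nm Elem))"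
      let ?r1 = "r(ordR := insert [?v0 (nm Last), ?v0 (nm Elem)] (r ordR))"
      let ?r2 = "?r1(markR := insert [?v1 (nm Elem), ?v1 (nm Elem)] (?r1 markR))"
      have ag: "agree {Tmp1, Tmp2, Elem, Last} v ?v3" by (intro agree_upd agree_clobber) auto
      have b3: "base D ?v3" using bs(1) by (intro base_mono[OF b ag]) auto
      have t3: "tape_word D ?v3 ?r2 (replicate (length as) False)"
        using t tape_ok_cong[OF _ ag, of "alphabet M" D r _ _ _ _ ?r2 D] unfolding tape_word_def by fastforce
      show "det I (Append (Sym (Bit False)) (Jump 0)) D ?v3 ?r2 S"
      proof (rule det_Append_bit[OF t3 b3])
        fix c v' r'
        assume c: "c \<notin> D" "agree {Cell, Tmp1, Tmp2, RightEnd} ?v3 v'" "base (insert c D) v'"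
          "r' ordR = ?r2 ordR" "r' markR = insert [c, c] (?r2 markR)"
          "tape_word (insert c D) v' r' (replicate (length as) False @ [False])"
        \<comment> \<open>Cells come from outside the domain of \<AA> and are marked when created,
          so they are never taken for unlisted elements.\<close>
        have cA: "c \<notin> univ \<AA>" using c(1) bs(2) by auto
        have zz: "val v' Zero = val v Zero" "val v' Last = a"
          using agreeD[OF c(2)] by auto
        have "inv_list (as @ [a]) (insert c D) v' r'"
          unfolding inv_list_def
        proof (intro conjI)
          show "r' ordR = succ_pairs (val v' Zero # as @ [a])"
            using succ_pairs_snoc[of "val v Zero # as" a] ord la by (simp add: c(4) zz)
          show "\<forall>x\<in>insert c D. ([x, x] \<in> r' markR) = (x \<notin> univ \<AA> - set (as @ [a]))"
            using mk cA aA by (auto simp: c(5))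
          show "tape_word (insert c D) v' r' (replicate (length (as @ [a])) False)"
            using c(6) by (simp add: replicate_append_same)
        qed (use c(3) as z aA zz in auto)
        then show "det I (Jump 0) (insert c D) v' r' S" using k[OF aA] by (intro det_Jump)
      qed auto
    qed (use LD in auto)
  next
    assume "\<not> fo I (Exi (nm Elem) (Neg (Atom 3 Elem Elem))) D v r"
    then have "\<forall>x\<in>D. [x, x] \<in> r markR" by auto
    then have "set as = univ \<AA>" using mk as(2) bs(2) by blast
    then have o: "ordering_of as (univ \<AA>)" using as(1) by (simp add: ordering_of_def)
    show "det I (Append (Sym (Bit True)) (Encode 1 Rs)) D v r S"
    proof (rule det_Append_bit[OF t b])
      fix c v' r'
      assume c: "c \<notin> D" "agree {Cell, Tmp1, Tmp2, RightEnd} v v'" "base (insert c D) v'"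
        "r' ordR = r ordR" "r' markR = insert [c, c] (r markR)"
        "tape_word (insert c D) v' r' (replicate (length as) False @ [True])"
      have "val v' Zero = val v Zero" using agreeD[OF c(2)] by auto
      then have "ready as (input_word as [] []) (insert c D) v' r'"
        using c(3,4,6) o z ord by (simp add: ready_def input_word_def)
      then show "det I (Encode 1 Rs) (insert c D) v' r' S" by (rule exit)
    qed auto
  qed simp
qed

lemma enc_eq_input_word: "enc ar Rs' \<AA> as = input_word as Rs' []"
  by (simp add: enc_def input_word_def)

text \<open>With no relation left, the word on the tape is the full encoding and the run starts at
  step 0. Otherwise the tuple variables are reset to the first tuple, for which \<open>pre\<close>
  is empty.\<close>

lemma det_Encode:
  assumes rd: "ready as (input_word as dn []) D v r" and Rs: "Rs = dn @ rest"
    and main: "\<And>D' v' r'. rest = [] \<Longrightarrow> inv_main as 0 D' v' r' \<Longrightarrow> At (Suc (length Rs)) D' v' r' \<in> S"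
    and enc: "\<And>R rest' post D' v' r'. rest = R # rest' \<Longrightarrow> inv_enc as dn R rest' [] post D' v' r' \<Longrightarrow>
      At (Suc (length dn)) D' v' r' \<in> S"
  shows "det I (Encode (Suc (length dn)) rest) D v r S"
proof -
  have b: "base D v" and o: "ordering_of as (univ \<AA>)" and z: "val v Zero \<notin> univ \<AA>"
    and ord: "r ordR = succ_pairs (val v Zero # as)" and t: "tape_word D v r (input_word as dn [])"
    using rd by (simp_all add: ready_def)
  note bs = base_simps[OF b]
  have as: "set as = univ \<AA>" "distinct as" "as \<noteq> []" using o ne by (auto simp: ordering_of_def)
  show ?thesis
  proof (cases rest)
    case Nil
    let ?w = "input_word as dn []"
    from Nil Rs have w: "?w = enc ar Rs \<AA> as" by (simp add: enc_eq_input_word)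
    have len: "0 < length ?w" by (simp add: input_word_def)
    from t obtain pos where pos: "tape_ok (alphabet M) D v r (-1) (int (length ?w) - 1) (tape_of ?w) pos"
      by (auto simp: tape_word_def)
    have le: "val v LeftEnd = pos (- 1)" using pos by (simp add: tape_ok_def)
    \<comment> \<open>\<open>LeftEnd\<close> is position -1, so its right neighbour is position 0;
      that cell exists because the input word contains at least the separator.\<close>
    have *: "[val v LeftEnd, a] \<in> r adjR \<longleftrightarrow> a = pos 0" for a
      using tape_ok_adj_iff(1)[OF pos, of "-1" a] len le by simp
    have st: "start M \<in> states M" using wf_M by (simp add: wf_tm_def)
    have "det I (Choose (nm Head) (Atom 4 LeftEnd Head)
        (Assign (nm Curr) (nm (Sta (start M))) (Lab (Suc (length dn)) (Step (Suc (length dn)))))) D v r S"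
    proof (intro det_Choose det_Assign det_Lab)
      show "\<exists>a\<in>D. fo I (Atom 4 LeftEnd Head) D (v(nm Head := a)) r"
        using * tape_ok_pos[OF pos, of 0] len by (intro bexI[of _ "pos 0"]) auto
      fix a assume "a \<in> D" "fo I (Atom 4 LeftEnd Head) D (v(nm Head := a)) r"
      then have a: "a = pos 0" using * by simp
      let ?v = "(v(nm Head := a))(nm Curr := (v(nm Head := a)) (nm (Sta (start M))))"
      have ag: "agree {Head, Curr} v ?v" by (intro agree_upd) auto
      have "base D ?v" using bs(1) by (intro base_mono[OF b ag]) auto
      moreover have "tape_ok (alphabet M) D ?v r (-1) (int (length ?w) - 1) (tape_of ?w) pos"
        using pos ag by (rule tape_ok_cong) auto
      moreover have "(tm_step M ^^ 0) (init_config M (enc ar Rs \<AA> as)) = (start M, tape_of ?w, 0)"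
        by (simp add: init_config_tape_of w)
      moreover have "(-1::int) \<le> 0" "(0::int) \<le> int (length ?w) - 1" "?v (nm Head) = pos 0"
        "?v (nm Curr) = ?v (nm (Sta (start M)))" using len a by auto
      ultimately have "inv_main as 0 D ?v r" using o st unfolding inv_main_def by blast
      from main[OF Nil this] show "At (Suc (length dn)) D ?v r \<in> S" using Nil Rs by simp
    qed (use bs(5)[OF st] in auto)
    then show ?thesis using Nil by simp
  next
    case (Cons R rest')
    have "det I (Reset (tups R) (Lab (Suc (length dn)) X)) D v r S" for X
    proof (rule det_Reset[where r = r and z = "val v Zero" and as = as, OF ord])
      fix v' assume v': "agree (set (tups R)) v v'"
        "map (val v') (tups R) = replicate (length (tups R)) (hd as)"
      obtain post where post: "product_lists (replicate (ar R) as) = replicate (ar R) (hd as) # post"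
        using product_lists_replicate_hd[OF as(3)] by blast
      have tu: "set (tups R) \<subseteq> range Tup" "length (tups R) = ar R" by (auto simp: tups_def)
      have pr: "product_lists (replicate (ar R) as) = [] @ map (val v') (tups R) # post"
        unfolding v'(2) tu(2) using post by simp
      have "base D v'" using bs(1) tu by (intro base_mono[OF b v'(1)]) auto
      moreover have "val v' Zero = val v Zero" using agreeD[OF v'(1), of Zero] tu by auto
      moreover have "tape_word D v' r (input_word as dn [])"
        using t tape_ok_cong[OF _ v'(1), of "alphabet M" D r _ _ _ _ r D] tu unfolding tape_word_def by fastforce
      ultimately have "inv_enc as dn R rest' [] post D v' r"
        using o z ord pr Cons Rs unfolding inv_enc_def ready_def by simp
      from enc[OF Cons this] show "det I (Lab (Suc (length dn)) X) D v' r S" by (rule det_Lab)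
    qed (use as z bs(2) in \<open>auto simp: tups_def\<close>)
    then show ?thesis using Cons by simp
  qed
qed

lemma det_enc_body:
  assumes inv: "inv_enc as dn R rest pre post D v r"
    and k: "\<And>post' D' v' r' t. post = t # post' \<Longrightarrow> inv_enc as dn R rest (pre @ [map (val v) (tups R)]) post' D' v' r' \<Longrightarrow>
      At (Suc (length dn)) D' v' r' \<in> S"
    and exit: "\<And>D' v' r'. ready as (input_word as (dn @ [R]) []) D' v' r' \<Longrightarrow>
      det I (Encode (Suc (length (dn @ [R]))) rest) D' v' r' S"
  shows "det I (enc_body (Suc (length dn)) R rest) D v r S"
proof -
  let ?bits = "map (\<lambda>t. t \<in> I R)"
  have b: "base D v" and o: "ordering_of as (univ \<AA>)" and z: "val v Zero \<notin> univ \<AA>"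
    and ord: "r ordR = succ_pairs (val v Zero # as)" and t: "tape_word D v r (input_word as dn (?bits pre))"
    and Rs: "Rs = dn @ R # rest"
    and prod: "product_lists (replicate (ar R) as) = pre @ map (val v) (tups R) # post"
    using inv by (simp_all add: ready_def inv_enc_def)
  note bs = base_simps[OF b]
  have as: "set as = univ \<AA>" "distinct as" using o by (auto simp: ordering_of_def)
  have tu: "set (tups R) \<subseteq> range Tup" "distinct (tups R)" "length (tups R) = ar R"
    by (auto simp: tups_def distinct_map inj_on_def)
  define bt where "bt \<longleftrightarrow> map (val v) (tups R) \<in> I R"
  have "map (v(nm Bit_val := a)) (map nm (tups R)) = map (val v) (tups R)" for a
    using tu(1) by auto
  then have "map (v(nm Bit_val := a)) (map nm (tups R)) \<in> I R \<longleftrightarrow> bt" for a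
    by (simp only: bt_def)
  \<comment> \<open>The guard pins \<open>Bit_val\<close> to the constant for the truth value of the
    current atom, read off the unchanged relations of \<AA>.\<close>
  then have test: "fo I (bit_test R) D (v(nm Bit_val := a)) r \<longleftrightarrow> a = val v (Sym (Bit bt))" for a
    by (cases bt) (simp_all add: bit_test_def Disj_def del: map_map)
  show ?thesis unfolding enc_body_def
  proof (rule det_Choose)
    show "\<exists>a\<in>D. fo I (bit_test R) D (v(nm Bit_val := a)) r" using test bs(4) by simp
    fix a assume "a \<in> D" "fo I (bit_test R) D (v(nm Bit_val := a)) r"
    then have a: "a = val v (Sym (Bit bt))" using test by simp
    let ?v = "v(nm Bit_val := a)"
    have ag: "agree {Bit_val} v ?v" by auto
    have b1: "base D ?v" using bs(1) by (intro base_mono[OF b ag]) auto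
    have t1: "tape_word D ?v r (input_word as dn (?bits pre))"
      using t tape_ok_cong[OF _ ag, of "alphabet M" D r _ _ _ _ r D] unfolding tape_word_def by fastforce
    show "det I (Append Bit_val (Next (tups R) (Jump (Suc (length dn))) (Encode (Suc (Suc (length dn))) rest))) D ?v r S"
    proof (rule det_Append_bit[OF t1 b1])
      show "val ?v Bit_val = val ?v (Sym (Bit bt))" using a by simp
      fix c v1 r1
      assume c: "c \<notin> D" "agree {Cell, Tmp1, Tmp2, RightEnd} ?v v1" "base (insert c D) v1"
        "r1 ordR = r ordR" "r1 markR = insert [c, c] (r markR)"
        "tape_word (insert c D) v1 r1 (input_word as dn (?bits pre) @ [bt])"
      have ag1: "agree {Bit_val, Cell, Tmp1, Tmp2, RightEnd} v v1"
        using agree_trans[OF ag c(2)] by (rule agree_mono) auto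
      have z1: "val v1 Zero = val v Zero" using agreeD[OF ag1, of Zero] by simp
      have w: "input_word as dn (?bits pre) @ [bt] = input_word as dn (?bits (pre @ [map (val v) (tups R)]))"
        by (simp add: input_word_def bt_def)
      have tv: "map (val v1) (tups R) = map (val v) (tups R)"
        using agreeD[OF ag1] tu(1) by auto
      show "det I (Next (tups R) (Jump (Suc (length dn))) (Encode (Suc (Suc (length dn))) rest)) (insert c D) v1 r1 S"
      proof (rule det_Next[where r = r1 and z = "val v Zero" and as = as and pre = pre and post = post])
        show "r1 ordR = succ_pairs (val v Zero # as)" using c(4) ord by simp
        show "product_lists (replicate (length (tups R)) as) = pre @ map (val v1) (tups R) # post"
          using prod tu(3) tv by simp
        fix v2 post' assume v2: "agree (insert Elem (set (tups R))) v1 v2" "post = map (val v2) (tups R) # post'"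
        have "base (insert c D) v2" using bs(1) tu by (intro base_mono[OF c(3) v2(1)]) auto
        moreover have "val v2 Zero = val v Zero" using agreeD[OF v2(1), of Zero] z1 tu(1) by auto
        moreover have "tape_word (insert c D) v2 r1 (input_word as dn (?bits (pre @ [map (val v) (tups R)])))"
          using c(6) tape_ok_cong[OF _ v2(1), of "alphabet M" "insert c D" r1 _ _ _ _ r1 "insert c D"] tu
          unfolding tape_word_def w by fastforce
        ultimately have "inv_enc as dn R rest (pre @ [map (val v) (tups R)]) post' (insert c D) v2 r1"
          using o z ord c(4) v2(2) prod Rs unfolding inv_enc_def ready_def by simp
        from k[OF v2(2) this] show "det I (Jump (Suc (length dn))) (insert c D) v2 r1 S" by (rule det_Jump)
      next
        assume post: "post = []"
        \<comment> \<open>No tuple follows the current one, so \<open>pre\<close> extended by it is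
          the complete list and its bits make up \<open>enc_rel\<close>.\<close>
        have "input_word as dn (?bits pre) @ [bt] = input_word as (dn @ [R]) []"
          unfolding w using prod post by (simp add: input_word_def enc_rel_def)
        then have "ready as (input_word as (dn @ [R]) []) (insert c D) v1 r1"
          using c(3,4,6) o z ord z1 by (simp add: ready_def)
        from exit[OF this] show "det I (Encode (Suc (Suc (length dn))) rest) (insert c D) v1 r1 S" by simp
      qed (use as z z1 bs(2) tu in auto)
    qed auto
  qed simp
qed

text \<open>The constants are distinct and the head cell carries a single symbol, so only the entry
  \<open>(q, a)\<close> passes its test.\<close>

lemma det_Dispatch:
  assumes b: "base D v" and q: "q \<in> states M" "val v Curr = val v (Sta q)" and a: "a \<in> alphabet M"
    and r: "\<And>x. [val v Head, x] \<in> r symR \<longleftrightarrow> x = val v (Sym a)"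
    and Act: "det I (Act k q a) D v r S"
    and ps: "(q, a) \<in> set ps" "set ps \<subseteq> states M \<times> alphabet M"
  shows "det I (Dispatch k ps) D v r S"
  using ps
proof (induction ps)
  case (Cons p ps)
  obtain q' a' where p: "p = (q', a')" by (cases p)
  have p': "q' \<in> states M" "a' \<in> alphabet M" using Cons.prems p by auto
  have "fo I (Conj (Eq (nm Curr) (nm (Sta q'))) (Atom 2 Head (Sym a'))) D v r \<longleftrightarrow> q' = q \<and> a' = a"
    using base_simps(6)[OF b p'(2) a] base_simps(7)[OF b p'(1) q(1)] q(2) r by auto
  then show ?case using Cons p Act by (auto intro!: det_IfFm)
qed simp

lemma det_Step:
  assumes inv: "inv_main as n D v r"
    and acc: "tm_state M (enc ar Rs \<AA> as) n \<in> acc M \<Longrightarrow> Halt True \<in> S"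
    and rej: "tm_state M (enc ar Rs \<AA> as) n \<in> rej M \<Longrightarrow> Halt False \<in> S"
    and k: "\<And>D' v' r'. tm_state M (enc ar Rs \<AA> as) n \<notin> acc M \<union> rej M \<Longrightarrow> inv_main as (Suc n) D' v' r' \<Longrightarrow>
      At k D' v' r' \<in> S"
  shows "det I (Step k) D v r S"
proof -
  from inv obtain q t h lo hi pos where b: "base D v" and o: "ordering_of as (univ \<AA>)"
    and c: "(tm_step M ^^ n) (init_config M (enc ar Rs \<AA> as)) = (q, t, h)"
    and q: "q \<in> states M" and t: "tape_ok (alphabet M) D v r lo hi t pos" and h: "lo \<le> h" "h \<le> hi"
    and H: "val v Head = pos h" and C: "val v Curr = val v (Sta q)"
    unfolding inv_main_def by blast
  note bs = base_simps[OF b]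
  have s: "tm_state M (enc ar Rs \<AA> as) n = q" by (simp add: tm_state_def c)
  have a: "t h \<in> alphabet M" and bl: "\<And>i. i < lo \<or> hi < i \<Longrightarrow> t i = Blank"
    using t by (auto simp: tape_ok_def)
  have "det I (Act k q (t h)) D v r S"
  proof (cases "q \<in> acc M \<union> rej M")
    case True
    then show ?thesis using acc rej s by (auto simp: Act_def intro!: det_Verum det_Neg_Verum)
  next
    case False
    obtain q' a' d where dl: "delta M q (t h) = (q', a', d)" by (cases "delta M q (t h)")
    have "delta M q (t h) \<in> states M \<times> alphabet M \<times> UNIV"
      using wf_M q a False by (auto simp: wf_tm_def)
    with dl have q': "q' \<in> states M" "a' \<in> alphabet M" by auto
    have step: "(tm_step M ^^ Suc n) (init_config M (enc ar Rs \<AA> as)) = (q', t(h := a'), h + shift d)"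
      using c dl False by simp
    have "det I (Prepend (Sym Blank) (Append (Sym Blank) (Del 2 Head (Sym (t h)) (Put 2 Head (Sym a')
          (Move d (Assign (nm Curr) (nm (Sta q')) (Jump k))))))) D v r S"
    proof (rule det_Prepend[OF t bs(1)])
      fix c1 v1 r1
      assume c1: "c1 \<notin> D" "agree {Cell, Tmp1, Tmp2, LeftEnd} v v1"
        and t1: "tape_ok (alphabet M) (insert c1 D) v1 r1 (lo - 1) hi (t(lo - 1 := Blank)) (pos(lo - 1 := c1))"
      let ?D1 = "insert c1 D"
      have b1: "base ?D1 v1" using bs(1) by (intro base_mono[OF b c1(2)]) auto
      note bs1 = base_simps[OF b1]
      show "det I (Append (Sym Blank) (Del 2 Head (Sym (t h)) (Put 2 Head (Sym a')
          (Move d (Assign (nm Curr) (nm (Sta q')) (Jump k)))))) ?D1 v1 r1 S"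
      proof (rule det_Append[OF t1 bs1(1)])
        fix c2 v2 r2
        assume c2: "c2 \<notin> ?D1" "agree {Cell, Tmp1, Tmp2, RightEnd} v1 v2"
          and t2: "tape_ok (alphabet M) (insert c2 ?D1) v2 r2 (lo - 1) (hi + 1)
            ((t(lo - 1 := Blank))(hi + 1 := Blank)) ((pos(lo - 1 := c1))(hi + 1 := c2))"
        define D2 where "D2 = insert c2 ?D1"
        define pos2 where "pos2 = (pos(lo - 1 := c1))(hi + 1 := c2)"
        \<comment> \<open>Everything outside the represented interval is blank, so extending the
          tape at both ends does not change its contents.\<close>
        have tt: "(t(lo - 1 := Blank))(hi + 1 := Blank) = t" using bl by (auto simp: fun_eq_iff)
        note t2 = t2[folded D2_def pos2_def, unfolded tt]
        have b2: "base D2 v2" using bs1(1) unfolding D2_def by (intro base_mono[OF b1 c2(2)]) auto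
        note bs2 = base_simps[OF b2]
        have "agree {Cell, Tmp1, Tmp2, LeftEnd, RightEnd} v v2"
          using agree_trans[OF c1(2) c2(2)] by (rule agree_mono) auto
        then have H2: "val v2 Head = pos2 h" using agreeD[of _ v v2 Head] H h by (simp add: pos2_def)
        have hD: "pos2 h \<in> D2" using tape_ok_pos[OF t2, of h] h by simp
        show "det I (Del 2 Head (Sym (t h)) (Put 2 Head (Sym a')
          (Move d (Assign (nm Curr) (nm (Sta q')) (Jump k))))) (insert c2 ?D1) v2 r2 S"
          unfolding D2_def[symmetric]
        proof (intro det_Del det_Put)
          let ?v3 = "clobber v2 Head (Sym (t h))"
          let ?v4 = "clobber ?v3 Head (Sym a')"
          let ?r3 = "r2(symR := r2 symR - {[val v2 Head, val v2 (Sym (t h))]})"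
          let ?r4 = "?r3(symR := insert [val ?v3 Head, val ?v3 (Sym a')] (?r3 symR))"
          have ag: "agree {Tmp1, Tmp2} v2 ?v4" by (intro agree_clobber) auto
          have b4: "base D2 ?v4" using bs2(1) by (intro base_mono[OF b2 ag]) auto
          have t4: "tape_ok (alphabet M) D2 ?v4 ?r4 (lo - 1) (hi + 1) (t(h := a')) pos2"
            by (rule tape_ok_write[OF t2 _ _ q'(2) ag]) (use h H2 in auto)
          show "det I (Move d (Assign (nm Curr) (nm (Sta q')) (Jump k))) D2 ?v4 ?r4 S"
          proof (rule det_Move[OF t4])
            fix v5 assume v5: "agree {Elem, Head} ?v4 v5" "val v5 Head = pos2 (h + shift d)"
            have b5: "base D2 v5" using bs2(1) by (intro base_mono[OF b4 v5(1)]) auto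
            show "det I (Assign (nm Curr) (nm (Sta q')) (Jump k)) D2 v5 ?r4 S"
            proof (intro det_Assign det_Jump k)
              show "tm_state M (enc ar Rs \<AA> as) n \<notin> acc M \<union> rej M" using False s by simp
              let ?v6 = "v5(nm Curr := v5 (nm (Sta q')))"
              have ag6: "agree {Elem, Head, Curr} ?v4 ?v6"
                using agree_mono[OF v5(1), of "{Elem, Head, Curr}"] by (intro agree_upd) auto
              have "base D2 ?v6" using bs2(1) by (intro base_mono[OF b4 ag6]) auto
              moreover have "tape_ok (alphabet M) D2 ?v6 ?r4 (lo - 1) (hi + 1) (t(h := a')) pos2"
                using t4 ag6 by (rule tape_ok_cong) auto
              moreover have "lo - 1 \<le> h + shift d" "h + shift d \<le> hi + 1"
                using h by (cases d; simp)+
              moreover have "?v6 (nm Head) = pos2 (h + shift d)" "?v6 (nm Curr) = ?v6 (nm (Sta q'))"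
                using v5(2) by simp_all
              ultimately show "inv_main as (Suc n) D2 ?v6 ?r4"
                using o q'(1) step unfolding inv_main_def by blast
            qed (use base_simps(5)[OF b5 q'(1)] in auto)
          qed (use h H2 in auto)
        qed (use bs2(4) a q' hD H2 in auto)
      qed (use bs1(4) in auto)
    qed (use bs(4) in auto)
    with False dl show ?thesis by (simp add: Act_def)
  qed
  then show ?thesis unfolding Step_def
    using tape_ok_sym_iff[OF t h] H q a qs(2) ss(2)
    by (intro det_Dispatch[OF b q C a]) auto
qed


text \<open>
  Each loop position carries a measure that decreases from one label to the next: the phase of the
  program together with the number of remaining elements, tuples, or (if the machine halts)
  computation steps.
\<close>

definition halt_time :: "'a list \<Rightarrow> nat" where
  "halt_time as = (LEAST n. tm_state M (enc ar Rs \<AA> as) n \<in> acc M \<union> rej M)"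

inductive Inv :: "nat \<times> nat \<Rightarrow> nat \<Rightarrow> 'a set \<Rightarrow> (nat \<Rightarrow> 'a) \<Rightarrow> (relvar \<Rightarrow> 'a list set) \<Rightarrow> bool" where
  list: "inv_list as D v r \<Longrightarrow> Inv (Suc (length Rs), card (univ \<AA> - set as)) 0 D v r"
| enc: "inv_enc as dn R rest pre post D v r \<Longrightarrow> Inv (Suc (length rest), length post) (Suc (length dn)) D v r"
| main: "inv_main as n D v r \<Longrightarrow> Inv (0, halt_time as - n) (Suc (length Rs)) D v r"

text \<open>The first component of the measure at the next label is just \<open>length rest\<close>:
  zero for the machine loop, and the successor of the number of later relations for an encoding
  loop. It is therefore smaller than in the phase being left.\<close>

lemma det_Encode_Inv:
  assumes "ready as (input_word as dn []) D v r" "Rs = dn @ rest"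
    and "\<And>n k D' v' r'. Inv (length rest, n) k D' v' r' \<Longrightarrow> At k D' v' r' \<in> S"
  shows "det I (Encode (Suc (length dn)) rest) D v r S"
proof (rule det_Encode[OF assms(1,2)])
  fix D' v' r' assume "rest = []" "inv_main as 0 D' v' r'"
  then show "At (Suc (length Rs)) D' v' r' \<in> S" by (intro assms(3)) (auto intro: main)
next
  fix R rest' post D' v' r'
  assume "rest = R # rest'" "inv_enc as dn R rest' [] post D' v' r'"
  then show "At (Suc (length dn)) D' v' r' \<in> S" by (intro assms(3)) (auto intro: enc)
qed

text \<open>\<open>H\<close> is tied to the machine for every ordering of the domain, since the
  order actually listed depends on the play.\<close>

lemma det_Inv:
  assumes inv: "Inv i k D v r"
    and acc: "\<And>as. ordering_of as (univ \<AA>) \<Longrightarrow> accepts M (enc ar Rs \<AA> as) \<longleftrightarrow> H True"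
    and rej: "\<And>as. ordering_of as (univ \<AA>) \<Longrightarrow> rejects M (enc ar Rs \<AA> as) \<longleftrightarrow> H False"
  shows "\<exists>\<chi>. (k, \<chi>) \<in> labset Sentence \<and> det I \<chi> D v r ({Halt c | c. H c} \<union>
      {At k' D' v' r' | j k' D' v' r'. Inv j k' D' v' r' \<and>
        (H True \<or> H False \<longrightarrow> (j, i) \<in> less_than <*lex*> less_than)})"
    (is "\<exists>\<chi>. _ \<and> det I \<chi> D v r (?S i)")
proof -
  have At: "At k D v r \<in> ?S i" if "Inv j k D v r" "(j, i) \<in> less_than <*lex*> less_than" for i j k D v r
    using that by blast
  show ?thesis using inv
  proof cases
    case (list as)
    have as: "set as \<subseteq> univ \<AA>" using list(3) by (simp add: inv_list_def)
    have "det I list_body D v r (?S i)"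
    proof (rule det_list_body[OF list(3)])
      fix x D' v' r' assume x: "x \<in> univ \<AA> - set as" "inv_list (as @ [x]) D' v' r'"
      have "univ \<AA> - set (as @ [x]) \<subset> univ \<AA> - set as" using x(1) by auto
      then have "card (univ \<AA> - set (as @ [x])) < card (univ \<AA> - set as)"
        using fin by (intro psubset_card_mono) auto
      then show "At 0 D' v' r' \<in> ?S i" using list(1) by (intro At[OF Inv.list[OF x(2)]]) simp
    next
      fix D' v' r' assume rd: "ready as (input_word as [] []) D' v' r'"
      have "det I (Encode (Suc (length ([] :: 'r list))) Rs) D' v' r' (?S i)"
        by (rule det_Encode_Inv[OF rd]) (use list(1) in \<open>auto intro!: At\<close>)
      then show "det I (Encode 1 Rs) D' v' r' (?S i)" by simp
    qed
    then show ?thesis using list(2) labset_Sentence by blast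
  next
    case (enc as dn R rest pre post)
    have Rs: "Rs = dn @ R # rest" using enc(3) by (simp add: inv_enc_def)
    have "det I (enc_body (Suc (length dn)) R rest) D v r (?S i)"
    proof (rule det_enc_body[OF enc(3)])
      fix post' D' v' r' t assume "post = t # post'"
        "inv_enc as dn R rest (pre @ [map (val v) (tups R)]) post' D' v' r'"
      then show "At (Suc (length dn)) D' v' r' \<in> ?S i" using enc(1) by (intro At[OF Inv.enc]) auto
    next
      fix D' v' r' assume rd: "ready as (input_word as (dn @ [R]) []) D' v' r'"
      show "det I (Encode (Suc (length (dn @ [R]))) rest) D' v' r' (?S i)"
        by (rule det_Encode_Inv[OF rd]) (use enc(1) Rs in \<open>auto intro!: At\<close>)
    qed
    then show ?thesis using enc(2) Rs labset_Sentence enc_body_in_labset[of 1 dn R rest] by auto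
  next
    case (main as n)
    let ?w = "enc ar Rs \<AA> as"
    have o: "ordering_of as (univ \<AA>)" using main(3) by (simp add: inv_main_def)
    have "det I (Step k) D v r (?S i)"
    proof (rule det_Step[OF main(3)])
      assume "tm_state M ?w n \<in> acc M"
      then show "Halt True \<in> ?S i" using acc[OF o] by (auto simp: accepts_def)
    next
      assume "tm_state M ?w n \<in> rej M"
      then show "Halt False \<in> ?S i" using rej[OF o] by (auto simp: rejects_def)
    next
      fix D' v' r'
      assume nh: "tm_state M ?w n \<notin> acc M \<union> rej M" and m: "inv_main as (Suc n) D' v' r'"
      \<comment> \<open>If there is an answer, the machine halts, and halted states persist. A
        machine still running after \<open>n\<close> steps thus has \<open>n < halt_time as\<close>,
        which makes the truncated subtraction decrease strictly.\<close>
      have "halt_time as - Suc n < halt_time as - n" if "H True \<or> H False"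
      proof -
        have "\<exists>n. tm_state M ?w n \<in> acc M \<union> rej M"
          using that acc[OF o] rej[OF o] by (auto simp: accepts_def rejects_def)
        then have "tm_state M ?w (halt_time as) \<in> acc M \<union> rej M"
          unfolding halt_time_def by (rule LeastI_ex)
        then have "n < halt_time as" using nh tm_state_mono[of M ?w "halt_time as" n] by (metis not_le)
        then show ?thesis by simp
      qed
      with Inv.main[OF m] main(1,2) show "At k D' v' r' \<in> ?S i" by auto
    qed
    then show ?thesis using main(2) labset_Sentence Step_in_labset[of 1 Rs] by auto
  qed
qed

section \<open>Initialisation and conclusion\<close>

lemma det_foldr_Exi:
  assumes "D \<noteq> {}" "\<And>v'. det J \<phi> D v' r S"
  shows "det J (foldr Exi xs \<phi>) D v r S"
  using assms by (induction xs arbitrary: v) (auto intro: det_Exi)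

lemma det_foldr_Clear:
  assumes "D \<noteq> {}" "\<And>v'. det J \<phi> D v' (\<lambda>_. {}) S"
  shows "det J (foldr Clear Xs \<phi>) D v (\<lambda>_. {}) S"
  using assms(2)
proof (induction Xs arbitrary: v)
  case (Cons X Xs)
  obtain a where "a \<in> D" using assms(1) by blast
  then have ne: "tuples 2 D \<noteq> {}" using tuples_2[of "[a, a]" D] by blast
  have e: "(\<lambda>_. {})(X := {}) = (\<lambda>_. {})" by auto
  have "det J (Clear X (foldr Clear Xs \<phi>)) D v (\<lambda>_. {}) S"
  proof (rule det_choice[where D' = "\<lambda>_. D" and v' = "upd v [nm Tmp1, nm Tmp2]" and r' = "\<lambda>_ _. {}", OF ne])
    show "det J (foldr Clear Xs \<phi>) D (upd v [nm Tmp1, nm Tmp2] bs) (\<lambda>_. {}) S" for bs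
      by (rule Cons.IH) (rule Cons.prems)
    show "ev J Q b (Clear X (foldr Clear Xs \<phi>)) D v (\<lambda>_. {}) = choice b (tuples 2 D)
        (\<lambda>bs. ev J Q b (foldr Clear Xs \<phi>) D (upd v [nm Tmp1, nm Tmp2] bs) (\<lambda>_. {}))" for Q b
      by (cases b) (simp_all add: Clear_def choice_def numeral_2_eq_2 e)
  qed
  then show ?case by simp
qed simp

text \<open>At the start exactly the inserted elements are marked, so the whole domain awaits
  listing; the successor chain consists of \<open>Zero\<close> alone, which matches the empty
  \<open>ordR\<close>.\<close>

lemma det_Setup:
  "det I Setup (univ \<AA>) v (\<lambda>_. {}) {At k D v r | i k D v r. Inv i k D v r}"
  unfolding Setup_def
proof (rule det_News[OF fin])
  show "set constants \<inter> {Tmp1, Tmp2} = {}" "distinct constants"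
    using qs ss by (auto simp: constants_def distinct_map inj_on_def)
  fix D v1
  assume D: "finite D" "univ \<AA> \<subseteq> D" "agree (set constants \<union> {Tmp1, Tmp2}) v v1"
    "inj_on (val v1) (set constants)" "val v1 ` set constants \<subseteq> D - univ \<AA>"
  let ?r1 = "(\<lambda>_. {})(markR := {} \<union> {[a, a] | a. a \<in> D - univ \<AA>})"
  let ?S = "{At k D v r | i k D v r. Inv i k D v r}"
  have b1: "base D v1" using D by (auto simp: base_def)
  show "det I (New Cell (Put 2 Cell (Sym Blank) (Assign (nm LeftEnd) (nm Cell)
     (Assign (nm RightEnd) (nm Cell) (Assign (nm Last) (nm Zero) (Lab 0 list_body)))))) D v1 ?r1 ?S"
  proof (rule det_New[OF D(1)])
    fix c v2
    assume c: "c \<notin> D" "agree {Cell, Tmp1, Tmp2} v1 v2" "v2 (nm Cell) = c"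
    let ?D = "insert c D"
    let ?r2 = "?r1(markR := insert [c, c] (?r1 markR))"
    have b2: "base ?D v2" using D(1) by (intro base_mono[OF b1 c(2)]) auto
    note bs2 = base_simps[OF b2]
    show "det I (Put 2 Cell (Sym Blank) (Assign (nm LeftEnd) (nm Cell)
     (Assign (nm RightEnd) (nm Cell) (Assign (nm Last) (nm Zero) (Lab 0 list_body))))) ?D v2 ?r2 ?S"
    proof (intro det_Put det_Assign det_Lab)
      let ?v3 = "clobber v2 Cell (Sym Blank)"
      let ?v4 = "?v3(nm LeftEnd := ?v3 (nm Cell))"
      let ?v5 = "?v4(nm RightEnd := ?v4 (nm Cell))"
      let ?v6 = "?v5(nm Last := ?v5 (nm Zero))"
      let ?r3 = "?r2(symR := insert [val v2 Cell, val v2 (Sym Blank)] (?r2 symR))"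
      have ag: "agree {Tmp1, Tmp2, LeftEnd, RightEnd, Last} v2 ?v6"
        by (intro agree_upd agree_clobber) auto
      have b6: "base ?D ?v6" using bs2(1) by (intro base_mono[OF b2 ag]) auto
      have z: "val v2 Zero = val v1 Zero" using agreeD[OF c(2)] by simp
      have "val v1 Zero \<in> D - univ \<AA>" using D(5) by (auto simp: constants_def)
      then have z': "?v6 (nm Zero) \<notin> univ \<AA>" using z by simp
      have "range (tape_of []) \<subseteq> alphabet M" by (auto simp: tape_of_def)
      then have "tape_ok (alphabet M) ?D ?v6 ?r3 (-1) (-1) (tape_of []) (\<lambda>_. c)"
        using c(3) by (auto simp: tape_ok_def tape_of_def)
      then have "tape_word ?D ?v6 ?r3 []" by (auto simp: tape_word_def)
      moreover have "\<forall>x\<in>?D. [x, x] \<in> ?r3 markR \<longleftrightarrow> x \<notin> univ \<AA> - set []"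
        using c(1) D(2) by auto
      ultimately have "inv_list [] ?D ?v6 ?r3" using b6 z' by (simp add: inv_list_def)
      from Inv.list[OF this] show "At 0 ?D ?v6 ?r3 \<in> ?S" by blast
    qed (use c(3) bs2 in auto)
  qed simp
qed

lemma sat_Sentence_iff:
  assumes "\<And>as. ordering_of as (univ \<AA>) \<Longrightarrow> accepts M (enc ar Rs \<AA> as) \<longleftrightarrow> H True"
    and "\<And>as. ordering_of as (univ \<AA>) \<Longrightarrow> rejects M (enc ar Rs \<AA> as) \<longleftrightarrow> H False"
    and "\<not> (H True \<and> H False)"
  shows "sat \<AA> (player_sign b) Sentence \<longleftrightarrow> H b"
proof (rule sat_iff_outcome[where Inv = Inv, OF norel_Sentence structured_Sentence _ _ _ assms(3)])
  show "wf (less_than <*lex*> less_than)" by blast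
  show "det I Sentence (univ \<AA>) v (\<lambda>_. {}) {At k D v r | i k D v r. Inv i k D v r}" for v
    unfolding Sentence_def by (intro det_foldr_Exi det_foldr_Clear det_Setup ne)
qed (rule det_Inv[OF _ assms(1,2)])

end

theorem theorem3:
  fixes \<tau> :: "'r set" and ar :: "'r \<Rightarrow> nat"
    and Cp Cm C0 :: "('a::infinite, 'r) model set"
    and M :: tm
  assumes "finite \<tau>"
    and "turing_classification \<tau> ar Cp Cm C0"
    and "witnesses \<tau> ar Cp Cm C0 M"
  shows "\<exists>\<phi>. \<phi> \<in> logic_L \<tau> ar \<and> sentence \<phi> \<and>
           (\<forall>\<AA> :: ('a, 'r) model. finite_model \<tau> ar \<AA> \<longrightarrow>
              (\<AA> \<Turnstile>\<^sup>+ \<phi> \<longleftrightarrow> \<AA> \<in> Cp) \<and> (\<AA> \<Turnstile>\<^sup>- \<phi> \<longleftrightarrow> \<AA> \<in> Cm))"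
proof -
  from assms(3) obtain Rs where wf: "wf_tm M" and Rs: "ordering_of Rs \<tau>"
    and w: "\<And>(\<AA> :: ('a, 'r) model) as. finite_model \<tau> ar \<AA> \<Longrightarrow> ordering_of as (univ \<AA>) \<Longrightarrow>
      (accepts M (enc ar Rs \<AA> as) \<longleftrightarrow> \<AA> \<in> Cp) \<and> (rejects M (enc ar Rs \<AA> as) \<longleftrightarrow> \<AA> \<in> Cm)"
    unfolding witnesses_def by blast
  have fin: "finite (states M)" "finite (alphabet M)" using wf by (simp_all add: wf_tm_def)
  obtain qs where qs: "set qs = states M" "distinct qs"
    using finite_distinct_list[OF fin(1)] by blast
  obtain ss where ss: "set ss = alphabet M" "distinct ss"
    using finite_distinct_list[OF fin(2)] by blast
  interpret tm_program ar Rs M qs ss by unfold_locales (use wf qs ss in simp_all)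
  have "\<AA> \<Turnstile>\<^sup>+ Sentence \<longleftrightarrow> \<AA> \<in> Cp" "\<AA> \<Turnstile>\<^sup>- Sentence \<longleftrightarrow> \<AA> \<in> Cm"
    if A: "finite_model \<tau> ar \<AA>" for \<AA> :: "('a, 'r) model"
  proof -
    interpret tm_simulation ar Rs M qs ss \<AA>
      by unfold_locales (use A in \<open>simp_all add: finite_model_def\<close>)
    \<comment> \<open>Membership in the classes depends on the structure alone, so one
      \<open>?H\<close> answers for all orderings; disjointness of \<open>Cp\<close> and
      \<open>Cm\<close> makes the two answers exclusive.\<close>
    let ?H = "\<lambda>b. \<AA> \<in> (if b then Cp else Cm)"
    have "Cp \<inter> Cm = {}" using assms(2) by (simp add: turing_classification_def)
    then have "\<not> (?H True \<and> ?H False)" by auto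
    then have "sat \<AA> (player_sign b) Sentence \<longleftrightarrow> ?H b" for b
      by (intro sat_Sentence_iff[where H = ?H]) (use w[OF A] in simp_all)
    from this[of True] this[of False] show "\<AA> \<Turnstile>\<^sup>+ Sentence \<longleftrightarrow> \<AA> \<in> Cp" "\<AA> \<Turnstile>\<^sup>- Sentence \<longleftrightarrow> \<AA> \<in> Cm"
      by (simp_all add: player_sign_def)
  qed
  moreover have "Sentence \<in> logic_L \<tau> ar" using Rs by (intro Sentence_in_logic) (simp add: ordering_of_def)
  ultimately show ?thesis using sentence_Sentence by blast
qed

end
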